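(* Let $G_n : S_n\times S_n\to\mathbb{R}$ be the random variable $G_n(\sigma,\tau)=1-\frac{\chi(S(\sigma,\tau))}{2}$, where $(\sigma,\tau)$ is uniformly distributed on $S_n\times S_n$. Let $A(n)=\sum_{i=1}^n \frac1i$ and $B(n)=\sum_{i=1}^n\left(\frac1i-\frac1{i^2}\right)$. Fix $a\in\mathbb{R}_{>0}$. Then, as $n\to\infty$, uniformly (i.e. with the constant in the $O(\cdot)$ term depending only on $a$) over all integers $\ell$ such that $n-\ell$ is even and $\frac{\ell-A(n)}{\sqrt{B(n)}}\in[-a,a]$, $$\Pr\left[G_n=\frac n2-\frac{\ell}{2}+1\right]=\frac{\left(2+O\left((\log n)^{-1/2}\right)\right)\exp\left(-\frac{(\ell-A(n))^2}{2B(n)}\right)}{\sqrt{2\pi B(n)}}.$$ Hence $G_n$ is asymptotically normal (i.e. $(G_n-\mathbb{E}[G_n])/\sqrt{\operatorname{Var}[G_n]}$ converges in distribution to a standard normal random variable), with mean and variance $$\mathbb{E}[G_n]=\frac n2-\frac{\log n}{2}-\frac{\gamma}{2}+1+o(1),\qquad \operatorname{Var}[G_n]=\frac{\log n}{4}+\frac{\gamma}{4}-\frac{\pi^2}{24}+o(1),$$ where $\gamma\approx 0.577$ is the Euler–Mascheroni constant.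
   Context: $S_n$ is the symmetric group on $\{1,\dots,n\}$. For $(\sigma,\tau)\in S_n\times S_n$, $S(\sigma,\tau)$ is the (possibly disconnected) closed square-tiled surface obtained from $n$ unit squares labelled $1,\dots,n$ by gluing sides by translations: for each $i$, the right side of square $i$ is glued to the left side of square $\sigma(i)$, and the top side of square $i$ is glued to the bottom side of square $\tau(i)$. $\chi(S)$ denotes the Euler characteristic. When $S(\sigma,\tau)$ is connected, $G_n(\sigma,\tau)$ is its genus. *)

theory Defs
  imports "HOL-Probability.Probability" "HOL-Combinatorics.Permutations"
begin

text \<open>The point \<open>(i, x, y)\<close> is the point with coordinates \<open>(x, y) \<in> [0,1]\<^sup>2\<close> of the unit
  square labelled \<open>i\<close>.\<close>

type_synonym point = "nat \<times> real \<times> real"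

definition squares :: "nat \<Rightarrow> point set" where
  "squares n = {1..n} \<times> {0..1} \<times> {0..1}"

inductive gluing :: "nat \<Rightarrow> (nat \<Rightarrow> nat) \<Rightarrow> (nat \<Rightarrow> nat) \<Rightarrow> point \<Rightarrow> point \<Rightarrow> bool"
  for n :: nat and \<sigma> \<tau> :: "nat \<Rightarrow> nat" where
  right_left: "i \<in> {1..n} \<Longrightarrow> y \<in> {0..1} \<Longrightarrow> gluing n \<sigma> \<tau> (i, 1, y) (\<sigma> i, 0, y)"
| top_bottom: "i \<in> {1..n} \<Longrightarrow> x \<in> {0..1} \<Longrightarrow> gluing n \<sigma> \<tau> (i, x, 1) (\<tau> i, x, 0)"

text \<open>A point of the surface is a class of the equivalence relation generated by the gluings.\<close>

definition surface_point :: "nat \<Rightarrow> (nat \<Rightarrow> nat) \<Rightarrow> (nat \<Rightarrow> nat) \<Rightarrow> point \<Rightarrow> point set" where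
  "surface_point n \<sigma> \<tau> p = {q \<in> squares n. equivclp (gluing n \<sigma> \<tau>) p q}"

definition surface :: "nat \<Rightarrow> (nat \<Rightarrow> nat) \<Rightarrow> (nat \<Rightarrow> nat) \<Rightarrow> point set set" where
  "surface n \<sigma> \<tau> = surface_point n \<sigma> \<tau> ` squares n"

text \<open>The subsets of the disjoint union of the squares whose images are the open cells of the
  surface: corners, open sides (left, right, bottom, top), open squares.\<close>

definition corners :: "nat \<Rightarrow> point set set" where
  "corners n = {{i} \<times> {x} \<times> {y} | i x y. i \<in> {1..n} \<and> x \<in> {0, 1} \<and> y \<in> {0, 1}}"

definition open_sides :: "nat \<Rightarrow> point set set" where
  "open_sides n =
     {{i} \<times> {x} \<times> {0<..<1} | i x. i \<in> {1..n} \<and> x \<in> {0, 1}} \<union>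
     {{i} \<times> {0<..<1} \<times> {y} | i y. i \<in> {1..n} \<and> y \<in> {0, 1}}"

definition open_squares :: "nat \<Rightarrow> point set set" where
  "open_squares n = {{i} \<times> {0<..<1} \<times> {0<..<1} | i. i \<in> {1..n}}"

text \<open>The cells are subsets of \<open>surface n \<sigma> \<tau>\<close>: sides and corners that are glued together have the same
  image and so are counted once.\<close>

definition vertices :: "nat \<Rightarrow> (nat \<Rightarrow> nat) \<Rightarrow> (nat \<Rightarrow> nat) \<Rightarrow> point set set set" where
  "vertices n \<sigma> \<tau> = (\<lambda>c. surface_point n \<sigma> \<tau> ` c) ` corners n"

definition edges :: "nat \<Rightarrow> (nat \<Rightarrow> nat) \<Rightarrow> (nat \<Rightarrow> nat) \<Rightarrow> point set set set" where
  "edges n \<sigma> \<tau> = (\<lambda>c. surface_point n \<sigma> \<tau> ` c) ` open_sides n"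

definition faces :: "nat \<Rightarrow> (nat \<Rightarrow> nat) \<Rightarrow> (nat \<Rightarrow> nat) \<Rightarrow> point set set set" where
  "faces n \<sigma> \<tau> = (\<lambda>c. surface_point n \<sigma> \<tau> ` c) ` open_squares n"

text \<open>The Euler characteristic of the surface, computed from its cell decomposition.\<close>

definition euler_char :: "nat \<Rightarrow> (nat \<Rightarrow> nat) \<Rightarrow> (nat \<Rightarrow> nat) \<Rightarrow> int" where
  "euler_char n \<sigma> \<tau> =
     int (card (vertices n \<sigma> \<tau>)) - int (card (edges n \<sigma> \<tau>)) + int (card (faces n \<sigma> \<tau>))"

definition G :: "nat \<Rightarrow> (nat \<Rightarrow> nat) \<times> (nat \<Rightarrow> nat) \<Rightarrow> real" where
  "G n = (\<lambda>(\<sigma>, \<tau>). 1 - real_of_int (euler_char n \<sigma> \<tau>) / 2)"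

definition sym_group :: "nat \<Rightarrow> (nat \<Rightarrow> nat) set" where
  "sym_group n = {\<pi>. \<pi> permutes {1..n}}"

definition unif_pairs :: "nat \<Rightarrow> ((nat \<Rightarrow> nat) \<times> (nat \<Rightarrow> nat)) pmf" where
  "unif_pairs n = pmf_of_set (sym_group n \<times> sym_group n)"

definition A :: "nat \<Rightarrow> real" where
  "A n = (\<Sum>i = 1..n. 1 / real i)"

definition B :: "nat \<Rightarrow> real" where
  "B n = (\<Sum>i = 1..n. 1 / real i - 1 / (real i)\<^sup>2)"

definition mean_G :: "nat \<Rightarrow> real" where
  "mean_G n = measure_pmf.expectation (unif_pairs n) (G n)"

definition var_G :: "nat \<Rightarrow> real" where
  "var_G n = measure_pmf.variance (unif_pairs n) (G n)"

end

theory Submission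
  imports Defs "Jordan_Normal_Form.Jordan_Normal_Form_Existence" "HOL-Real_Asymp.Real_Asymp"
begin

text \<open>The number \<open>V\<close> of vertices of the surface is the number of cycles of the commutator of \<open>\<sigma>\<close> and \<open>\<tau>\<close>,
  and \<open>G = n/2 - V/2 + 1\<close>.  The generating function of \<open>V\<close> is a sum over partitions,
  \<open>n! E[q^V] = \<Sum>\<lambda>. \<Prod>b \<in> \<lambda>. (q + c(b))\<close>,
  where \<open>c(b)\<close> is the content of the box \<open>b\<close>: the left-hand side is the trace of convolution by
  \<open>q ^ cycles\<close> on class functions.  The eigenvalues are found without representation theory.  If
  \<open>m\<close> is the largest size of a block whose symmetrizer does not kill the eigenfunction \<open>f\<close>, then
  symmetrizing \<open>f\<close> over \<open>m\<close> points yields an eigenfunction on the other \<open>n - m\<close> points with \<open>q\<close> replaced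
  by \<open>q - 1\<close>, and the eigenvalue loses the factor of a first row of length \<open>m\<close>; iterating gives the
  content product of a partition, and for generic \<open>q\<close> all eigenvalues are simple.  It is enough to
  know that the trace is a sum over \<open>some\<close> set of partitions containing the row and the column.

  The row and the column contribute the rising and the falling factorial, that is, twice the law of
  the cycle count of a uniform permutation restricted to the right parity.  The remaining terms are
  smaller by a factor \<open>n\<close>, even coefficientwise with weights \<open>(3/2)^v\<close>.  The cycle count of a uniform
  permutation has the law of a sum of independent Bernoulli variables of parameters \<open>1/i\<close>, with mean
  \<open>A n\<close> and variance \<open>B n\<close>, so its local limit theorem follows from Fourier inversion, and the
  central limit theorem from Levy's continuity theorem.\<close>

text \<open>The spectral argument only shows which numbers can be eigenvalues, while the trace also
  needs their multiplicities. Genericity of \<open>q\<close> settles this: distinct partitions have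
  distinct content products, so an eigenvalue determines its first row, and induction on the rows
  shows that eigenfunctions are unique up to scalars. As the kernel is Hermitian for real
  \<open>q\<close>, the trace is then the sum of the distinct nonzero eigenvalues. The values of
  \<open>q\<close> at which, after some integer shift, a content polynomial vanishes or two of them
  collide form a countable set. That the set of occurring partitions stays unknown is harmless,
  because the remainder is bounded by absolute values over all partitions. The weight
  \<open>(3/2) ^ v\<close> needs a base above 1 to control the first two moments, and below 2
  because the rising factorial of \<open>x\<close> exceeds \<open>n!\<close> by about
  \<open>n ^ (x - 1)\<close>, which eats into the gain of a factor \<open>n\<close>; at
  \<open>x = 3/2\<close> an error of order \<open>1 / sqrt n\<close> is left. This beats every power
  of \<open>log n\<close>, so the error in the local limit theorem is that of the uniform
  permutation, of relative order \<open>1 / sqrt (B n)\<close>.\<close>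

no_notation m_inv (\<open>(\<open>open_block notation=\<open>prefix inv\<close>\<close>inv\<index> _)\<close> [81] 80)

section \<open>Vertices as cycles of the commutator\<close>

text \<open>Cycles are classes of a generated equivalence, as points of the surface are, so the two
  can be compared by checking generating pairs only.\<close>

definition cyc_class :: "('a \<Rightarrow> 'a) \<Rightarrow> 'a \<Rightarrow> 'a set" where
  "cyc_class g x = {y. equivclp (\<lambda>u v. v = g u) x y}"

definition ncyc :: "'a set \<Rightarrow> ('a \<Rightarrow> 'a) \<Rightarrow> nat" where
  "ncyc X g = card (cyc_class g ` X)"

lemma equivclp_const:
  assumes "equivclp R x y" and "\<And>u v. R u v \<Longrightarrow> F u = F v"
  shows "F x = F y"
  using assms(1) by (induction rule: equivclp_induct) (use assms(2) in auto)

lemma equivclp_map: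
  assumes "equivclp R x y" and "\<And>u v. R u v \<Longrightarrow> equivclp Q (F u) (F v)"
  shows "equivclp Q (F x) (F y)"
  using assms(1)
proof (induction rule: equivclp_induct)
  case base then show ?case by simp
next
  case (step y z)
  then show ?case using assms(2) by (meson equivclp_sym equivclp_trans)
qed

lemma equivclp_class_eq: "{z. equivclp R x z} = {z. equivclp R y z} \<longleftrightarrow> equivclp R x y"
proof
  assume "{z. equivclp R x z} = {z. equivclp R y z}"
  moreover have "y \<in> {z. equivclp R y z}" by simp
  ultimately show "equivclp R x y" by blast
next
  assume xy: "equivclp R x y"
  have "equivclp R x z \<longleftrightarrow> equivclp R y z" for z
    using equivclp_trans[OF xy, of z] equivclp_trans[OF equivclp_sym[OF xy], of z] by blast
  then show "{z. equivclp R x z} = {z. equivclp R y z}" by simp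
qed

lemma cyc_class_eq_iff: "cyc_class g x = cyc_class g y \<longleftrightarrow> equivclp (\<lambda>u v. v = g u) x y"
  unfolding cyc_class_def by (rule equivclp_class_eq)

text \<open>The size of an image depends only on which points are identified. This compares cycle
  counts of different permutations, and vertices with cycles, without naming a bijection between
  classes.\<close>

lemma card_image_cong_kernel:
  assumes "\<And>x y. x \<in> X \<Longrightarrow> y \<in> X \<Longrightarrow> f x = f y \<longleftrightarrow> g x = g y"
  shows "card (f ` X) = card (g ` X)"
proof -
  define h where "h = (\<lambda>z. g (SOME x. x \<in> X \<and> f x = z))"
  have hf: "h (f x) = g x" if "x \<in> X" for x
    unfolding h_def using someI[of "\<lambda>y. y \<in> X \<and> f y = f x" x] assms that by metis
  have "inj_on h (f ` X)" using assms by (auto simp: inj_on_def hf)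
  moreover have "h ` (f ` X) = g ` X" using hf by (force simp: image_iff)
  ultimately show ?thesis by (metis card_image)
qed

lemma surface_point_eq_iff:
  assumes "p \<in> squares n" "q \<in> squares n"
  shows "surface_point n \<sigma> \<tau> p = surface_point n \<sigma> \<tau> q \<longleftrightarrow> equivclp (gluing n \<sigma> \<tau>) p q"
proof
  assume "surface_point n \<sigma> \<tau> p = surface_point n \<sigma> \<tau> q"
  then have "q \<in> surface_point n \<sigma> \<tau> p" using assms by (auto simp: surface_point_def)
  then show "equivclp (gluing n \<sigma> \<tau>) p q" by (simp add: surface_point_def)
next
  assume "equivclp (gluing n \<sigma> \<tau>) p q"
  then show "surface_point n \<sigma> \<tau> p = surface_point n \<sigma> \<tau> q"
    using equivclp_class_eq[of "gluing n \<sigma> \<tau>" p q] unfolding surface_point_def by blast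
qed

definition commutator :: "('a \<Rightarrow> 'a) \<Rightarrow> ('a \<Rightarrow> 'a) \<Rightarrow> 'a \<Rightarrow> 'a" where
  "commutator \<sigma> \<tau> = \<sigma> \<circ> \<tau> \<circ> inv \<sigma> \<circ> inv \<tau>"

context
  fixes n :: nat and \<sigma> \<tau> :: "nat \<Rightarrow> nat"
  assumes perm: "\<sigma> permutes {1..n}" "\<tau> permutes {1..n}"
begin

text \<open>The top right corner of square \<open>i\<close> is the bottom left corner both of
  \<open>\<tau> (\<sigma> i)\<close> and of \<open>\<sigma> (\<tau> i)\<close>. The commutator
  passes from one of these names to the other, so its cycles are the vertices.\<close>

lemma commutator_apply: "commutator \<sigma> \<tau> (\<tau> (\<sigma> i)) = \<sigma> (\<tau> i)"
  using perm by (simp add: commutator_def permutes_inverses)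

text \<open>The label records on which square a point lies after moving it to a left or bottom side where
  possible; at a corner only the cycle of the commutator is well defined.\<close>

definition glue_label :: "point \<Rightarrow> nat set \<times> real \<times> real" where
  "glue_label = (\<lambda>(i, x, y).
     let j = (if x = 1 then \<sigma> else id) ((if y = 1 then \<tau> else id) i);
         x' = (if x = 1 then 0 else x); y' = (if y = 1 then 0 else y)
     in (if x' = 0 \<and> y' = 0 then cyc_class (commutator \<sigma> \<tau>) j else {j}, x', y'))"

lemma glue_label_gluing: "gluing n \<sigma> \<tau> p q \<Longrightarrow> glue_label p = glue_label q"
proof (induction rule: gluing.induct)
  case (right_left i y)
  \<comment> \<open>Only the corner \<open>y = 1\<close> needs care: the label computes
    \<open>\<sigma> (\<tau> i)\<close> from one point and \<open>\<tau> (\<sigma> i)\<close> from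
    the other.\<close>
  have "cyc_class (commutator \<sigma> \<tau>) (\<tau> (\<sigma> i)) = cyc_class (commutator \<sigma> \<tau>) (\<sigma> (\<tau> i))"
    unfolding cyc_class_eq_iff by (rule r_into_equivclp) (simp add: commutator_apply)
  then show ?case by (auto simp: glue_label_def)
next
  case (top_bottom i x)
  then show ?case by (auto simp: glue_label_def)
qed

lemma surface_point_label:
  assumes "p \<in> squares n" "q \<in> squares n" "surface_point n \<sigma> \<tau> p = surface_point n \<sigma> \<tau> q"
  shows "glue_label p = glue_label q"
  using assms equivclp_const[of "gluing n \<sigma> \<tau>" p q glue_label] glue_label_gluing
  by (simp add: surface_point_eq_iff)

lemma in_range: "i \<in> {1..n} \<Longrightarrow> \<sigma> i \<in> {1..n}" "i \<in> {1..n} \<Longrightarrow> \<tau> i \<in> {1..n}"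
  by (simp_all only: permutes_in_image[OF perm(1)] permutes_in_image[OF perm(2)])

lemma surface_point_right:
  assumes "i \<in> {1..n}" "y \<in> {0..1}"
  shows "surface_point n \<sigma> \<tau> (i, 1, y) = surface_point n \<sigma> \<tau> (\<sigma> i, 0, y)"
  using assms in_range(1)[OF assms(1)]
  by (subst surface_point_eq_iff) (auto simp: squares_def intro!: r_into_equivclp gluing.intros)

lemma surface_point_top:
  assumes "i \<in> {1..n}" "x \<in> {0..1}"
  shows "surface_point n \<sigma> \<tau> (i, x, 1) = surface_point n \<sigma> \<tau> (\<tau> i, x, 0)"
  using assms in_range(2)[OF assms(1)]
  by (subst surface_point_eq_iff) (auto simp: squares_def intro!: r_into_equivclp gluing.intros)

lemma card_faces: "card (faces n \<sigma> \<tau>) = n"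
proof -
  define f where "f i = surface_point n \<sigma> \<tau> ` ({i} \<times> {0<..<1} \<times> {0<..<1})" for i
  have "open_squares n = (\<lambda>i. {i} \<times> {0<..<1} \<times> {0<..<1}) ` {1..n}"
    unfolding open_squares_def by (rule Setcompr_eq_image)
  then have "faces n \<sigma> \<tau> = f ` {1..n}"
    by (simp add: faces_def f_def[abs_def] image_image)
  moreover have "inj_on f {1..n}"
  proof (rule inj_onI)
    fix i j assume ij: "i \<in> {1..n}" "j \<in> {1..n}" "f i = f j"
    have "surface_point n \<sigma> \<tau> (i, 1/2, 1/2) \<in> f i" unfolding f_def by (rule imageI) auto
    then have "surface_point n \<sigma> \<tau> (i, 1/2, 1/2) \<in> surface_point n \<sigma> \<tau> ` ({j} \<times> {0<..<1} \<times> {0<..<1})"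
      unfolding ij(3) by (simp only: f_def)
    then obtain p where p: "p \<in> {j} \<times> {0<..<1} \<times> {0<..<1}"
      "surface_point n \<sigma> \<tau> (i, 1/2, 1/2) = surface_point n \<sigma> \<tau> p"
      by (elim imageE)
    then obtain x y where xy: "x \<in> {0<..<1}" "y \<in> {0<..<1}"
      "surface_point n \<sigma> \<tau> (i, 1/2, 1/2) = surface_point n \<sigma> \<tau> (j, x, y)"
      using that[of "fst (snd p)" "snd (snd p)"] by (cases p) simp
    have "glue_label (i, 1/2, 1/2) = glue_label (j, x, y)"
      by (rule surface_point_label[OF _ _ xy(3)]) (use xy ij in \<open>auto simp: squares_def\<close>)
    then show "i = j" using xy by (auto simp: glue_label_def Let_def split: if_splits)
  qed
  ultimately show ?thesis by (simp add: card_image)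
qed

text \<open>Gluing carries every right side to a left side and every top side to a bottom side; the
  labels of midpoints keep the remaining \<open>2 * n\<close> sides apart.\<close>

lemma card_edges: "card (edges n \<sigma> \<tau>) = 2 * n"
proof -
  define f where "f i = surface_point n \<sigma> \<tau> ` ({i} \<times> {0} \<times> {0<..<1})" for i
  define g where "g i = surface_point n \<sigma> \<tau> ` ({i} \<times> {0<..<1} \<times> {0})" for i
  have fr: "surface_point n \<sigma> \<tau> ` ({i} \<times> {1} \<times> {0<..<1}) = f (\<sigma> i)" if "i \<in> {1..n}" for i
  proof -
    have "surface_point n \<sigma> \<tau> (i, 1, y) = surface_point n \<sigma> \<tau> (\<sigma> i, 0, y)" if "y \<in> {0<..<1}" for y
      by (rule surface_point_right) (use that \<open>i \<in> {1..n}\<close> in auto)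
    then show ?thesis unfolding f_def by (force simp: image_iff)
  qed
  have gt: "surface_point n \<sigma> \<tau> ` ({i} \<times> {0<..<1} \<times> {1}) = g (\<tau> i)" if "i \<in> {1..n}" for i
  proof -
    have "surface_point n \<sigma> \<tau> (i, x, 1) = surface_point n \<sigma> \<tau> (\<tau> i, x, 0)" if "x \<in> {0<..<1}" for x
      by (rule surface_point_top) (use that \<open>i \<in> {1..n}\<close> in auto)
    then show ?thesis unfolding g_def by (force simp: image_iff)
  qed
  have "edges n \<sigma> \<tau> = f ` {1..n} \<union> g ` {1..n}"
  proof
    show "edges n \<sigma> \<tau> \<subseteq> f ` {1..n} \<union> g ` {1..n}"
    proof
      fix e assume "e \<in> edges n \<sigma> \<tau>"
      then consider i x where "i \<in> {1..n}" "x \<in> {0,1}" "e = surface_point n \<sigma> \<tau> ` ({i} \<times> {x} \<times> {0<..<1})"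
        | i y where "i \<in> {1..n}" "y \<in> {0,1}" "e = surface_point n \<sigma> \<tau> ` ({i} \<times> {0<..<1} \<times> {y})"
        unfolding edges_def open_sides_def by blast
      then show "e \<in> f ` {1..n} \<union> g ` {1..n}"
      proof cases
        case 1
        then show ?thesis using fr[OF 1(1)] in_range(1)[OF 1(1)] by (auto simp: f_def)
      next
        case 2
        then show ?thesis using gt[OF 2(1)] in_range(2)[OF 2(1)] by (auto simp: g_def)
      qed
    qed
    have "f i \<in> edges n \<sigma> \<tau>" "g i \<in> edges n \<sigma> \<tau>" if "i \<in> {1..n}" for i
      unfolding edges_def f_def g_def open_sides_def using that by blast+
    then show "f ` {1..n} \<union> g ` {1..n} \<subseteq> edges n \<sigma> \<tau>" by blast
  qed
  moreover have "inj_on f {1..n}"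
  proof (rule inj_onI)
    fix i j assume ij: "i \<in> {1..n}" "j \<in> {1..n}" "f i = f j"
    have "surface_point n \<sigma> \<tau> (i, 0, 1/2) \<in> f i" unfolding f_def by (rule imageI) auto
    then obtain y where y: "y \<in> {0<..<1}" "surface_point n \<sigma> \<tau> (i, 0, 1/2) = surface_point n \<sigma> \<tau> (j, 0, y)"
      using ij(3) unfolding f_def by blast
    have "glue_label (i, 0, 1/2) = glue_label (j, 0, y)"
      by (rule surface_point_label[OF _ _ y(2)]) (use y ij in \<open>auto simp: squares_def\<close>)
    then show "i = j" using y by (auto simp: glue_label_def Let_def split: if_splits)
  qed
  moreover have "inj_on g {1..n}"
  proof (rule inj_onI)
    fix i j assume ij: "i \<in> {1..n}" "j \<in> {1..n}" "g i = g j"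
    have "surface_point n \<sigma> \<tau> (i, 1/2, 0) \<in> g i" unfolding g_def by (rule imageI) auto
    then obtain y where y: "y \<in> {0<..<1}" "surface_point n \<sigma> \<tau> (i, 1/2, 0) = surface_point n \<sigma> \<tau> (j, y, 0)"
      using ij(3) unfolding g_def by blast
    have "glue_label (i, 1/2, 0) = glue_label (j, y, 0)"
      by (rule surface_point_label[OF _ _ y(2)]) (use y ij in \<open>auto simp: squares_def\<close>)
    then show "i = j" using y by (auto simp: glue_label_def Let_def split: if_splits)
  qed
  moreover have "f ` {1..n} \<inter> g ` {1..n} = {}"
  proof (rule ccontr)
    assume "f ` {1..n} \<inter> g ` {1..n} \<noteq> {}"
    then obtain i j where ij: "i \<in> {1..n}" "j \<in> {1..n}" "f i = g j" by blast
    have "surface_point n \<sigma> \<tau> (i, 0, 1/2) \<in> f i" unfolding f_def by (rule imageI) auto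
    then obtain y where y: "y \<in> {0<..<1}" "surface_point n \<sigma> \<tau> (i, 0, 1/2) = surface_point n \<sigma> \<tau> (j, y, 0)"
      using ij(3) unfolding g_def by blast
    have "glue_label (i, 0, 1/2) = glue_label (j, y, 0)"
      by (rule surface_point_label[OF _ _ y(2)]) (use y ij in \<open>auto simp: squares_def\<close>)
    then show False using y by (auto simp: glue_label_def Let_def split: if_splits)
  qed
  ultimately show ?thesis by (simp add: card_Un_disjoint card_image)
qed

text \<open>Bottom left corners reach every vertex. Two of them are glued exactly when their squares
  lie on one cycle: the labels give one direction, the two ways to a top right corner the
  other.\<close>

lemma card_vertices: "card (vertices n \<sigma> \<tau>) = ncyc {1..n} (commutator \<sigma> \<tau>)"
proof -
  define f where "f j = surface_point n \<sigma> \<tau> (j, 0, 0)" for j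
  have "vertices n \<sigma> \<tau> = (\<lambda>j. {f j}) ` {1..n}"
  proof
    show "vertices n \<sigma> \<tau> \<subseteq> (\<lambda>j. {f j}) ` {1..n}"
    proof
      fix v assume "v \<in> vertices n \<sigma> \<tau>"
      then obtain i x y where i: "i \<in> {1..n}" and xy: "x \<in> {0,1}" "y \<in> {0,1}"
        and v: "v = surface_point n \<sigma> \<tau> ` ({i} \<times> {x} \<times> {y})"
        unfolding vertices_def corners_def by blast
      have v': "v = {surface_point n \<sigma> \<tau> (i, x, y)}" using v by simp
      have "\<exists>j\<in>{1..n}. surface_point n \<sigma> \<tau> (i, x, y) = f j"
      proof -
        have "surface_point n \<sigma> \<tau> (i, 1, 0) = f (\<sigma> i)" "surface_point n \<sigma> \<tau> (i, 0, 1) = f (\<tau> i)"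
          using surface_point_right[OF i, of 0] surface_point_top[OF i, of 0] by (auto simp: f_def)
        moreover have "surface_point n \<sigma> \<tau> (i, 1, 1) = f (\<tau> (\<sigma> i))"
          using surface_point_right[OF i, of 1] surface_point_top[OF in_range(1)[OF i], of 0] by (simp add: f_def)
        moreover have "surface_point n \<sigma> \<tau> (i, 0, 0) = f i" by (simp add: f_def)
        ultimately show ?thesis using xy i in_range(1)[OF i] in_range(2)[OF i] in_range(2)[OF in_range(1)[OF i]]
          by blast
      qed
      then show "v \<in> (\<lambda>j. {f j}) ` {1..n}" using v' by auto
    qed
    show "(\<lambda>j. {f j}) ` {1..n} \<subseteq> vertices n \<sigma> \<tau>"
    proof
      fix v assume "v \<in> (\<lambda>j. {f j}) ` {1..n}"
      then obtain j where j: "j \<in> {1..n}" "v = {f j}" by blast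
      have "v = surface_point n \<sigma> \<tau> ` ({j} \<times> {0} \<times> {0})" using j by (simp add: f_def)
      then show "v \<in> vertices n \<sigma> \<tau>" unfolding vertices_def corners_def using j(1) by blast
    qed
  qed
  then have "card (vertices n \<sigma> \<tau>) = card ((\<lambda>j. {f j}) ` {1..n})" by simp
  also have "\<dots> = ncyc {1..n} (commutator \<sigma> \<tau>)"
    unfolding ncyc_def
  proof (rule card_image_cong_kernel)
    fix j k assume jk: "j \<in> {1..n}" "k \<in> {1..n}"
    have sq: "(j, 0, 0) \<in> squares n" "(k, 0, 0) \<in> squares n" using jk by (auto simp: squares_def)
    \<comment> \<open>All \<open>u\<close> are covered, as the generated equivalence is a relation
      on all naturals; outside \<open>{1..n}\<close> the commutator fixes \<open>u\<close>.\<close>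
    have step: "equivclp (gluing n \<sigma> \<tau>) (u, 0, 0) (commutator \<sigma> \<tau> u, 0, 0)" for u
    proof (cases "u \<in> {1..n}")
      case True
      define i where "i = inv \<sigma> (inv \<tau> u)"
      have u: "u = \<tau> (\<sigma> i)" 
          using permutes_inverses(1)[OF perm(1)] permutes_inverses(1)[OF perm(2)] by (simp add: i_def)
      have i: "i \<in> {1..n}" using True permutes_in_image[OF permutes_inv[OF perm(1)]] permutes_in_image[OF permutes_inv[OF perm(2)]]
          unfolding i_def by (simp only:)
      have "surface_point n \<sigma> \<tau> (\<tau> (\<sigma> i), 0, 0) = surface_point n \<sigma> \<tau> (i, 1, 1)"
        using surface_point_right[OF i, of 1] surface_point_top[OF in_range(1)[OF i], of 0] by simp
      also have "\<dots> = surface_point n \<sigma> \<tau> (\<sigma> (\<tau> i), 0, 0)"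
        using surface_point_top[OF i, of 1] surface_point_right[OF in_range(2)[OF i], of 0] by simp
      finally have "equivclp (gluing n \<sigma> \<tau>) (\<tau> (\<sigma> i), 0, 0) (\<sigma> (\<tau> i), 0, 0)"
        using in_range(2)[OF in_range(1)[OF i]] in_range(1)[OF in_range(2)[OF i]]
        by (subst (asm) surface_point_eq_iff) (auto simp: squares_def)
      then show ?thesis unfolding u commutator_apply .
    next
      case False
      then have "commutator \<sigma> \<tau> u = u"
        using permutes_not_in[OF perm(1) False] permutes_not_in[OF perm(2) False]
          permutes_not_in[OF permutes_inv[OF perm(1)] False] permutes_not_in[OF permutes_inv[OF perm(2)] False]
        by (simp add: commutator_def)
      then show ?thesis by simp
    qed
    show "{f j} = {f k} \<longleftrightarrow> cyc_class (commutator \<sigma> \<tau>) j = cyc_class (commutator \<sigma> \<tau>) k"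
    proof
      assume "{f j} = {f k}"
      then have "surface_point n \<sigma> \<tau> (j, 0, 0) = surface_point n \<sigma> \<tau> (k, 0, 0)" by (simp add: f_def)
      then show "cyc_class (commutator \<sigma> \<tau>) j = cyc_class (commutator \<sigma> \<tau>) k"
        using surface_point_label[OF sq] by (simp add: glue_label_def)
    next
      assume "cyc_class (commutator \<sigma> \<tau>) j = cyc_class (commutator \<sigma> \<tau>) k"
      then have "equivclp (\<lambda>u v. v = commutator \<sigma> \<tau> u) j k" by (simp add: cyc_class_eq_iff)
      then have "equivclp (gluing n \<sigma> \<tau>) (j, 0, 0) (k, 0, 0)"
        by (rule equivclp_map[where F = "\<lambda>u. (u, 0, 0)"]) (use step in simp)
      then show "{f j} = {f k}" using sq by (simp add: f_def surface_point_eq_iff)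
    qed
  qed
  finally show ?thesis .
qed

lemma euler_char_eq: "euler_char n \<sigma> \<tau> = int (ncyc {1..n} (commutator \<sigma> \<tau>)) - int n"
  by (simp add: euler_char_def card_faces card_edges card_vertices)

end

section \<open>Cycle sums and symmetrizers\<close>

abbreviation tswap :: "'a \<Rightarrow> 'a \<Rightarrow> 'a \<Rightarrow> 'a" where "tswap \<equiv> Transposition.transpose"

section \<open>Cycle counts under insertion of a point, conjugation and inversion\<close>

lemma permutes_fixes: "h permutes X \<Longrightarrow> k \<notin> X \<Longrightarrow> h k = k"
  by (rule permutes_not_in)

lemma cyc_class_fixed:
  assumes "g k = k" "inj g" "equivclp (\<lambda>u v. v = g u) k y"
  shows "y = k"
proof -
  have "(k = k) = (y = k)"
    using assms(3) by (rule equivclp_const) (use assms(1,2) in \<open>auto simp: inj_def\<close>)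
  then show ?thesis by simp
qed

lemma ncyc_insert_fixed:
  assumes "finite X" "k \<notin> X" "h permutes X"
  shows "ncyc (insert k X) h = Suc (ncyc X h)"
proof -
  have "cyc_class h k \<notin> cyc_class h ` X"
  proof
    assume "cyc_class h k \<in> cyc_class h ` X"
    then obtain x where x: "x \<in> X" "cyc_class h k = cyc_class h x" by blast
    then have "x = k"
      using cyc_class_fixed[OF permutes_fixes[OF assms(3,2)] permutes_inj[OF assms(3)]]
      by (simp add: cyc_class_eq_iff)
    then show False using x assms by simp
  qed
  then show ?thesis using assms by (simp add: ncyc_def)
qed

text \<open>\<open>tswap k b \<circ> h\<close> is \<open>h\<close> with \<open>k\<close> spliced
  into its cycle just before \<open>b\<close>, so no cycle is created.\<close>

lemma ncyc_insert_transpose: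
  assumes "k \<notin> X" "b \<in> X" "h permutes X"
  shows "ncyc (insert k X) (tswap k b \<circ> h) = ncyc X h"
proof -
  define g where "g = tswap k b \<circ> h"
  have hk: "h k = k" using assms by (simp add: permutes_not_in)
  have kb: "k \<noteq> b" using assms by blast
  have gk: "g k = b" using hk by (simp add: g_def)
  have hX: "h x \<in> X \<longleftrightarrow> x \<in> X" for x by (rule permutes_in_image[OF assms(3)])
  have gE: "equivclp (\<lambda>u v. v = g u) u (h u)" for u
  proof (cases "h u = b")
    case True
    then have "g u = k" by (simp add: g_def)
    then have "equivclp (\<lambda>u v. v = g u) u k" "equivclp (\<lambda>u v. v = g u) k b"
      using gk by (auto intro: r_into_equivclp)
    then show ?thesis unfolding True by (rule equivclp_trans)
  next
    case False
    show ?thesis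
    proof (cases "u = k")
      case True then show ?thesis using hk by simp
    next
      case u: False
      have "h u \<noteq> k" using u hk permutes_inj[OF assms(3)] by (metis injD)
      then have "g u = h u" using False by (simp add: g_def)
      then show ?thesis by (auto intro: r_into_equivclp)
    qed
  qed
  \<comment> \<open>Contracting \<open>k\<close> to \<open>b\<close> turns steps of \<open>g\<close>
    into steps of \<open>h\<close> or into equalities.\<close>
  define r where "r u = (if u = k then b else u)" for u
  have rE: "equivclp (\<lambda>u v. v = h u) (r u) (r (g u))" for u
  proof (cases "u = k")
    case True then show ?thesis using gk by (simp add: r_def)
  next
    case u: False
    have hu: "h u \<noteq> k" using u hk permutes_inj[OF assms(3)] by (metis injD)
    have "r (g u) = h u" using hu kb by (cases "h u = b") (simp_all add: g_def r_def)
    then show ?thesis using u by (auto simp: r_def intro: r_into_equivclp)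
  qed
  have iff: "cyc_class g x = cyc_class g y \<longleftrightarrow> cyc_class h x = cyc_class h y" if "x \<in> X" "y \<in> X" for x y
  proof -
    have rxy: "r x = x" "r y = y" using that assms(1) by (auto simp: r_def)
    show ?thesis unfolding cyc_class_eq_iff
    proof
      assume "equivclp (\<lambda>u v. v = g u) x y"
      then have "equivclp (\<lambda>u v. v = h u) (r x) (r y)"
        by (rule equivclp_map) (use rE in simp)
      then show "equivclp (\<lambda>u v. v = h u) x y" by (simp add: rxy)
    next
      assume "equivclp (\<lambda>u v. v = h u) x y"
      then show "equivclp (\<lambda>u v. v = g u) x y"
        by (rule equivclp_map[where F = "\<lambda>x. x"]) (use gE in simp)
    qed
  qed
  have "cyc_class g k = cyc_class g b"
    unfolding cyc_class_eq_iff using gk by (auto intro: r_into_equivclp)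
  then have "cyc_class g ` insert k X = cyc_class g ` X" using assms(2) by auto
  then have "ncyc (insert k X) g = card (cyc_class g ` X)" by (simp add: ncyc_def)
  also have "\<dots> = ncyc X h" unfolding ncyc_def by (rule card_image_cong_kernel) (rule iff)
  finally show ?thesis by (simp add: g_def)
qed

lemma ncyc_conj:
  assumes "t permutes X"
  shows "ncyc X (t \<circ> g \<circ> inv t) = ncyc X g"
proof -
  define g' where "g' = t \<circ> g \<circ> inv t"
  note ti = permutes_inverses[OF assms]
  have E1: "equivclp (\<lambda>u v. v = g' u) (t x) (t y)" if "equivclp (\<lambda>u v. v = g u) x y" for x y
    using that by (rule equivclp_map) (auto simp: g'_def ti intro: r_into_equivclp)
  have E2: "equivclp (\<lambda>u v. v = g u) (inv t x) (inv t y)" if "equivclp (\<lambda>u v. v = g' u) x y" for x y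
    using that by (rule equivclp_map) (auto simp: g'_def ti intro: r_into_equivclp)
  have "ncyc X g' = card (cyc_class g' ` (t ` X))" by (simp add: ncyc_def permutes_image[OF assms])
  also have "\<dots> = card ((\<lambda>x. cyc_class g' (t x)) ` X)" by (simp add: image_image)
  also have "\<dots> = ncyc X g" unfolding ncyc_def
    by (rule card_image_cong_kernel) (use E1 E2[of "t _" "t _"] in \<open>auto simp: cyc_class_eq_iff ti\<close>)
  finally show ?thesis by (simp add: g'_def)
qed

lemma ncyc_inv:
  assumes "g permutes X"
  shows "ncyc X (inv g) = ncyc X g"
proof -
  have "equivclp (\<lambda>u v. v = inv g u) x y \<longleftrightarrow> equivclp (\<lambda>u v. v = g u) x y" for x y
  proof
    assume "equivclp (\<lambda>u v. v = inv g u) x y"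
    then show "equivclp (\<lambda>u v. v = g u) x y"
      by (rule equivclp_map[where F = "\<lambda>x. x"])
        (auto simp: permutes_inverses[OF assms] intro!: equivclp_sym[OF r_into_equivclp])
  next
    assume "equivclp (\<lambda>u v. v = g u) x y"
    then show "equivclp (\<lambda>u v. v = inv g u) x y"
      by (rule equivclp_map[where F = "\<lambda>x. x"])
        (auto simp: permutes_inverses[OF assms] intro!: equivclp_sym[OF r_into_equivclp])
  qed
  then show ?thesis unfolding ncyc_def by (intro card_image_cong_kernel) (simp add: cyc_class_eq_iff)
qed

section \<open>Convolution by cycle counts and symmetrization over blocks\<close>

text \<open>Since \<open>f\<close> is defined on all maps, \<open>X\<close> may be smaller than the
  set of points that \<open>x\<close> moves; this lets the sum be built up one point at a
  time.\<close>

definition cyc_sum :: "'a set \<Rightarrow> 'b \<Rightarrow> (('a \<Rightarrow> 'a) \<Rightarrow> 'b) \<Rightarrow> ('a \<Rightarrow> 'a) \<Rightarrow> 'b::field_char_0" where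
  "cyc_sum X q f x = (\<Sum>g | g permutes X. q ^ ncyc X g * f (g \<circ> x))"

definition sym_sum :: "'a set \<Rightarrow> (('a \<Rightarrow> 'a) \<Rightarrow> 'b) \<Rightarrow> ('a \<Rightarrow> 'a) \<Rightarrow> 'b::field_char_0" where
  "sym_sum M f x = (\<Sum>s | s permutes M. f (s \<circ> x))"

definition class_fun :: "'a set \<Rightarrow> (('a \<Rightarrow> 'a) \<Rightarrow> 'b) \<Rightarrow> bool" where
  "class_fun X f \<longleftrightarrow> (\<forall>x y. x permutes X \<longrightarrow> y permutes X \<longrightarrow> f (x \<circ> y) = f (y \<circ> x))"

lemma class_funD: "class_fun X f \<Longrightarrow> x permutes X \<Longrightarrow> y permutes X \<Longrightarrow> f (x \<circ> y) = f (y \<circ> x)"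
  by (simp add: class_fun_def)

lemma cyc_sum_empty [simp]: "cyc_sum {} q f x = f x"
  by (simp add: cyc_sum_def ncyc_def)

text \<open>Coset decomposition: \<open>q\<close> stands for \<open>k\<close> as a cycle of its own,
  the transpositions for splicing it into an old cycle. This is the factor \<open>q + J\<close> with
  a Jucys-Murphy element \<open>J\<close>.\<close>

lemma cyc_sum_insert:
  assumes "finite X" "k \<notin> X"
  shows "cyc_sum (insert k X) q f x =
    q * cyc_sum X q f x + (\<Sum>b\<in>X. cyc_sum X q (\<lambda>y. f (tswap k b \<circ> y)) x)"
proof -
  have "cyc_sum (insert k X) q f x =
    (\<Sum>b\<in>insert k X. \<Sum>h | h permutes X. q ^ ncyc (insert k X) (tswap k b \<circ> h) * f (tswap k b \<circ> h \<circ> x))"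
    unfolding cyc_sum_def by (rule sum_over_permutations_insert[OF assms])
  also have "\<dots> = (\<Sum>h | h permutes X. q ^ ncyc (insert k X) h * f (h \<circ> x)) +
    (\<Sum>b\<in>X. \<Sum>h | h permutes X. q ^ ncyc (insert k X) (tswap k b \<circ> h) * f (tswap k b \<circ> h \<circ> x))"
    using assms by simp
  also have "(\<Sum>h | h permutes X. q ^ ncyc (insert k X) h * f (h \<circ> x)) = q * cyc_sum X q f x"
    unfolding cyc_sum_def sum_distrib_left
    by (rule sum.cong) (simp_all add: ncyc_insert_fixed assms mult.assoc)
  also have "(\<Sum>b\<in>X. \<Sum>h | h permutes X. q ^ ncyc (insert k X) (tswap k b \<circ> h) * f (tswap k b \<circ> h \<circ> x))
    = (\<Sum>b\<in>X. cyc_sum X q (\<lambda>y. f (tswap k b \<circ> y)) x)"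
    unfolding cyc_sum_def
    by (intro sum.cong) (simp_all add: ncyc_insert_transpose assms o_assoc)
  finally show ?thesis .
qed

text \<open>On constants each transposition acts as 1, so the successive factors are
  \<open>q\<close>, \<open>q + 1\<close>, and so on.\<close>

lemma sum_pow_ncyc:
  assumes "finite X"
  shows "(\<Sum>g | g permutes X. q ^ ncyc X g) = pochhammer (q :: 'b :: field_char_0) (card X)"
proof -
  have "cyc_sum X q (\<lambda>_. 1) x = pochhammer q (card X)" for x
    using assms
  proof (induction X)
    case (insert k X)
    then show ?case by (simp add: cyc_sum_insert pochhammer_Suc algebra_simps)
  qed simp
  then show ?thesis by (simp add: cyc_sum_def)
qed

text \<open>The coset decomposition has the transposition to the left of \<open>s\<close>; inverting
  the summation variable brings it next to \<open>z\<close>.\<close>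

lemma sym_sum_insert:
  assumes "finite M" "k \<notin> M"
  shows "sym_sum (insert k M) f z = sym_sum M f z + (\<Sum>b\<in>M. sym_sum M f (tswap k b \<circ> z))"
proof -
  have "sym_sum (insert k M) f z = (\<Sum>s | s permutes insert k M. f (inv s \<circ> z))"
    unfolding sym_sum_def by (rule sum_permutations_inverse)
  also have "\<dots> = (\<Sum>b\<in>insert k M. \<Sum>s | s permutes M. f (inv (tswap k b \<circ> s) \<circ> z))"
    by (rule sum_over_permutations_insert[OF assms])
  also have "\<dots> = (\<Sum>b\<in>insert k M. \<Sum>s | s permutes M. f (inv s \<circ> (tswap k b \<circ> z)))"
    by (intro sum.cong refl) (auto simp: o_inv_distrib permutes_bij o_assoc)
  also have "\<dots> = (\<Sum>b\<in>insert k M. sym_sum M f (tswap k b \<circ> z))"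
    unfolding sym_sum_def by (intro sum.cong refl sum_permutations_inverse[symmetric])
  finally show ?thesis using assms by simp
qed

lemma sym_sum_left:
  assumes "s permutes M"
  shows "sym_sum M f (s \<circ> z) = sym_sum M f z"
  unfolding sym_sum_def
  by (subst (2) sum_permutations_compose_right[OF assms]) (simp add: o_assoc)

lemma permutes_disjoint_commute:
  assumes "s permutes M" "t permutes N" "M \<inter> N = {}"
  shows "s \<circ> t = t \<circ> s"
proof
  fix x
  consider "x \<in> M" | "x \<in> N" | "x \<notin> M" "x \<notin> N" by blast
  then show "(s \<circ> t) x = (t \<circ> s) x"
  proof cases
    case 1
    then have "s x \<in> M" using permutes_in_image[OF assms(1)] by simp
    then show ?thesis using 1 assms(3) permutes_not_in[OF assms(2)] by (metis IntI comp_apply empty_iff)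
  next
    case 2
    then have "t x \<in> N" using permutes_in_image[OF assms(2)] by simp
    then show ?thesis using 2 assms(3) permutes_not_in[OF assms(1)] by (metis IntI comp_apply empty_iff)
  next
    case 3
    then show ?thesis using permutes_not_in[OF assms(1)] permutes_not_in[OF assms(2)] by simp
  qed
qed

text \<open>The weight \<open>q ^ ncyc X g\<close> is a class function, hence central, so the
  convolution commutes with translations.\<close>

lemma cyc_sum_shift:
  assumes "s permutes X"
  shows "cyc_sum X q f (s \<circ> y) = cyc_sum X q (\<lambda>z. f (s \<circ> z)) y"
proof -
  let ?F = "\<lambda>g. q ^ ncyc X g * f (g \<circ> (s \<circ> y))"
  have si: "inv s permutes X" by (rule permutes_inv[OF assms])
  have inv: "inv s \<circ> s = id" by (rule permutes_inv_o(2)[OF assms])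
  have "cyc_sum X q f (s \<circ> y) = (\<Sum>g | g permutes X. ?F (s \<circ> g))"
    unfolding cyc_sum_def by (rule setum_permutations_compose_left[OF assms])
  also have "\<dots> = (\<Sum>g | g permutes X. ?F (s \<circ> (g \<circ> inv s)))"
    by (rule sum_permutations_compose_right[OF si])
  also have "\<dots> = cyc_sum X q (\<lambda>z. f (s \<circ> z)) y"
    unfolding cyc_sum_def
  proof (rule sum.cong)
    fix g
    have "s \<circ> (g \<circ> inv s) \<circ> (s \<circ> y) = s \<circ> g \<circ> (inv s \<circ> s) \<circ> y" by (simp only: o_assoc)
    then show "?F (s \<circ> (g \<circ> inv s)) = q ^ ncyc X g * f (s \<circ> (g \<circ> y))"
      using ncyc_conj[OF assms, of g] by (simp add: inv o_assoc)
  qed simp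
  finally show ?thesis .
qed

context
  fixes \<Omega> M :: "'a set" and f :: "('a \<Rightarrow> 'a) \<Rightarrow> 'b::field_char_0"
  assumes fin: "finite \<Omega>" and sub: "M \<subseteq> \<Omega>" and cls: "class_fun \<Omega> f"
begin

lemma class_fun_sym_sum: "class_fun (\<Omega> - M) (sym_sum M f)"
  unfolding class_fun_def
proof (intro allI impI)
  fix x y assume xy: "x permutes \<Omega> - M" "y permutes \<Omega> - M"
  show "sym_sum M f (x \<circ> y) = sym_sum M f (y \<circ> x)"
    unfolding sym_sum_def
  proof (rule sum.cong)
    fix s assume "s \<in> {s. s permutes M}"
    then have s: "s permutes M" by simp
    have x': "x permutes \<Omega>" "y permutes \<Omega>" "s permutes \<Omega>"
      using xy s sub permutes_subset by blast+
    have "f (s \<circ> (x \<circ> y)) = f ((s \<circ> x) \<circ> y)" by (simp add: o_assoc)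
    also have "\<dots> = f (y \<circ> (s \<circ> x))"
      by (rule class_funD[OF cls]) (use x' permutes_compose in blast)+
    also have "y \<circ> (s \<circ> x) = s \<circ> (y \<circ> x)"
      using permutes_disjoint_commute[OF s xy(2)] by (metis Diff_disjoint o_assoc)
    finally show "f (s \<circ> (x \<circ> y)) = f (s \<circ> (y \<circ> x))" .
  qed simp
qed

text \<open>The class property turns the right translation by \<open>s\<close> into a left one,
  which the symmetrizer absorbs.\<close>

lemma sym_sum_right:
  assumes "s permutes M" "z permutes \<Omega>"
  shows "sym_sum M f (z \<circ> s) = sym_sum M f z"
proof -
  have s: "s permutes \<Omega>" using assms(1) sub by (rule permutes_subset)
  have "sym_sum M f (z \<circ> s) = (\<Sum>t | t permutes M. f ((t \<circ> z) \<circ> s))"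
    unfolding sym_sum_def by (simp add: o_assoc)
  also have "\<dots> = (\<Sum>t | t permutes M. f (s \<circ> t \<circ> z))"
  proof (rule sum.cong)
    fix t assume "t \<in> {t. t permutes M}"
    then have t: "t permutes \<Omega>" using sub permutes_subset by blast
    have "t \<circ> z permutes \<Omega>" by (rule permutes_compose) fact+
    then show "f ((t \<circ> z) \<circ> s) = f (s \<circ> t \<circ> z)" using class_funD[OF cls _ s] by (simp add: o_assoc)
  qed simp
  also have "\<dots> = sym_sum M f z"
    unfolding sym_sum_def using setum_permutations_compose_left[OF assms(1), of "\<lambda>t. f (t \<circ> z)"] by simp
  finally show ?thesis .
qed

end

text \<open>With \<open>J\<close> the sum of the transpositions \<open>(k b)\<close>, \<open>b \<in> M \<union> K\<close>, passing from \<open>K\<close> to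
  \<open>insert k K\<close> multiplies by \<open>q + J\<close>; since the symmetrizer of \<open>insert k M\<close> kills \<open>f\<close>, the
  transpositions with \<open>b \<in> M\<close> contribute \<open>-1\<close> in total.  This is the shift from \<open>q\<close> to \<open>q - 1\<close>.\<close>

lemma sym_sum_cyc_sum:
  fixes f :: "('a \<Rightarrow> 'a) \<Rightarrow> 'b::field_char_0"
  assumes fin: "finite \<Omega>" and sub: "M \<subseteq> \<Omega>" and cls: "class_fun \<Omega> f"
    and van: "\<And>k z. k \<in> \<Omega> - M \<Longrightarrow> z permutes \<Omega> \<Longrightarrow> sym_sum (insert k M) f z = 0"
    and K: "K \<subseteq> \<Omega> - M" and x: "x permutes \<Omega>"
  shows "(\<Sum>s | s permutes M. cyc_sum (M \<union> K) q (\<lambda>y. f (s \<circ> y)) x) =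
    pochhammer q (card M) * cyc_sum K (q - 1) (sym_sum M f) x"
proof -
  have finM: "finite M" using fin sub finite_subset by blast
  have finK: "finite K" using fin K finite_subset by blast
  show ?thesis using finK K x
  proof (induction K arbitrary: x)
    case empty
    \<comment> \<open>With \<open>K\<close> empty the symmetrizer absorbs every \<open>g\<close>,
      leaving the sum of the weights, a rising factorial.\<close>
    have "(\<Sum>s | s permutes M. cyc_sum M q (\<lambda>y. f (s \<circ> y)) x)
      = (\<Sum>g | g permutes M. q ^ ncyc M g * (\<Sum>s | s permutes M. f (s \<circ> g \<circ> x)))"
      unfolding cyc_sum_def by (subst sum.swap) (simp add: sum_distrib_left o_assoc)
    also have "\<dots> = (\<Sum>g | g permutes M. q ^ ncyc M g * sym_sum M f x)"
    proof (rule sum.cong)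
      fix g assume "g \<in> {g. g permutes M}"
      then have g: "g permutes M" by simp
      show "q ^ ncyc M g * (\<Sum>s | s permutes M. f (s \<circ> g \<circ> x)) = q ^ ncyc M g * sym_sum M f x"
        unfolding sym_sum_def
        by (subst (2) sum_permutations_compose_right[OF g]) simp
    qed simp
    also have "\<dots> = pochhammer q (card M) * sym_sum M f x"
      by (simp add: sum_pow_ncyc[OF finM] flip: sum_distrib_right)
    finally show ?case by (simp only: Un_empty_right cyc_sum_empty)
  next
    case (insert k K)
    define T where "T x = (\<Sum>s | s permutes M. cyc_sum (M \<union> K) q (\<lambda>y. f (s \<circ> y)) x)" for x
    define R where "R x = pochhammer q (card M) * cyc_sum K (q - 1) (sym_sum M f) x" for x
    have TR: "T x = R x" if "x permutes \<Omega>" for x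
      unfolding T_def R_def using insert.IH[of x] insert.prems that by blast
    have k: "k \<in> \<Omega>" "k \<notin> M" "k \<notin> K" and finMK: "finite (M \<union> K)" "k \<notin> M \<union> K"
      using insert finM by auto
    have MK: "M \<inter> K = {}" "K \<subseteq> \<Omega>" "M \<union> K \<subseteq> \<Omega>" using insert.prems sub by auto
    have tr: "tswap k b permutes \<Omega>" if "b \<in> M \<union> K" for b
      by (rule permutes_swap_id) (use that MK k in auto)
    \<comment> \<open>For \<open>b\<close> in \<open>K\<close> the transposition commutes with
      \<open>s\<close>, and the class property carries it to the right end, where the induction
      hypothesis, stated for all \<open>x\<close>, absorbs it.\<close>
    have bK: "f (s \<circ> (tswap k b \<circ> (g \<circ> x))) = f (s \<circ> (g \<circ> (x \<circ> tswap k b)))"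
      if s: "s permutes M" and b: "b \<in> K" and g: "g permutes \<Omega>" for s g b
    proof -
      have tkb: "tswap k b permutes \<Omega> - M"
        by (rule permutes_swap_id) (use b k insert.prems in auto)
      have cm: "s \<circ> tswap k b = tswap k b \<circ> s"
        by (rule permutes_disjoint_commute[OF s tkb]) auto
      have t: "tswap k b permutes \<Omega>" using tr b by blast
      have sgx: "s \<circ> (g \<circ> x) permutes \<Omega>"
        by (intro permutes_compose permutes_subset[OF s] sub g insert.prems)
      have "f (s \<circ> (tswap k b \<circ> (g \<circ> x))) = f ((s \<circ> tswap k b) \<circ> (g \<circ> x))" by (simp only: o_assoc)
      also have "\<dots> = f (tswap k b \<circ> (s \<circ> (g \<circ> x)))" unfolding cm by (simp only: o_assoc)
      also have "\<dots> = f ((s \<circ> (g \<circ> x)) \<circ> tswap k b)" by (rule class_funD[OF cls t sgx])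
      finally show ?thesis by (simp only: o_assoc)
    qed
    have "(\<Sum>s | s permutes M. cyc_sum (M \<union> insert k K) q (\<lambda>y. f (s \<circ> y)) x)
      = (\<Sum>s | s permutes M. q * cyc_sum (M \<union> K) q (\<lambda>y. f (s \<circ> y)) x +
          (\<Sum>b\<in>M \<union> K. cyc_sum (M \<union> K) q (\<lambda>y. f (s \<circ> (tswap k b \<circ> y))) x))"
      by (simp only: Un_insert_right cyc_sum_insert[OF finMK])
    also have "\<dots> = q * T x + (\<Sum>b\<in>M \<union> K. \<Sum>s | s permutes M. cyc_sum (M \<union> K) q (\<lambda>y. f (s \<circ> (tswap k b \<circ> y))) x)"
      unfolding sum.distrib T_def by (subst (2) sum.swap) (simp add: sum_distrib_left)
    also have "(\<Sum>b\<in>M \<union> K. \<Sum>s | s permutes M. cyc_sum (M \<union> K) q (\<lambda>y. f (s \<circ> (tswap k b \<circ> y))) x)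
      = (\<Sum>b\<in>M. \<Sum>s | s permutes M. cyc_sum (M \<union> K) q (\<lambda>y. f (s \<circ> (tswap k b \<circ> y))) x)
      + (\<Sum>b\<in>K. \<Sum>s | s permutes M. cyc_sum (M \<union> K) q (\<lambda>y. f (s \<circ> (tswap k b \<circ> y))) x)"
      by (rule sum.union_disjoint) (use finM insert.hyps MK in auto)
    also have "(\<Sum>b\<in>M. \<Sum>s | s permutes M. cyc_sum (M \<union> K) q (\<lambda>y. f (s \<circ> (tswap k b \<circ> y))) x) = - T x"
    proof -
      have "(\<Sum>b\<in>M. \<Sum>s | s permutes M. cyc_sum (M \<union> K) q (\<lambda>y. f (s \<circ> (tswap k b \<circ> y))) x)
        = (\<Sum>b\<in>M. \<Sum>g | g permutes M \<union> K. \<Sum>s | s permutes M. q ^ ncyc (M \<union> K) g * f (s \<circ> (tswap k b \<circ> (g \<circ> x))))"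
        unfolding cyc_sum_def by (subst sum.swap) (rule refl)
      also have "\<dots> = (\<Sum>g | g permutes M \<union> K. q ^ ncyc (M \<union> K) g * (\<Sum>b\<in>M. sym_sum M f (tswap k b \<circ> (g \<circ> x))))"
        unfolding sym_sum_def by (subst sum.swap) (simp add: sum_distrib_left)
      also have "\<dots> = (\<Sum>g | g permutes M \<union> K. q ^ ncyc (M \<union> K) g * (- sym_sum M f (g \<circ> x)))"
      proof (rule sum.cong)
        fix g assume "g \<in> {g. g permutes M \<union> K}"
        then have g: "g permutes \<Omega>" using MK(3) permutes_subset by blast
        have "g \<circ> x permutes \<Omega>" by (intro permutes_compose g insert.prems)
        then have "sym_sum (insert k M) f (g \<circ> x) = 0" using van k by blast
        then have "(\<Sum>b\<in>M. sym_sum M f (tswap k b \<circ> (g \<circ> x))) = - sym_sum M f (g \<circ> x)"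
          unfolding sym_sum_insert[OF finM k(2)] by (metis add.inverse_unique)
        then show "q ^ ncyc (M \<union> K) g * (\<Sum>b\<in>M. sym_sum M f (tswap k b \<circ> (g \<circ> x)))
          = q ^ ncyc (M \<union> K) g * (- sym_sum M f (g \<circ> x))" by (simp only:)
      qed simp
      also have "\<dots> = - T x"
        unfolding T_def sym_sum_def cyc_sum_def
        by (subst sum.swap) (simp add: sum_distrib_left sum_negf)
      finally show ?thesis .
    qed
    also have "(\<Sum>b\<in>K. \<Sum>s | s permutes M. cyc_sum (M \<union> K) q (\<lambda>y. f (s \<circ> (tswap k b \<circ> y))) x)
      = (\<Sum>b\<in>K. T (x \<circ> tswap k b))"
      unfolding T_def cyc_sum_def
    proof (intro sum.cong refl, goal_cases)
      case (1 b s g)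
      then have "g permutes \<Omega>" using MK(3) permutes_subset by blast
      then have "f (s \<circ> (tswap k b \<circ> (g \<circ> x))) = f (s \<circ> (g \<circ> (x \<circ> tswap k b)))"
        using bK 1 by blast
      then show ?case by (simp only:)
    qed
    also have "(\<Sum>b\<in>K. T (x \<circ> tswap k b)) = (\<Sum>b\<in>K. R (x \<circ> tswap k b))"
      by (intro sum.cong refl TR permutes_compose[OF tr]) (use insert.prems in auto)
    also have "T x = R x" using TR insert.prems by blast
    also have "q * R x + (- R x + (\<Sum>b\<in>K. R (x \<circ> tswap k b)))
      = pochhammer q (card M) * ((q - 1) * cyc_sum K (q - 1) (sym_sum M f) x +
          (\<Sum>b\<in>K. cyc_sum K (q - 1) (sym_sum M f) (x \<circ> tswap k b)))"
      unfolding R_def by (simp add: algebra_simps sum_distrib_left)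
    also have "(\<Sum>b\<in>K. cyc_sum K (q - 1) (sym_sum M f) (x \<circ> tswap k b))
      = (\<Sum>b\<in>K. cyc_sum K (q - 1) (\<lambda>y. sym_sum M f (tswap k b \<circ> y)) x)"
      unfolding cyc_sum_def sym_sum_def
    proof (intro sum.cong refl arg_cong2[where f = "(*)"], goal_cases)
      case (1 b g s)
      then have "g permutes \<Omega>" using MK(2) permutes_subset by blast
      then have "f (s \<circ> (tswap k b \<circ> (g \<circ> x))) = f (s \<circ> (g \<circ> (x \<circ> tswap k b)))"
        using bK 1 by blast
      then show ?case by (simp only:)
    qed
    also have "(q - 1) * cyc_sum K (q - 1) (sym_sum M f) x +
          (\<Sum>b\<in>K. cyc_sum K (q - 1) (\<lambda>y. sym_sum M f (tswap k b \<circ> y)) x)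
      = cyc_sum (insert k K) (q - 1) (sym_sum M f) x"
      by (rule cyc_sum_insert[OF insert.hyps(1) k(3), symmetric])
    finally show ?case .
  qed
qed

section \<open>The spectrum of the cycle sums\<close>

text \<open>If \<open>x\<close> maps \<open>a \<in> M\<close> to \<open>k \<notin> M\<close> and misses \<open>b0 \<in> M\<close>, then \<open>z = (k b0) x\<close> maps fewer points of \<open>M\<close>
  out of \<open>M\<close>, and the relation \<open>sym_sum (insert k M) f z = 0\<close> is a positive multiple of
  \<open>sym_sum M f x\<close> plus terms with fewer such points.\<close>

lemma sym_sum_extend_zero:
  fixes f :: "('a \<Rightarrow> 'a) \<Rightarrow> 'b::field_char_0"
  assumes fin: "finite \<Omega>" and sub: "M \<subseteq> \<Omega>" and cls: "class_fun \<Omega> f"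
    and van: "\<And>k z. k \<in> \<Omega> - M \<Longrightarrow> z permutes \<Omega> \<Longrightarrow> sym_sum (insert k M) f z = 0"
    and zero: "\<And>y. y permutes \<Omega> - M \<Longrightarrow> sym_sum M f y = 0"
    and x: "x permutes \<Omega>"
  shows "sym_sum M f x = 0"
  using x
proof (induction "card (x ` M - M)" arbitrary: x rule: less_induct)
  case less
  note x = less.prems
  have finM: "finite M" using fin sub finite_subset by blast
  note injx = permutes_inj[OF x]
  define F where "F = sym_sum M f"
  have Fl: "F (s \<circ> z) = F z" if "s permutes M" for s z
    unfolding F_def using that by (rule sym_sum_left)
  have Fr: "F (z \<circ> s) = F z" if "s permutes M" "z permutes \<Omega>" for s z
    unfolding F_def using fin sub cls that by (rule sym_sum_right)
  have cardx: "card (x ` M) = card M" by (rule card_image) (rule permutes_inj_on[OF x])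
  show ?case
  proof (cases "x ` M \<subseteq> M")
    \<comment> \<open>Here \<open>x\<close> is a permutation \<open>s\<close> of the block after a
      permutation of the complement, and the symmetrizer absorbs \<open>s\<close>.\<close>
    case True
    then have xM: "x ` M = M" using card_subset_eq[OF finM True cardx] by simp
    define s where "s i = (if i \<in> M then x i else i)" for i
    have s: "s permutes M"
    proof (rule bij_imp_permutes)
      have "bij_betw x M M" using xM permutes_inj_on[OF x] by (simp add: bij_betw_def)
      then show "bij_betw s M M" by (rule bij_betw_cong[THEN iffD1, rotated]) (simp add: s_def)
    qed (simp add: s_def)
    have y: "inv s \<circ> x permutes \<Omega> - M"
    proof (rule permutes_superset[where S = \<Omega>])
      show "inv s \<circ> x permutes \<Omega>" by (rule permutes_compose[OF x permutes_subset[OF permutes_inv[OF s] sub]])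
      fix i assume "i \<in> \<Omega> - (\<Omega> - M)"
      then have "x i = s i" by (auto simp: s_def)
      then show "(inv s \<circ> x) i = i" by (simp add: permutes_inverses[OF s])
    qed
    have "F (s \<circ> (inv s \<circ> x)) = F (inv s \<circ> x)" by (rule Fl[OF s])
    moreover have "s \<circ> (inv s \<circ> x) = x" by (simp add: o_assoc permutes_inv_o[OF s])
    ultimately show ?thesis using zero[OF y] by (simp add: F_def)
  next
    case False
    then obtain a where a: "a \<in> M" "x a \<notin> M" by blast
    define k where "k = x a"
    have k: "k \<in> \<Omega>" "k \<notin> M" using a sub permutes_in_image[OF x] by (auto simp: k_def)
    have "\<not> M \<subseteq> x ` M" using card_subset_eq[of "x ` M" M] cardx finM False by auto
    then obtain b0 where b0: "b0 \<in> M" "b0 \<notin> x ` M" by blast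
    define z where "z = tswap k b0 \<circ> x"
    have kb0: "k \<noteq> b0" using k b0 by blast
    have z: "z permutes \<Omega>"
      unfolding z_def by (rule permutes_compose[OF x permutes_swap_id]) (use k b0 sub in auto)
    have za: "z a = b0" by (simp add: z_def k_def)
    have xz: "x = tswap k b0 \<circ> z" by (simp add: z_def o_assoc)
    note injz = permutes_inj[OF z]
    have zM: "z ` M = insert b0 (x ` M - {k})"
    proof -
      have "z ` M = tswap k b0 ` (x ` M)" by (simp add: z_def image_comp)
      also have "\<dots> = tswap k b0 ` insert k (x ` M - {k})" 
        using a by (metis imageI insert_Diff k_def)
      also have "\<dots> = insert b0 (tswap k b0 ` (x ` M - {k}))" by (simp only: image_insert transpose_apply_first)
      also have "tswap k b0 ` (x ` M - {k}) = (\<lambda>u. u) ` (x ` M - {k})"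
        by (rule image_cong) (use b0(2) in \<open>metis DiffD1 DiffD2 singletonI transpose_apply_other\<close>)+
      finally show ?thesis by simp
    qed
    have "z ` M - M \<subset> x ` M - M" using zM a b0 by (auto simp: k_def)
    then have lt: "card (z ` M - M) < card (x ` M - M)" by (rule psubset_card_mono[rotated]) (use finM in simp)
    have Fz: "F z = 0" unfolding F_def by (rule less.hyps[OF lt z])
    have kz: "k \<notin> z ` M" using zM kb0 by auto
    \<comment> \<open>Neither \<open>k\<close> nor \<open>b\<close> is a value of \<open>z\<close>
      on \<open>M\<close>, so the transposition leaves the image of \<open>M\<close> unchanged and
      the induction hypothesis applies.\<close>
    have F0: "F (tswap k b \<circ> z) = 0" if b: "b \<in> M" "b \<notin> z ` M" for b
    proof -
      have "(tswap k b \<circ> z) ` M = (\<lambda>u. u) ` (z ` M)"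
        unfolding image_comp[symmetric] by (rule image_cong) (use b kz in \<open>metis transpose_apply_other\<close>)+
      then have "card ((tswap k b \<circ> z) ` M - M) < card (x ` M - M)" using lt by simp
      moreover have "tswap k b \<circ> z permutes \<Omega>"
        by (rule permutes_compose[OF z permutes_swap_id]) (use b k sub in auto)
      ultimately show ?thesis unfolding F_def by (rule less.hyps)
    qed
    \<comment> \<open>If \<open>b = z a'\<close>, exchanging \<open>b\<close> with \<open>b0\<close>
      after the map and \<open>a\<close> with \<open>a'\<close> before it turns
      \<open>tswap k b \<circ> z\<close> into \<open>x\<close>. Both exchanges stay inside
      \<open>M\<close> and leave \<open>F\<close> unchanged.\<close>
    have Fx: "F (tswap k b \<circ> z) = F x" if b: "b \<in> M" "b \<in> z ` M" for b
    proof (cases "b = b0")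
      case True then show ?thesis using xz by simp
    next
      case bb0: False
      obtain a' where a': "a' \<in> M" "z a' = b" using b by blast
      have kb: "k \<noteq> b" using k b by blast
      have "tswap b b0 \<circ> ((tswap k b \<circ> z) \<circ> tswap a a') = tswap k b0 \<circ> z"
      proof
        fix u
        have eqa: "z u = b0 \<longleftrightarrow> u = a" "z u = b \<longleftrightarrow> u = a'" using za a' injz by (auto dest: injD)
        consider "u = a" | "u = a'" | "u \<noteq> a" "u \<noteq> a'" by blast
        then show "(tswap b b0 \<circ> ((tswap k b \<circ> z) \<circ> tswap a a')) u = (tswap k b0 \<circ> z) u"
        proof cases
          case 1
          then show ?thesis using a' za kb kb0 bb0 by simp
        next
          case 2
          then show ?thesis using a' za kb kb0 bb0 by (simp add: transpose_apply_other)
        next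
          case 3
          then show ?thesis using eqa kb kb0 bb0 by (cases "z u = k") (simp_all add: transpose_apply_other)
        qed
      qed
      then have eq: "x = tswap b b0 \<circ> ((tswap k b \<circ> z) \<circ> tswap a a')" using xz by simp
      have "F x = F ((tswap k b \<circ> z) \<circ> tswap a a')"
        unfolding eq by (rule Fl) (rule permutes_swap_id[OF b(1) b0(1)])
      also have "\<dots> = F (tswap k b \<circ> z)"
        by (rule Fr[OF permutes_swap_id[OF a(1) a'(1)]], rule permutes_compose[OF z permutes_swap_id])
          (use b k sub in auto)
      finally show ?thesis by simp
    qed
    have "sym_sum (insert k M) f z = 0" by (rule van) (use k z in auto)
    then have "F z + (\<Sum>b\<in>M. F (tswap k b \<circ> z)) = 0"
      unfolding F_def sym_sum_insert[OF finM k(2)] .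
    moreover have "(\<Sum>b\<in>M. F (tswap k b \<circ> z)) = (\<Sum>b\<in>M. if b \<in> z ` M then F x else 0)"
      by (intro sum.cong refl) (use F0 Fx in auto)
    moreover have "\<dots> = of_nat (card (M \<inter> z ` M)) * F x"
      using finM by (simp flip: sum.inter_restrict)
    \<comment> \<open>The multiplicity of \<open>F x\<close> is positive because
      \<open>b0 = z a\<close> is counted, and characteristic zero allows division by it.\<close>
    moreover have "card (M \<inter> z ` M) \<noteq> 0" using b0(1) za a(1) finM by auto
    ultimately show ?thesis using Fz by (simp add: F_def)
  qed
qed

section \<open>Content products, generic parameters and the possible eigenvalues\<close>

text \<open>The product of \<open>q + c\<close> over the contents \<open>c\<close> (column minus
  row) of the boxes: each row starts one content lower than the row above, hence
  \<open>q - 1\<close>.\<close>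

fun content_prod :: "nat list \<Rightarrow> 'b \<Rightarrow> 'b::comm_ring_1" where
  "content_prod [] q = 1"
| "content_prod (m # l) q = pochhammer q m * content_prod l (q - 1)"

definition is_partition :: "nat list \<Rightarrow> bool" where
  "is_partition l \<longleftrightarrow> sorted_wrt (\<ge>) l \<and> 0 \<notin> set l"

text \<open>All shifts \<open>q - j\<close> are included because each peeled row lowers
  \<open>q\<close> by one. Partitions of all sizes are compared at once, so that no size has to be
  carried along.\<close>

definition generic :: "'b::field_char_0 \<Rightarrow> bool" where
  "generic q \<longleftrightarrow> (\<forall>j l. is_partition l \<longrightarrow> content_prod l (q - of_nat j) \<noteq> 0) \<and>
    (\<forall>j l l'. is_partition l \<longrightarrow> is_partition l' \<longrightarrow>
      content_prod l (q - of_nat j) = content_prod l' (q - of_nat j) \<longrightarrow> l = l')"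

lemma generic_shift: "generic q \<Longrightarrow> generic (q - 1)"
proof -
  assume q: "generic q"
  have "q - 1 - of_nat j = q - of_nat (Suc j)" for j by simp
  then show ?thesis using q unfolding generic_def by (simp only:) blast
qed

lemma generic_pochhammer:
  assumes "generic q"
  shows "pochhammer q m \<noteq> 0"
proof (cases "m = 0")
  case False
  then have "is_partition [m]" by (simp add: is_partition_def)
  then have "content_prod [m] (q - of_nat 0) \<noteq> 0" using assms unfolding generic_def by blast
  then show ?thesis by simp
qed simp

lemma generic_inj: "generic q \<Longrightarrow> is_partition l \<Longrightarrow> is_partition l' \<Longrightarrow> content_prod l q = content_prod l' q \<Longrightarrow> l = l'"
  unfolding generic_def by (metis diff_zero of_nat_0)

definition eigen :: "'a set \<Rightarrow> 'b \<Rightarrow> 'b \<Rightarrow> (('a \<Rightarrow> 'a) \<Rightarrow> 'b::field_char_0) \<Rightarrow> bool" where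
  "eigen \<Omega> q \<theta> f \<longleftrightarrow> class_fun \<Omega> f \<and> (\<forall>x. x permutes \<Omega> \<longrightarrow> cyc_sum \<Omega> q f x = \<theta> * f x)"

text \<open>The convolution commutes with translations, so the symmetrized convolution of
  \<open>f\<close> is \<open>\<theta>\<close> times the symmetrization;
  \<open>sym_sum_cyc_sum\<close>, with \<open>K\<close> the whole complement, evaluates the same sum
  in a second way.\<close>

lemma eigen_restrict:
  fixes f :: "('a \<Rightarrow> 'a) \<Rightarrow> 'b::field_char_0"
  assumes fin: "finite \<Omega>" and sub: "M \<subseteq> \<Omega>" and e: "eigen \<Omega> q \<theta> f"
    and van: "\<And>k z. k \<in> \<Omega> - M \<Longrightarrow> z permutes \<Omega> \<Longrightarrow> sym_sum (insert k M) f z = 0"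
    and nz: "pochhammer q (card M) \<noteq> 0"
  shows "eigen (\<Omega> - M) (q - 1) (\<theta> / pochhammer q (card M)) (sym_sum M f)"
proof -
  have cls: "class_fun \<Omega> f" using e by (simp add: eigen_def)
  have "cyc_sum (\<Omega> - M) (q - 1) (sym_sum M f) y = \<theta> / pochhammer q (card M) * sym_sum M f y"
    if y: "y permutes \<Omega> - M" for y
  proof -
    have y': "y permutes \<Omega>" using y by (rule permutes_subset) auto
    have MK: "M \<union> (\<Omega> - M) = \<Omega>" using sub by blast
    have "pochhammer q (card M) * cyc_sum (\<Omega> - M) (q - 1) (sym_sum M f) y
      = (\<Sum>s | s permutes M. cyc_sum (M \<union> (\<Omega> - M)) q (\<lambda>y. f (s \<circ> y)) y)"
      by (rule sym_sum_cyc_sum[symmetric]) (use fin sub cls van y' in auto)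
    also have "\<dots> = (\<Sum>s | s permutes M. \<theta> * f (s \<circ> y))"
      unfolding MK
    proof (rule sum.cong)
      fix s assume "s \<in> {s. s permutes M}"
      then have s: "s permutes \<Omega>" using sub permutes_subset by blast
      have "cyc_sum \<Omega> q (\<lambda>y. f (s \<circ> y)) y = cyc_sum \<Omega> q f (s \<circ> y)"
        by (rule cyc_sum_shift[OF s, symmetric])
      also have "\<dots> = \<theta> * f (s \<circ> y)"
        using e permutes_compose[OF y' s] unfolding eigen_def by blast
      finally show "cyc_sum \<Omega> q (\<lambda>y. f (s \<circ> y)) y = \<theta> * f (s \<circ> y)" .
    qed simp
    also have "\<dots> = \<theta> * sym_sum M f y" by (simp add: sym_sum_def sum_distrib_left)
    finally show ?thesis using nz by (simp add: field_simps)
  qed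
  then show ?thesis using class_fun_sym_sum[OF fin sub cls] by (simp add: eigen_def)
qed

text \<open>\<open>M\<close> has maximal size among the blocks whose symmetrizer does not kill
  \<open>f\<close>. Permutations of disjoint blocks commute, so longer blocks also kill the
  restriction; by this last conclusion the next row is no longer than this one.\<close>

lemma eigen_level:
  fixes f :: "('a \<Rightarrow> 'a) \<Rightarrow> 'b::field_char_0"
  assumes fin: "finite \<Omega>" "\<Omega> \<noteq> {}" and e: "eigen \<Omega> q \<theta> f"
    and nz: "x0 permutes \<Omega>" "f x0 \<noteq> 0" and gen: "generic q"
  obtains M where "M \<subseteq> \<Omega>" "M \<noteq> {}"
    "\<forall>M' x. M' \<subseteq> \<Omega> \<longrightarrow> card M < card M' \<longrightarrow> x permutes \<Omega> \<longrightarrow> sym_sum M' f x = 0"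
    "\<exists>y. y permutes \<Omega> - M \<and> sym_sum M f y \<noteq> 0"
    "eigen (\<Omega> - M) (q - 1) (\<theta> / pochhammer q (card M)) (sym_sum M f)"
    "\<forall>M' x. M' \<subseteq> \<Omega> - M \<longrightarrow> card M < card M' \<longrightarrow> x permutes \<Omega> - M \<longrightarrow> sym_sum M' (sym_sum M f) x = 0"
proof -
  have cls: "class_fun \<Omega> f" using e by (simp add: eigen_def)
  define S where "S = {M. M \<subseteq> \<Omega> \<and> (\<exists>x. x permutes \<Omega> \<and> sym_sum M f x \<noteq> 0)}"
  have finS: "finite S" unfolding S_def using fin by auto
  obtain v where v: "v \<in> \<Omega>" using fin by blast
  have "sym_sum {v} f x0 = f x0" by (simp add: sym_sum_def)
  then have vS: "{v} \<in> S" unfolding S_def using v nz by auto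
  have "Max (card ` S) \<in> card ` S" by (rule Max_in) (use finS vS in auto)
  then obtain M where M: "M \<in> S" "card M = Max (card ` S)" by auto
  have max: "card M' \<le> card M" if "M' \<in> S" for M'
    unfolding M(2) by (rule Max_ge) (use finS that in auto)
  have sub: "M \<subseteq> \<Omega>" using M(1) by (simp add: S_def)
  have finM: "finite M" using fin sub finite_subset by blast
  have ne: "M \<noteq> {}" using max[OF vS] by auto
  have big: "sym_sum M' f x = 0" if "M' \<subseteq> \<Omega>" "card M < card M'" "x permutes \<Omega>" for M' x
  proof (rule ccontr)
    assume "sym_sum M' f x \<noteq> 0"
    then have "M' \<in> S" unfolding S_def using that by blast
    then show False using max that(2) by (simp add: leD)
  qed
  have van: "sym_sum (insert k M) f z = 0" if "k \<in> \<Omega> - M" "z permutes \<Omega>" for k z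
    by (rule big) (use that sub finM in auto)
  have nzM: "\<exists>y. y permutes \<Omega> - M \<and> sym_sum M f y \<noteq> 0"
    using sym_sum_extend_zero[OF fin(1) sub cls van] M(1) unfolding S_def by blast
  have eM: "eigen (\<Omega> - M) (q - 1) (\<theta> / pochhammer q (card M)) (sym_sum M f)"
    by (rule eigen_restrict[OF fin(1) sub e van generic_pochhammer[OF gen]])
  have bigM: "sym_sum M' (sym_sum M f) x = 0"
    if M': "M' \<subseteq> \<Omega> - M" "card M < card M'" and x: "x permutes \<Omega> - M" for M' x
  proof -
    have "sym_sum M' (sym_sum M f) x = (\<Sum>s | s permutes M. \<Sum>s' | s' permutes M'. f (s \<circ> (s' \<circ> x)))"
      unfolding sym_sum_def by (rule sum.swap)
    also have "\<dots> = (\<Sum>s | s permutes M. sym_sum M' f (s \<circ> x))"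
      unfolding sym_sum_def
    proof (intro sum.cong refl)
      fix s s' assume "s \<in> {s. s permutes M}" "s' \<in> {s'. s' permutes M'}"
      then have "s \<circ> s' = s' \<circ> s" by (intro permutes_disjoint_commute[where M = M and N = M']) (use M' in auto)
      then show "f (s \<circ> (s' \<circ> x)) = f (s' \<circ> (s \<circ> x))" by (simp only: o_assoc)
    qed
    also have "\<dots> = 0"
    proof (rule sum.neutral, rule ballI)
      fix s assume "s \<in> {s. s permutes M}"
      then have "s permutes \<Omega>" using sub permutes_subset by blast
      moreover have "x permutes \<Omega>" using x by (rule permutes_subset) auto
      ultimately have "s \<circ> x permutes \<Omega>" by (simp add: permutes_compose)
      then show "sym_sum M' f (s \<circ> x) = 0" using M' by (intro big) auto
    qed
    finally show ?thesis .
  qed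
  show thesis by (rule that[OF sub ne _ nzM eM]) (use big bigM in blast)+
qed

text \<open>The bound \<open>m0\<close> on surviving block sizes is carried along so that the peeled
  lengths decrease. A nonzero value is passed on to each restriction, so the peeling ends only at
  the empty set, where \<open>\<theta> = 1\<close>.\<close>

lemma eigen_spectrum:
  fixes f :: "('a \<Rightarrow> 'a) \<Rightarrow> 'b::field_char_0"
  assumes "finite \<Omega>" "eigen \<Omega> q \<theta> f" "x0 permutes \<Omega>" "f x0 \<noteq> 0" "generic q"
    and "\<forall>M x. M \<subseteq> \<Omega> \<longrightarrow> m0 < card M \<longrightarrow> x permutes \<Omega> \<longrightarrow> sym_sum M f x = 0"
  shows "\<exists>l. is_partition l \<and> sum_list l = card \<Omega> \<and> (\<forall>a\<in>set l. a \<le> m0) \<and> \<theta> = content_prod l q"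
  using assms
proof (induction "card \<Omega>" arbitrary: \<Omega> q \<theta> f x0 m0 rule: less_induct)
  case less
  show ?case
  proof (cases "\<Omega> = {}")
    case True
    then have "x0 = id" using less.prems(3) by simp
    moreover have "f x0 = \<theta> * f x0" using less.prems(2,3) True by (simp add: eigen_def)
    ultimately have "\<theta> = 1" using less.prems(4) by simp
    then show ?thesis using True by (intro exI[of _ "[]"]) (simp add: is_partition_def)
  next
    case False
    obtain M where sub: "M \<subseteq> \<Omega>" and ne: "M \<noteq> {}"
      and nz: "\<exists>y. y permutes \<Omega> - M \<and> sym_sum M f y \<noteq> 0"
      and e: "eigen (\<Omega> - M) (q - 1) (\<theta> / pochhammer q (card M)) (sym_sum M f)"
      and big: "\<forall>M' x. M' \<subseteq> \<Omega> - M \<longrightarrow> card M < card M' \<longrightarrow> x permutes \<Omega> - M \<longrightarrow> sym_sum M' (sym_sum M f) x = 0"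
      by (rule eigen_level[OF less.prems(1) False less.prems(2,3,4,5)]) (rule that; assumption)
    have finM: "finite M" using less.prems(1) sub finite_subset by blast
    obtain y where y: "y permutes \<Omega> - M" "sym_sum M f y \<noteq> 0" using nz by blast
    have y': "y permutes \<Omega>" using y(1) by (rule permutes_subset) auto
    have lt: "card (\<Omega> - M) < card \<Omega>"
      by (rule psubset_card_mono) (use less.prems(1) sub ne in auto)
    have le: "card M \<le> m0" using less.prems(6) sub y' y(2) by (intro leI) blast
    obtain l where l: "is_partition l" "sum_list l = card (\<Omega> - M)" "\<forall>a\<in>set l. a \<le> card M"
      "\<theta> / pochhammer q (card M) = content_prod l (q - 1)"
      using less.hyps[OF lt _ e y generic_shift[OF less.prems(5)] big] less.prems(1) by auto
    have "card (\<Omega> - M) = card \<Omega> - card M" "card M \<le> card \<Omega>"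
      using finM sub less.prems(1) by (simp_all add: card_Diff_subset card_mono)
    moreover have "\<theta> = content_prod (card M # l) q"
      using l(4) generic_pochhammer[OF less.prems(5), of "card M"] by (simp add: field_simps)
    moreover have "card M \<noteq> 0" using ne finM by simp
    ultimately show ?thesis using l le by (intro exI[of _ "card M # l"]) (auto simp: is_partition_def)
  qed
qed

text \<open>Writes \<open>\<theta>\<close> as the content product of a partition with first row
  \<open>card M\<close>; for generic \<open>q\<close> the level of an eigenfunction is therefore
  determined by its eigenvalue.\<close>

lemma eigen_step:
  fixes f :: "('a \<Rightarrow> 'a) \<Rightarrow> 'b::field_char_0"
  assumes fin: "finite \<Omega>" "\<Omega> \<noteq> {}" and e: "eigen \<Omega> q \<theta> f"
    and nz: "x0 permutes \<Omega>" "f x0 \<noteq> 0" and gen: "generic q"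
  obtains M r where "M \<subseteq> \<Omega>" "M \<noteq> {}"
    "\<forall>M' x. M' \<subseteq> \<Omega> \<longrightarrow> card M < card M' \<longrightarrow> x permutes \<Omega> \<longrightarrow> sym_sum M' f x = 0"
    "\<exists>y. y permutes \<Omega> - M \<and> sym_sum M f y \<noteq> 0"
    "eigen (\<Omega> - M) (q - 1) (\<theta> / pochhammer q (card M)) (sym_sum M f)"
    "is_partition (card M # r)" "\<theta> = content_prod (card M # r) q"
proof -
  obtain M where M: "M \<subseteq> \<Omega>" "M \<noteq> {}"
    "\<forall>M' x. M' \<subseteq> \<Omega> \<longrightarrow> card M < card M' \<longrightarrow> x permutes \<Omega> \<longrightarrow> sym_sum M' f x = 0"
    "\<exists>y. y permutes \<Omega> - M \<and> sym_sum M f y \<noteq> 0"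
    "eigen (\<Omega> - M) (q - 1) (\<theta> / pochhammer q (card M)) (sym_sum M f)"
    "\<forall>M' x. M' \<subseteq> \<Omega> - M \<longrightarrow> card M < card M' \<longrightarrow> x permutes \<Omega> - M \<longrightarrow> sym_sum M' (sym_sum M f) x = 0"
    by (rule eigen_level[OF fin e nz gen]) (rule that; assumption)
  obtain y where y: "y permutes \<Omega> - M" "sym_sum M f y \<noteq> 0" using M(4) by blast
  obtain r where r: "is_partition r" "\<forall>a\<in>set r. a \<le> card M" "\<theta> / pochhammer q (card M) = content_prod r (q - 1)"
    using eigen_spectrum[OF _ M(5) y generic_shift[OF gen] M(6)] fin by auto
  have "card M \<noteq> 0" using M(1,2) fin(1) finite_subset[of M \<Omega>] by simp
  then have "is_partition (card M # r)" using r by (auto simp: is_partition_def)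
  moreover have "\<theta> = content_prod (card M # r) q"
    using r(3) generic_pochhammer[OF gen, of "card M"] by (simp add: field_simps)
  ultimately show thesis using that M(1-5) by blast
qed

section \<open>Multiplicity one for generic parameters\<close>

lemma permutes_conj_image:
  assumes "t permutes M" "bij p"
  shows "p \<circ> t \<circ> inv p permutes p ` M"
proof (rule bij_imp_permutes)
  have 1: "bij_betw (inv p) (p ` M) M"
    unfolding bij_betw_def using assms(2)
    by (auto simp: bij_is_inj image_inv_f_f bij_imp_bij_inv intro!: inj_on_subset[OF bij_is_inj[OF bij_imp_bij_inv[OF assms(2)]]])
  have "bij_betw p M (p ` M)" by (rule inj_on_imp_bij_betw[OF inj_on_subset[OF bij_is_inj[OF assms(2)]]]) simp
  then show "bij_betw (p \<circ> t \<circ> inv p) (p ` M) (p ` M)"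
    using 1 permutes_imp_bij[OF assms(1)] by (blast intro: bij_betw_trans)
  fix x assume "x \<notin> p ` M"
  then have "inv p x \<notin> M" using surj_f_inv_f[OF bij_is_surj[OF assms(2)], of x] by (metis imageI)
  then show "(p \<circ> t \<circ> inv p) x = x"
    using permutes_not_in[OF assms(1)] assms(2) by (simp add: bij_is_surj surj_f_inv_f)
qed

text \<open>For a class function, conjugation by \<open>p\<close> moves the block, so whether a
  symmetrizer kills \<open>f\<close> depends only on the size of the block.\<close>

lemma sym_sum_image:
  fixes f :: "('a \<Rightarrow> 'a) \<Rightarrow> 'b::field_char_0"
  assumes "p permutes \<Omega>" "M \<subseteq> \<Omega>" "class_fun \<Omega> f" "x permutes \<Omega>"
  shows "sym_sum (p ` M) f x = sym_sum M f (inv p \<circ> x \<circ> p)"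
  unfolding sym_sum_def
proof (rule sum.reindex_bij_witness[where i = "\<lambda>t. p \<circ> t \<circ> inv p" and j = "\<lambda>s. inv p \<circ> s \<circ> p"])
  note p = permutes_inv_o[OF assms(1)] permutes_bij[OF assms(1)]
  fix t assume t: "t \<in> {t. t permutes M}"
  show "inv p \<circ> (p \<circ> t \<circ> inv p) \<circ> p = t" by (simp add: fun_eq_iff permutes_inverses[OF assms(1)])
  show "p \<circ> t \<circ> inv p \<in> {s. s permutes p ` M}" using permutes_conj_image t p by blast
next
  note p = permutes_inv_o[OF assms(1)] permutes_bij[OF assms(1)]
  fix s assume s: "s \<in> {s. s permutes p ` M}"
  show "p \<circ> (inv p \<circ> s \<circ> p) \<circ> inv p = s" by (simp add: fun_eq_iff permutes_inverses[OF assms(1)])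
  have "inv p \<circ> s \<circ> inv (inv p) permutes inv p ` (p ` M)"
    by (rule permutes_conj_image) (use s permutes_bij[OF permutes_inv[OF assms(1)]] in auto)
  then have sp: "inv p \<circ> s \<circ> p permutes M"
    using p by (simp add: inv_inv_eq image_image permutes_inverses[OF assms(1)])
  then show "inv p \<circ> s \<circ> p \<in> {t. t permutes M}" by simp
  have a: "inv p permutes \<Omega>" "s permutes \<Omega>"
    using s assms permutes_inv permutes_subset[of s "p ` M" \<Omega>] permutes_image[OF assms(1)] by blast+
  have "f (inv p \<circ> s \<circ> p \<circ> (inv p \<circ> x \<circ> p)) = f (inv p \<circ> (s \<circ> x \<circ> p))"
    by (simp add: comp_def permutes_inverses[OF assms(1)])
  also have "\<dots> = f ((s \<circ> x \<circ> p) \<circ> inv p)"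
    by (rule class_funD[OF assms(3) a(1)]) (intro permutes_compose assms a)
  also have "\<dots> = f (s \<circ> x)" by (simp add: comp_def permutes_inverses[OF assms(1)])
  finally show "f (inv p \<circ> s \<circ> p \<circ> (inv p \<circ> x \<circ> p)) = f (s \<circ> x)" .
qed

lemma exists_permutes_image:
  assumes "finite \<Omega>" "M \<subseteq> \<Omega>" "N \<subseteq> \<Omega>" "card M = card N"
  obtains p where "p permutes \<Omega>" "p ` M = N"
proof -
  have fin: "finite M" "finite N" using assms finite_subset by blast+
  obtain h where h: "bij_betw h M N"
    using finite_same_card_bij[OF fin assms(4)] by blast
  have "card (\<Omega> - M) = card (\<Omega> - N)" using assms fin by (simp add: card_Diff_subset)
  then obtain h' where h': "bij_betw h' (\<Omega> - M) (\<Omega> - N)"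
    using finite_same_card_bij[of "\<Omega> - M" "\<Omega> - N"] assms by blast
  define p where "p x = (if x \<in> M then h x else if x \<in> \<Omega> then h' x else x)" for x
  have 1: "bij_betw p M N" using h by (rule bij_betw_cong[THEN iffD1, rotated]) (simp add: p_def)
  have 2: "bij_betw p (\<Omega> - M) (\<Omega> - N)"
    using h' by (rule bij_betw_cong[THEN iffD1, rotated]) (simp add: p_def)
  have "bij_betw p (M \<union> (\<Omega> - M)) (N \<union> (\<Omega> - N))" by (rule bij_betw_combine[OF 1 2]) auto
  moreover have "M \<union> (\<Omega> - M) = \<Omega>" "N \<union> (\<Omega> - N) = \<Omega>" using assms by auto
  ultimately have "bij_betw p \<Omega> \<Omega>" by simp
  then have "p permutes \<Omega>" by (rule bij_imp_permutes) (use assms in \<open>auto simp: p_def\<close>)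
  moreover have "p ` M = N" using 1 by (simp add: bij_betw_def)
  ultimately show thesis by (rule that)
qed

lemma eigen_lin:
  assumes "eigen \<Omega> q \<theta> f" "eigen \<Omega> q \<theta> f'"
  shows "eigen \<Omega> q \<theta> (\<lambda>x. \<alpha> * f x + \<beta> * f' x)"
proof -
  have "cyc_sum \<Omega> q (\<lambda>x. \<alpha> * f x + \<beta> * f' x) x = \<alpha> * cyc_sum \<Omega> q f x + \<beta> * cyc_sum \<Omega> q f' x" for x
    by (simp add: cyc_sum_def algebra_simps sum.distrib sum_distrib_left)
  then show ?thesis using assms by (simp add: eigen_def class_fun_def algebra_simps)
qed

lemma sym_sum_lin: "sym_sum M (\<lambda>x. \<alpha> * f x + \<beta> * f' x) x = \<alpha> * sym_sum M f x + \<beta> * sym_sum M f' x"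
  by (simp add: sym_sum_def sum.distrib sum_distrib_left)

text \<open>Both functions have the same level, as it is read off from \<open>\<theta>\<close>.
  Their symmetrizations over one block \<open>M\<close> are dependent by induction, and the same
  combination of \<open>f\<close> and \<open>f'\<close> is killed by that symmetrizer. Were it
  nonzero, it would be an eigenfunction for \<open>\<theta>\<close> and so survive on a block of
  this size.\<close>

lemma eigen_unique:
  fixes f f' :: "('a \<Rightarrow> 'a) \<Rightarrow> 'b::field_char_0"
  assumes "finite \<Omega>" "generic q" "eigen \<Omega> q \<theta> f" "eigen \<Omega> q \<theta> f'"
    "x0 permutes \<Omega>" "f x0 \<noteq> 0" "x1 permutes \<Omega>" "f' x1 \<noteq> 0"
  shows "\<exists>\<alpha> \<beta>. (\<alpha> \<noteq> 0 \<or> \<beta> \<noteq> 0) \<and> (\<forall>x. x permutes \<Omega> \<longrightarrow> \<alpha> * f x + \<beta> * f' x = 0)"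
  using assms
proof (induction "card \<Omega>" arbitrary: \<Omega> q \<theta> f f' x0 x1 rule: less_induct)
  case less
  note fin = less.prems(1) and gen = less.prems(2) and e = less.prems(3) and e' = less.prems(4)
  show ?case
  proof (cases "\<Omega> = {}")
    case True
    then have "x0 = id" "x1 = id" using less.prems by auto
    then show ?thesis using less.prems(6,8) True by (intro exI[of _ "f' id"] exI[of _ "- f id"]) auto
  next
    case False
    have cls: "class_fun \<Omega> f" "class_fun \<Omega> f'" using e e' by (simp_all add: eigen_def)
    obtain M r where M: "M \<subseteq> \<Omega>" "M \<noteq> {}"
      and big: "\<forall>M' x. M' \<subseteq> \<Omega> \<longrightarrow> card M < card M' \<longrightarrow> x permutes \<Omega> \<longrightarrow> sym_sum M' f x = 0"
      and nz: "\<exists>y. y permutes \<Omega> - M \<and> sym_sum M f y \<noteq> 0"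
      and eM: "eigen (\<Omega> - M) (q - 1) (\<theta> / pochhammer q (card M)) (sym_sum M f)"
      and r: "is_partition (card M # r)" "\<theta> = content_prod (card M # r) q"
      by (rule eigen_step[OF fin False e less.prems(5,6) gen]) (rule that; assumption)
    obtain N r' where N: "N \<subseteq> \<Omega>" "N \<noteq> {}"
      and big': "\<forall>M' x. M' \<subseteq> \<Omega> \<longrightarrow> card N < card M' \<longrightarrow> x permutes \<Omega> \<longrightarrow> sym_sum M' f' x = 0"
      and nz': "\<exists>y. y permutes \<Omega> - N \<and> sym_sum N f' y \<noteq> 0"
      and r': "is_partition (card N # r')" "\<theta> = content_prod (card N # r') q"
      by (rule eigen_step[OF fin False e' less.prems(7,8) gen]) (rule that; assumption)
    have MN: "card M = card N" using generic_inj[OF gen r(1) r'(1)] r(2) r'(2) by simp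
    have finM: "finite M" using fin M finite_subset by blast
    have van: "sym_sum (insert k M) f z = 0" "sym_sum (insert k M) f' z = 0"
      if "k \<in> \<Omega> - M" "z permutes \<Omega>" for k z
    proof -
      have "insert k M \<subseteq> \<Omega>" "card M < card (insert k M)" "card N < card (insert k M)"
        using that M finM MN by auto
      then show "sym_sum (insert k M) f z = 0" "sym_sum (insert k M) f' z = 0"
        using big big' that(2) by blast+
    qed
    have eM': "eigen (\<Omega> - M) (q - 1) (\<theta> / pochhammer q (card M)) (sym_sum M f')"
      by (rule eigen_restrict[OF fin M(1) e' van(2) generic_pochhammer[OF gen]])
    \<comment> \<open>The level of \<open>f'\<close> was found on \<open>N\<close>; conjugation
      shows that \<open>f'\<close> survives on \<open>M\<close> too.\<close>
    obtain p where p: "p permutes \<Omega>" "p ` M = N" using exists_permutes_image[OF fin M(1) N(1) MN] .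
    obtain z where z: "z permutes \<Omega> - N" "sym_sum N f' z \<noteq> 0" using nz' by blast
    have z': "z permutes \<Omega>" using z(1) by (rule permutes_subset) auto
    have "sym_sum M f' (inv p \<circ> z \<circ> p) \<noteq> 0"
      using z(2) sym_sum_image[OF p(1) M(1) cls(2) z'] p(2) by simp
    moreover have "inv p \<circ> z \<circ> p permutes \<Omega>" by (intro permutes_compose permutes_inv p z')
    ultimately obtain y' where y': "y' permutes \<Omega> - M" "sym_sum M f' y' \<noteq> 0"
      using sym_sum_extend_zero[OF fin M(1) cls(2) van(2)] by blast
    obtain y where y: "y permutes \<Omega> - M" "sym_sum M f y \<noteq> 0" using nz by blast
    have lt: "card (\<Omega> - M) < card \<Omega>"
      by (rule psubset_card_mono) (use fin M in auto)
    have "\<exists>\<alpha> \<beta>. (\<alpha> \<noteq> 0 \<or> \<beta> \<noteq> 0) \<and>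
      (\<forall>x. x permutes \<Omega> - M \<longrightarrow> \<alpha> * sym_sum M f x + \<beta> * sym_sum M f' x = 0)"
      by (rule less.hyps[of "\<Omega> - M" "q - 1" "\<theta> / pochhammer q (card M)" "sym_sum M f" "sym_sum M f'" y y',
            OF lt finite_Diff[OF fin] generic_shift[OF gen] eM eM' y y'])
    then obtain \<alpha> \<beta> where ab: "\<alpha> \<noteq> 0 \<or> \<beta> \<noteq> 0"
      "\<And>x. x permutes \<Omega> - M \<Longrightarrow> \<alpha> * sym_sum M f x + \<beta> * sym_sum M f' x = 0" by blast
    define g where "g x = \<alpha> * f x + \<beta> * f' x" for x
    have eg: "eigen \<Omega> q \<theta> g" unfolding g_def by (rule eigen_lin[OF e e'])
    have clg: "class_fun \<Omega> g" using eg by (simp add: eigen_def)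
    have symg: "sym_sum M' g x = \<alpha> * sym_sum M' f x + \<beta> * sym_sum M' f' x" for M' x
      unfolding g_def by (rule sym_sum_lin)
    have "g x = 0" if x: "x permutes \<Omega>" for x
    proof (rule ccontr)
      assume gx: "g x \<noteq> 0"
      obtain L s where L: "L \<subseteq> \<Omega>" and nzL: "\<exists>y. y permutes \<Omega> - L \<and> sym_sum L g y \<noteq> 0"
        and s: "is_partition (card L # s)" "\<theta> = content_prod (card L # s) q"
        by (rule eigen_step[OF fin False eg x gx gen]) (rule that; assumption)
      have cML: "card M = card L" using generic_inj[OF gen r(1) s(1)] r(2) s(2) by simp
      obtain p where p: "p permutes \<Omega>" "p ` M = L" using exists_permutes_image[OF fin M(1) L cML] .
      obtain z where z: "z permutes \<Omega> - L" "sym_sum L g z \<noteq> 0" using nzL by blast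
      have z': "z permutes \<Omega>" using z(1) by (rule permutes_subset) auto
      have "sym_sum M g (inv p \<circ> z \<circ> p) = 0"
      proof (rule sym_sum_extend_zero[OF fin M(1) clg])
        show "inv p \<circ> z \<circ> p permutes \<Omega>" by (intro permutes_compose permutes_inv p z')
      qed (simp_all add: symg van ab)
      then show False using z(2) sym_sum_image[OF p(1) M(1) clg z'] p(2) by simp
    qed
    then show ?thesis using ab(1) unfolding g_def by blast
  qed
qed

section \<open>Hermitian kernels with simple spectrum\<close>

lemma jordan_matrix_bidiagonal:
  assumes "i < sum_list (map fst n_as)" "j < sum_list (map fst n_as)"
  shows "i \<noteq> j \<Longrightarrow> j \<noteq> Suc i \<Longrightarrow> jordan_matrix n_as $$ (i, j) = 0"
    and "j = Suc i \<Longrightarrow> jordan_matrix n_as $$ (i, j) \<noteq> 0 \<Longrightarrow>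
      jordan_matrix n_as $$ (i, i) = jordan_matrix n_as $$ (j, j)"
proof -
  have "(i \<noteq> j \<longrightarrow> j \<noteq> Suc i \<longrightarrow> jordan_matrix n_as $$ (i, j) = 0) \<and>
    (j = Suc i \<longrightarrow> jordan_matrix n_as $$ (i, j) \<noteq> 0 \<longrightarrow>
      jordan_matrix n_as $$ (i, i) = jordan_matrix n_as $$ (j, j))"
    using assms
  proof (induction n_as arbitrary: i j)
    case Nil
    then show ?case by simp
  next
    case (Cons na n_as)
    obtain m a where na: "na = (m, a)" by force
    have i: "i < m + sum_list (map fst n_as)" and j: "j < m + sum_list (map fst n_as)"
      using Cons.prems na by auto
    have J: "jordan_matrix (na # n_as) $$ (i', j') =
        (if i' < m then if j' < m then jordan_block m a $$ (i', j') else 0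
         else if j' < m then 0 else jordan_matrix n_as $$ (i' - m, j' - m))"
      if "i' < m + sum_list (map fst n_as)" "j' < m + sum_list (map fst n_as)" for i' j'
      unfolding na jordan_matrix_Cons using that by auto
    show ?case
      using Cons.IH[of "i - m" "j - m"] i j
      by (auto simp: J jordan_block_def Suc_diff_le)
  qed
  then show "i \<noteq> j \<Longrightarrow> j \<noteq> Suc i \<Longrightarrow> jordan_matrix n_as $$ (i, j) = 0"
    and "j = Suc i \<Longrightarrow> jordan_matrix n_as $$ (i, j) \<noteq> 0 \<Longrightarrow>
      jordan_matrix n_as $$ (i, i) = jordan_matrix n_as $$ (j, j)" by blast+
qed

lemma hermitian_sum_swap:
  fixes K :: "nat \<Rightarrow> nat \<Rightarrow> complex"
  assumes herm: "\<And>i j. i < n \<Longrightarrow> j < n \<Longrightarrow> K j i = cnj (K i j)"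
  shows "(\<Sum>i<n. cnj (p i) * (\<Sum>j<n. K i j * r j)) = (\<Sum>j<n. cnj (\<Sum>i<n. K j i * p i) * r j)"
proof -
  have "(\<Sum>i<n. cnj (p i) * (\<Sum>j<n. K i j * r j)) = (\<Sum>i<n. \<Sum>j<n. cnj (p i) * K i j * r j)"
    by (simp add: sum_distrib_left mult.assoc)
  also have "\<dots> = (\<Sum>j<n. \<Sum>i<n. cnj (p i) * K i j * r j)" by (rule sum.swap)
  also have "\<dots> = (\<Sum>j<n. \<Sum>i<n. cnj (K j i * p i) * r j)"
  proof (intro sum.cong refl)
    fix i j assume "j \<in> {..<n}" "i \<in> {..<n}"
    then have "K i j = cnj (K j i)" by (intro herm) auto
    then show "cnj (p i) * K i j * r j = cnj (K j i * p i) * r j" by simp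
  qed
  finally show ?thesis by (simp add: sum_distrib_right)
qed

text \<open>The Jordan normal form has no superdiagonal entry: an entry \<open>c\<close> would give
  \<open>K v = a v\<close> and \<open>K w = a w + c v\<close>, and pairing with \<open>v\<close>
  leaves \<open>c |v|^2 = 0\<close>, as \<open>K\<close> is self-adjoint and \<open>a\<close> is
  real.\<close>

lemma hermitian_diagonalizable:
  fixes K :: "nat \<Rightarrow> nat \<Rightarrow> complex"
  assumes herm: "\<And>i j. i < n \<Longrightarrow> j < n \<Longrightarrow> K j i = cnj (K i j)"
  obtains P Q d where
    "\<And>i j. i < n \<Longrightarrow> j < n \<Longrightarrow> (\<Sum>k<n. P i k * Q k j) = of_bool (i = j)"
    "\<And>i j. i < n \<Longrightarrow> j < n \<Longrightarrow> (\<Sum>k<n. Q i k * P k j) = of_bool (i = j)"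
    "\<And>i j. i < n \<Longrightarrow> j < n \<Longrightarrow> (\<Sum>k<n. K i k * P k j) = d j * P i j"
proof -
  define M where "M = mat n n (\<lambda>(i, j). K i j)"
  have M: "M \<in> carrier_mat n n" by (simp add: M_def)
  obtain as where "char_poly M = (\<Prod>a\<leftarrow>as. [:- a, 1:])" using char_poly_factorized[OF M] by blast
  then obtain n_as where "jordan_nf M n_as" using jordan_nf_exists[OF M] by blast
  then obtain Pm Qm where sim: "similar_mat_wit M (jordan_matrix n_as) Pm Qm"
    unfolding jordan_nf_def similar_mat_def by blast
  define J where "J = jordan_matrix n_as"
  note S = similar_mat_witD2[OF M sim, folded J_def]
  have nn: "sum_list (map fst n_as) = n"
    using S(5) unfolding J_def by (metis carrier_matD(1) jordan_matrix_dim(1))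
  define P Q where "P i j = Pm $$ (i, j)" and "Q i j = Qm $$ (i, j)" for i j
  have prod: "(X * Y) $$ (i, j) = (\<Sum>k<n. X $$ (i, k) * Y $$ (k, j))"
    if "X \<in> carrier_mat n n" "Y \<in> carrier_mat n n" "i < n" "j < n" for X Y :: "complex mat" and i j
    using that by (simp add: scalar_prod_def atLeast0LessThan)
  have PQ: "(\<Sum>k<n. P i k * Q k j) = of_bool (i = j)" if "i < n" "j < n" for i j
  proof -
    have "(\<Sum>k<n. P i k * Q k j) = (Pm * Qm) $$ (i, j)" by (simp only: prod[OF S(6,7) that] P_def Q_def)
    also have "\<dots> = of_bool (i = j)" unfolding S(1) using that by simp
    finally show ?thesis .
  qed
  have QP: "(\<Sum>k<n. Q i k * P k j) = of_bool (i = j)" if "i < n" "j < n" for i j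
  proof -
    have "(\<Sum>k<n. Q i k * P k j) = (Qm * Pm) $$ (i, j)" by (simp only: prod[OF S(7,6) that] P_def Q_def)
    also have "\<dots> = of_bool (i = j)" unfolding S(2) using that by simp
    finally show ?thesis .
  qed
  have "M * Pm = Pm * J * (Qm * Pm)"
    unfolding S(3) using S(5,6,7) by (simp add: assoc_mult_mat[of _ n n _ n _ n])
  then have MP: "M * Pm = Pm * J" using S by simp
  have KP: "(\<Sum>k<n. K i k * P k j) = (\<Sum>k<n. P i k * J $$ (k, j))" if "i < n" "j < n" for i j
  proof -
    have "(\<Sum>k<n. K i k * P k j) = (M * Pm) $$ (i, j)"
      using prod[OF M S(6) that] that by (simp add: M_def P_def)
    also have "\<dots> = (\<Sum>k<n. P i k * J $$ (k, j))"
      unfolding MP using prod[OF S(6,5) that] by (simp add: P_def)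
    finally show ?thesis .
  qed
  define N where "N p = (\<Sum>i<n. cnj (P i p) * P i p)" for p
  have N: "N p \<noteq> 0" if "p < n" for p
  proof
    assume "N p = 0"
    then have "of_real (\<Sum>i<n. (cmod (P i p))\<^sup>2) = (0 :: complex)"
      unfolding N_def of_real_sum complex_norm_square by (simp only: mult.commute)
    then have "(\<Sum>i<n. (cmod (P i p))\<^sup>2) = 0" by (simp only: of_real_eq_0_iff)
    then have "\<forall>i<n. P i p = 0" by (subst (asm) sum_nonneg_eq_0_iff) auto
    then show False using QP[OF that that] by simp
  qed
  \<comment> \<open>Strong induction looks at the first nonzero superdiagonal entry, for which
    column \<open>i\<close> of \<open>P\<close> is a true eigenvector.\<close>
  have off: "J $$ (i, Suc i) = 0" if "Suc i < n" for i
    using that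
  proof (induction i rule: less_induct)
    case (less i)
    show ?case
    proof (rule ccontr)
      assume c: "J $$ (i, Suc i) \<noteq> 0"
      have a: "J $$ (i, i) = J $$ (Suc i, Suc i)"
        using jordan_matrix_bidiagonal(2)[of i n_as "Suc i"] c less.prems nn by (simp add: J_def)
      define a where "a = J $$ (i, i)"
      have K1: "(\<Sum>k<n. K x k * P k i) = a * P x i" if "x < n" for x
      proof -
        have "(\<Sum>k<n. P x k * J $$ (k, i)) = (\<Sum>k<n. if k = i then a * P x i else 0)"
        proof (intro sum.cong refl)
          fix k assume "k \<in> {..<n}"
          then have k: "k < n" by simp
          consider "k = i" | "i = Suc k" | "k \<noteq> i" "i \<noteq> Suc k" by blast
          then show "P x k * J $$ (k, i) = (if k = i then a * P x i else 0)"
          proof cases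
            case 2
            then show ?thesis using less.IH[of k] less.prems by simp
          qed (use jordan_matrix_bidiagonal(1)[of k n_as i] k nn less.prems in \<open>auto simp: J_def a_def\<close>)
        qed
        then show ?thesis using KP[OF that, of i] less.prems by simp
      qed
      have K2: "(\<Sum>k<n. K x k * P k (Suc i)) = a * P x (Suc i) + J $$ (i, Suc i) * P x i" if "x < n" for x
      proof -
        have "(\<Sum>k<n. P x k * J $$ (k, Suc i)) =
          (\<Sum>k<n. (if k = Suc i then a * P x (Suc i) else 0) + (if k = i then J $$ (i, Suc i) * P x i else 0))"
          by (intro sum.cong refl)
            (use jordan_matrix_bidiagonal(1)[of _ n_as "Suc i"] nn less.prems a in \<open>auto simp: J_def a_def\<close>)
        then show ?thesis using KP[OF that, of "Suc i"] less.prems by (simp add: sum.distrib)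
      qed
      have "a * N i = (\<Sum>x<n. cnj (P x i) * (\<Sum>k<n. K x k * P k i))"
        using K1 by (simp add: N_def sum_distrib_left mult_ac)
      also have "\<dots> = (\<Sum>x<n. cnj (\<Sum>k<n. K x k * P k i) * P x i)"
        by (rule hermitian_sum_swap[OF herm])
      also have "\<dots> = cnj a * N i"
        using K1 by (simp add: N_def sum_distrib_left mult_ac)
      finally have ra: "cnj a = a" using N[of i] less.prems by simp
      define I where "I = (\<Sum>x<n. cnj (P x i) * P x (Suc i))"
      have "a * I + J $$ (i, Suc i) * N i = (\<Sum>x<n. cnj (P x i) * (\<Sum>k<n. K x k * P k (Suc i)))"
        using K2 by (simp add: N_def I_def sum_distrib_left algebra_simps sum.distrib)
      also have "\<dots> = (\<Sum>x<n. cnj (\<Sum>k<n. K x k * P k i) * P x (Suc i))"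
        by (rule hermitian_sum_swap[OF herm])
      also have "\<dots> = a * I"
        using K1 ra by (simp add: I_def sum_distrib_left mult_ac)
      finally show False using c N[of i] less.prems by simp
    qed
  qed
  have KPd: "(\<Sum>k<n. K i k * P k j) = J $$ (j, j) * P i j" if "i < n" "j < n" for i j
  proof -
    have "(\<Sum>k<n. P i k * J $$ (k, j)) = (\<Sum>k<n. if k = j then J $$ (j, j) * P i j else 0)"
    proof (intro sum.cong refl)
      fix k assume "k \<in> {..<n}"
      then have k: "k < n" by simp
      consider "k = j" | "j = Suc k" | "k \<noteq> j" "j \<noteq> Suc k" by blast
      then show "P i k * J $$ (k, j) = (if k = j then J $$ (j, j) * P i j else 0)"
        using off[of k] jordan_matrix_bidiagonal(1)[of k n_as j] k that nn by cases (auto simp: J_def)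
    qed
    then show ?thesis using KP[OF that] that by simp
  qed
  show thesis by (rule that[OF PQ QP KPd])
qed

definition eigenfun :: "'a set \<Rightarrow> ('a \<Rightarrow> 'a \<Rightarrow> complex) \<Rightarrow> complex \<Rightarrow> ('a \<Rightarrow> complex) \<Rightarrow> bool" where
  "eigenfun S K \<theta> f \<longleftrightarrow> (\<forall>x\<in>S. (\<Sum>y\<in>S. K x y * f y) = \<theta> * f x) \<and> (\<exists>x\<in>S. f x \<noteq> 0)"

text \<open>The trace is the sum of all \<open>d j\<close> over an eigenbasis, and dependence of
  eigenfunctions makes the nonzero ones distinct. The value 0 is set apart: it may be highly
  degenerate, and it adds nothing to the trace.\<close>

lemma trace_simple_spectrum_nat:
  fixes K :: "nat \<Rightarrow> nat \<Rightarrow> complex"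
  assumes herm: "\<And>i j. i < n \<Longrightarrow> j < n \<Longrightarrow> K j i = cnj (K i j)"
    and simple: "\<And>\<theta> f f'. \<theta> \<noteq> 0 \<Longrightarrow> eigenfun {..<n} K \<theta> f \<Longrightarrow> eigenfun {..<n} K \<theta> f' \<Longrightarrow>
      \<exists>\<alpha> \<beta>. (\<alpha> \<noteq> 0 \<or> \<beta> \<noteq> 0) \<and> (\<forall>x<n. \<alpha> * f x + \<beta> * f' x = 0)"
  defines "E \<equiv> {\<theta>. \<theta> \<noteq> 0 \<and> (\<exists>f. eigenfun {..<n} K \<theta> f)}"
  shows "finite E \<and> (\<Sum>i<n. K i i) = \<Sum>E"
proof -
  obtain P Q d where PQ: "\<And>i j. i < n \<Longrightarrow> j < n \<Longrightarrow> (\<Sum>k<n. P i k * Q k j) = of_bool (i = j)"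
    and QP: "\<And>i j. i < n \<Longrightarrow> j < n \<Longrightarrow> (\<Sum>k<n. Q i k * P k j) = of_bool (i = j)"
    and KP: "\<And>i j. i < n \<Longrightarrow> j < n \<Longrightarrow> (\<Sum>k<n. K i k * P k j) = d j * P i j"
    by (rule hermitian_diagonalizable[of n K, OF herm]) (assumption | rule that)+
  have Kdec: "K i l = (\<Sum>j<n. d j * P i j * Q j l)" if "i < n" "l < n" for i l
  proof -
    have "K i l = (\<Sum>k<n. K i k * of_bool (k = l))" using that by simp
    also have "\<dots> = (\<Sum>k<n. K i k * (\<Sum>j<n. P k j * Q j l))"
      by (intro sum.cong refl) (use PQ that in simp)
    also have "\<dots> = (\<Sum>k<n. \<Sum>j<n. K i k * P k j * Q j l)" by (simp add: sum_distrib_left mult.assoc)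
    also have "\<dots> = (\<Sum>j<n. (\<Sum>k<n. K i k * P k j) * Q j l)" by (subst sum.swap) (simp add: sum_distrib_right)
    also have "\<dots> = (\<Sum>j<n. d j * P i j * Q j l)" using KP that by simp
    finally show ?thesis .
  qed
  have QK: "(\<Sum>k<n. Q j k * K k l) = d j * Q j l" if "j < n" "l < n" for j l
  proof -
    have "(\<Sum>k<n. Q j k * K k l) = (\<Sum>k<n. \<Sum>m<n. d m * Q j k * P k m * Q m l)"
      proof (intro sum.cong refl)
      fix k assume "k \<in> {..<n}"
      then have "K k l = (\<Sum>m<n. d m * P k m * Q m l)" using Kdec that by simp
      then show "Q j k * K k l = (\<Sum>m<n. d m * Q j k * P k m * Q m l)"
        by (simp only: sum_distrib_left) (simp add: mult_ac)
    qed
    also have "\<dots> = (\<Sum>m<n. d m * (\<Sum>k<n. Q j k * P k m) * Q m l)"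
      by (subst sum.swap) (simp add: sum_distrib_left sum_distrib_right mult_ac)
    also have "\<dots> = (\<Sum>m<n. if m = j then d j * Q j l else 0)"
      by (intro sum.cong refl) (use QP that in simp)
    finally show ?thesis using that by simp
  qed
  have ef: "eigenfun {..<n} K (d j) (\<lambda>i. P i j)" if "j < n" for j
  proof -
    have "\<exists>i<n. P i j \<noteq> 0"
    proof (rule ccontr)
      assume "\<not> ?thesis"
      then show False using QP[OF that that] by simp
    qed
    then show ?thesis unfolding eigenfun_def using KP that by auto
  qed
  define I where "I = {j. j < n \<and> d j \<noteq> 0}"
  have inj: "inj_on d I"
  proof (rule inj_onI, rule ccontr)
    fix i j assume ij: "i \<in> I" "j \<in> I" "d i = d j" "i \<noteq> j"
    have i: "i < n" "j < n" "d i \<noteq> 0" using ij by (auto simp: I_def)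
    obtain \<alpha> \<beta> where ab: "\<alpha> \<noteq> 0 \<or> \<beta> \<noteq> 0" "\<forall>x<n. \<alpha> * P x i + \<beta> * P x j = 0"
      using simple[OF i(3) ef[OF i(1)]] ef[OF i(2)] ij(3) by metis
    have c: "\<alpha> * (\<Sum>x<n. Q m x * P x i) + \<beta> * (\<Sum>x<n. Q m x * P x j) = 0" for m
    proof -
      have "\<alpha> * (\<Sum>x<n. Q m x * P x i) + \<beta> * (\<Sum>x<n. Q m x * P x j)
        = (\<Sum>x<n. Q m x * (\<alpha> * P x i + \<beta> * P x j))"
        by (simp add: sum_distrib_left sum.distrib algebra_simps)
      also have "\<dots> = 0" using ab(2) by (intro sum.neutral) simp
      finally show ?thesis .
    qed
    show False using c[of i] c[of j] QP i ij(4) ab(1) by simp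
  qed
  have img: "d ` I = E"
  proof
    show "d ` I \<subseteq> E" using ef by (auto simp: I_def E_def)
    show "E \<subseteq> d ` I"
    proof
      fix \<theta> assume "\<theta> \<in> E"
      then obtain f where t: "\<theta> \<noteq> 0" and f: "\<And>x. x < n \<Longrightarrow> (\<Sum>y<n. K x y * f y) = \<theta> * f x"
        and nz: "\<exists>x<n. f x \<noteq> 0"
        unfolding E_def eigenfun_def by auto
      \<comment> \<open>Coordinates of \<open>f\<close> in the eigenbasis; a nonzero coordinate
        \<open>g j\<close> forces \<open>\<theta> = d j\<close>.\<close>
      define g where "g j = (\<Sum>i<n. Q j i * f i)" for j
      have fg: "f i = (\<Sum>j<n. P i j * g j)" if "i < n" for i
      proof -
        have "(\<Sum>j<n. P i j * g j) = (\<Sum>j<n. \<Sum>k<n. P i j * Q j k * f k)"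
          by (simp add: g_def sum_distrib_left mult.assoc)
        also have "\<dots> = (\<Sum>k<n. (\<Sum>j<n. P i j * Q j k) * f k)"
          by (subst sum.swap) (simp add: sum_distrib_right)
        also have "\<dots> = (\<Sum>k<n. if k = i then f i else 0)"
          by (intro sum.cong refl) (use PQ that in auto)
        finally show ?thesis using that by simp
      qed
      have "\<exists>j<n. g j \<noteq> 0"
      proof (rule ccontr)
        assume "\<not> ?thesis"
        then have "f i = 0" if "i < n" for i using fg[OF that] by simp
        then show False using nz by blast
      qed
      then obtain j where j: "j < n" "g j \<noteq> 0" by blast
      have "\<theta> * g j = (\<Sum>i<n. Q j i * (\<theta> * f i))" by (simp add: g_def sum_distrib_left mult_ac)
      also have "\<dots> = (\<Sum>i<n. \<Sum>y<n. Q j i * K i y * f y)"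
        by (intro sum.cong refl) (simp add: f[symmetric] sum_distrib_left mult.assoc)
      also have "\<dots> = (\<Sum>y<n. (\<Sum>i<n. Q j i * K i y) * f y)"
        by (subst sum.swap) (simp add: sum_distrib_right)
      also have "\<dots> = d j * g j" using QK[OF j(1)] by (simp add: g_def sum_distrib_left mult.assoc)
      finally have "\<theta> = d j" using j(2) by simp
      then show "\<theta> \<in> d ` I" using j(1) t by (auto simp: I_def)
    qed
  qed
  have "(\<Sum>i<n. K i i) = (\<Sum>i<n. \<Sum>j<n. d j * P i j * Q j i)"
    by (intro sum.cong refl) (rule Kdec; simp)
  also have "\<dots> = (\<Sum>j<n. d j * (\<Sum>i<n. Q j i * P i j))"
    by (subst sum.swap) (simp add: sum_distrib_left mult_ac)
  also have "\<dots> = (\<Sum>j<n. d j)" using QP by simp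
  also have "\<dots> = (\<Sum>j\<in>I. d j)"
    by (rule sum.mono_neutral_right) (auto simp: I_def)
  also have "\<dots> = \<Sum>E" using sum.reindex[OF inj, of "\<lambda>x. x"] img by simp
  finally show ?thesis using img by (auto simp: I_def)
qed

lemma trace_simple_spectrum:
  fixes K :: "'a \<Rightarrow> 'a \<Rightarrow> complex"
  assumes fin: "finite S"
    and herm: "\<And>x y. x \<in> S \<Longrightarrow> y \<in> S \<Longrightarrow> K y x = cnj (K x y)"
    and simple: "\<And>\<theta> f f'. \<theta> \<noteq> 0 \<Longrightarrow> eigenfun S K \<theta> f \<Longrightarrow> eigenfun S K \<theta> f' \<Longrightarrow>
      \<exists>\<alpha> \<beta>. (\<alpha> \<noteq> 0 \<or> \<beta> \<noteq> 0) \<and> (\<forall>x\<in>S. \<alpha> * f x + \<beta> * f' x = 0)"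
  shows "finite {\<theta>. \<theta> \<noteq> 0 \<and> (\<exists>f. eigenfun S K \<theta> f)} \<and>
    (\<Sum>x\<in>S. K x x) = \<Sum>{\<theta>. \<theta> \<noteq> 0 \<and> (\<exists>f. eigenfun S K \<theta> f)}"
proof -
  define n where "n = card S"
  obtain e where "bij_betw e {0..<n} S" using ex_bij_betw_nat_finite[OF fin] unfolding n_def by blast
  then have e: "bij_betw e {..<n} S" by (simp add: atLeast0LessThan)
  define e' where "e' = inv_into {..<n} e"
  have e': "e (e' x) = x" "e' x < n" if "x \<in> S" for x
    using that bij_betw_inv_into_right[OF e] bij_betw_apply[OF bij_betw_inv_into[OF e]]
    by (auto simp: e'_def)
  have ee: "e i \<in> S" "e' (e i) = i" if "i < n" for i
    using that bij_betw_apply[OF e] bij_betw_inv_into_left[OF e] by (auto simp: e'_def)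
  define L where "L i j = K (e i) (e j)" for i j
  have sumS: "(\<Sum>y\<in>S. h y) = (\<Sum>j<n. h (e j))" for h :: "'a \<Rightarrow> complex"
    by (rule sum.reindex_bij_betw[OF e, symmetric])
  have tr1: "eigenfun S K \<theta> (\<lambda>x. f (e' x))" if "eigenfun {..<n} L \<theta> f" for \<theta> f
  proof -
    have "(\<Sum>j<n. K x (e j) * f j) = \<theta> * f (e' x)" if "x \<in> S" for x
    proof -
      have "(\<Sum>j<n. L (e' x) j * f j) = \<theta> * f (e' x)"
        using \<open>eigenfun {..<n} L \<theta> f\<close> e'(2)[OF that] unfolding eigenfun_def by blast
      then show ?thesis by (simp add: L_def e'(1)[OF that])
    qed
    moreover have "\<exists>x\<in>S. f (e' x) \<noteq> 0"
      using that ee unfolding eigenfun_def by (metis lessThan_iff)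
    ultimately show ?thesis by (auto simp: eigenfun_def sumS ee)
  qed
  have tr2: "eigenfun {..<n} L \<theta> (\<lambda>i. f (e i))" if f: "eigenfun S K \<theta> f" for \<theta> f
  proof -
    obtain x where "x \<in> S" "f x \<noteq> 0" using f by (auto simp: eigenfun_def)
    then have "\<exists>i<n. f (e i) \<noteq> 0" using e'[of x] by (intro exI[of _ "e' x"]) auto
    then show ?thesis using f ee(1) by (auto simp: eigenfun_def sumS L_def)
  qed
  have set_eq: "{\<theta>. \<theta> \<noteq> 0 \<and> (\<exists>f. eigenfun {..<n} L \<theta> f)} = {\<theta>. \<theta> \<noteq> 0 \<and> (\<exists>f. eigenfun S K \<theta> f)}"
    using tr1 tr2 by blast
  have "finite {\<theta>. \<theta> \<noteq> 0 \<and> (\<exists>f. eigenfun {..<n} L \<theta> f)} \<and>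
    (\<Sum>i<n. L i i) = \<Sum>{\<theta>. \<theta> \<noteq> 0 \<and> (\<exists>f. eigenfun {..<n} L \<theta> f)}"
  proof (rule trace_simple_spectrum_nat)
    show "L j i = cnj (L i j)" if "i < n" "j < n" for i j
      unfolding L_def by (intro herm ee that)
    fix \<theta> f f' assume t: "\<theta> \<noteq> 0" "eigenfun {..<n} L \<theta> f" "eigenfun {..<n} L \<theta> f'"
    obtain \<alpha> \<beta> where ab: "\<alpha> \<noteq> 0 \<or> \<beta> \<noteq> 0" "\<forall>x\<in>S. \<alpha> * f (e' x) + \<beta> * f' (e' x) = 0"
      using simple[OF t(1) tr1[OF t(2)] tr1[OF t(3)]] by blast
    have "\<alpha> * f i + \<beta> * f' i = 0" if "i < n" for i
      using ab(2) ee[OF that] by metis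
    then show "\<exists>\<alpha> \<beta>. (\<alpha> \<noteq> 0 \<or> \<beta> \<noteq> 0) \<and> (\<forall>x<n. \<alpha> * f x + \<beta> * f' x = 0)" using ab(1) by blast
  qed
  then show ?thesis unfolding set_eq by (simp add: sumS L_def)
qed

section \<open>The trace formula\<close>

text \<open>The trace of this kernel is the generating function of the cycle count of the commutator.  It
  averages \<open>cyc_sum\<close> over conjugation, so its eigenfunctions with nonzero eigenvalue are class
  functions, on which it acts as \<open>cyc_sum\<close>.\<close>

definition comm_kernel :: "'a set \<Rightarrow> real \<Rightarrow> ('a \<Rightarrow> 'a) \<Rightarrow> ('a \<Rightarrow> 'a) \<Rightarrow> complex" where
  "comm_kernel \<Omega> q x y =
     (\<Sum>t | t permutes \<Omega>. of_real q ^ ncyc \<Omega> (t \<circ> x \<circ> inv t \<circ> inv y)) / fact (card \<Omega>)"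

lemma inv_comp4:
  assumes "t permutes \<Omega>" "x permutes \<Omega>" "y permutes \<Omega>"
  shows "inv (t \<circ> x \<circ> inv t \<circ> inv y) = y \<circ> t \<circ> inv x \<circ> inv t"
proof -
  note b = permutes_bij[OF assms(1)] permutes_bij[OF assms(2)] permutes_bij[OF assms(3)]
  show ?thesis
    using b by (simp add: o_inv_distrib bij_comp bij_imp_bij_inv inv_inv_eq o_assoc)
qed

text \<open>Exchanging \<open>x\<close> and \<open>y\<close> and inverting \<open>t\<close> turns
  the argument of \<open>ncyc\<close> into its inverse, up to conjugation by \<open>t\<close>. Both
  operations keep the cycle count, and \<open>q\<close> is real.\<close>

lemma comm_kernel_hermitian:
  assumes x: "x permutes \<Omega>" and y: "y permutes \<Omega>"
  shows "comm_kernel \<Omega> q y x = cnj (comm_kernel \<Omega> q x y)"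
proof -
  have "(\<Sum>t | t permutes \<Omega>. complex_of_real q ^ ncyc \<Omega> (t \<circ> y \<circ> inv t \<circ> inv x))
      = (\<Sum>t | t permutes \<Omega>. of_real q ^ ncyc \<Omega> (inv t \<circ> y \<circ> inv (inv t) \<circ> inv x))"
    by (rule sum_permutations_inverse)
  also have "\<dots> = (\<Sum>t | t permutes \<Omega>. of_real q ^ ncyc \<Omega> (t \<circ> x \<circ> inv t \<circ> inv y))"
  proof (intro sum.cong refl)
    fix t assume "t \<in> {t. t permutes \<Omega>}"
    then have t: "t permutes \<Omega>" by simp
    note ti = permutes_inv[OF t]
    note tt = permutes_inv_inv[OF t]
    have p: "inv t \<circ> y \<circ> inv (inv t) \<circ> inv x permutes \<Omega>"
      by (intro permutes_compose permutes_inv t x y)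
    have "ncyc \<Omega> (inv t \<circ> y \<circ> inv (inv t) \<circ> inv x) = ncyc \<Omega> (x \<circ> inv t \<circ> inv y \<circ> t)"
      using ncyc_inv[OF p] inv_comp4[OF ti y x] tt by simp
    also have "\<dots> = ncyc \<Omega> (t \<circ> (x \<circ> inv t \<circ> inv y \<circ> t) \<circ> inv t)"
      by (rule ncyc_conj[OF t, symmetric])
    also have "t \<circ> (x \<circ> inv t \<circ> inv y \<circ> t) \<circ> inv t = t \<circ> x \<circ> inv t \<circ> inv y"
      by (simp add: fun_eq_iff permutes_inverses[OF t])
    finally show "complex_of_real q ^ ncyc \<Omega> (inv t \<circ> y \<circ> inv (inv t) \<circ> inv x)
      = of_real q ^ ncyc \<Omega> (t \<circ> x \<circ> inv t \<circ> inv y)" by (simp only:)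
  qed
  finally show ?thesis by (simp add: comm_kernel_def)
qed

text \<open>Substitute \<open>y = g \<circ> z\<close>: then \<open>z \<circ> inv y\<close> is
  \<open>inv g\<close>, which has as many cycles as \<open>g\<close>.\<close>

lemma sum_ncyc_cyc_sum:
  assumes z: "z permutes \<Omega>"
  shows "(\<Sum>y | y permutes \<Omega>. q ^ ncyc \<Omega> (z \<circ> inv y) * f y) = cyc_sum \<Omega> q f z"
proof -
  have "(\<Sum>y | y permutes \<Omega>. q ^ ncyc \<Omega> (z \<circ> inv y) * f y)
      = (\<Sum>y | y permutes \<Omega>. q ^ ncyc \<Omega> (z \<circ> inv (inv y)) * f (inv y))"
    by (rule sum_permutations_inverse)
  also have "\<dots> = (\<Sum>y | y permutes \<Omega>. q ^ ncyc \<Omega> (z \<circ> inv (inv (inv z \<circ> y))) * f (inv (inv z \<circ> y)))"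
    by (rule setum_permutations_compose_left[OF permutes_inv[OF z]])
  also have "\<dots> = (\<Sum>y | y permutes \<Omega>. q ^ ncyc \<Omega> (inv y) * f (inv y \<circ> z))"
  proof (intro sum.cong refl)
    fix y assume "y \<in> {y. y permutes \<Omega>}"
    then have y: "y permutes \<Omega>" by simp
    have zy: "inv z \<circ> y permutes \<Omega>" by (intro permutes_compose permutes_inv y z)
    have "z \<circ> inv (inv (inv z \<circ> y)) = y"
      unfolding permutes_inv_inv[OF zy] by (simp add: fun_eq_iff permutes_inverses[OF z])
    moreover have "inv (inv z \<circ> y) = inv y \<circ> z"
      using permutes_bij[OF y] permutes_bij[OF z] by (simp add: o_inv_distrib bij_imp_bij_inv inv_inv_eq)
    ultimately show "q ^ ncyc \<Omega> (z \<circ> inv (inv (inv z \<circ> y))) * f (inv (inv z \<circ> y))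
      = q ^ ncyc \<Omega> (inv y) * f (inv y \<circ> z)" using ncyc_inv[OF y] by simp
  qed
  also have "\<dots> = cyc_sum \<Omega> q f z"
    unfolding cyc_sum_def by (rule sum_permutations_inverse[symmetric])
  finally show ?thesis .
qed

lemma comm_kernel_apply:
  assumes x: "x permutes \<Omega>"
  shows "(\<Sum>y | y permutes \<Omega>. comm_kernel \<Omega> q x y * f y) =
    (\<Sum>t | t permutes \<Omega>. cyc_sum \<Omega> (of_real q) f (t \<circ> x \<circ> inv t)) / fact (card \<Omega>)"
proof -
  have "(\<Sum>y | y permutes \<Omega>. comm_kernel \<Omega> q x y * f y) =
    (\<Sum>y | y permutes \<Omega>. \<Sum>t | t permutes \<Omega>. of_real q ^ ncyc \<Omega> (t \<circ> x \<circ> inv t \<circ> inv y) * f y) / fact (card \<Omega>)"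
    by (simp add: comm_kernel_def sum_distrib_right sum_divide_distrib)
  also have "(\<Sum>y | y permutes \<Omega>. \<Sum>t | t permutes \<Omega>. of_real q ^ ncyc \<Omega> (t \<circ> x \<circ> inv t \<circ> inv y) * f y)
    = (\<Sum>t | t permutes \<Omega>. cyc_sum \<Omega> (of_real q) f (t \<circ> x \<circ> inv t))"
  proof (subst sum.swap, intro sum.cong refl)
    fix t assume "t \<in> {t. t permutes \<Omega>}"
    then have "t \<circ> x \<circ> inv t permutes \<Omega>" by (intro permutes_compose permutes_inv x) simp_all
    then show "(\<Sum>y | y permutes \<Omega>. of_real q ^ ncyc \<Omega> (t \<circ> x \<circ> inv t \<circ> inv y) * f y)
      = cyc_sum \<Omega> (of_real q) f (t \<circ> x \<circ> inv t)" by (rule sum_ncyc_cyc_sum)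
  qed
  finally show ?thesis .
qed

lemma class_fun_conj: "class_fun \<Omega> f \<longleftrightarrow> (\<forall>t x. t permutes \<Omega> \<longrightarrow> x permutes \<Omega> \<longrightarrow> f (t \<circ> x \<circ> inv t) = f x)"
proof
  assume c: "class_fun \<Omega> f"
  show "\<forall>t x. t permutes \<Omega> \<longrightarrow> x permutes \<Omega> \<longrightarrow> f (t \<circ> x \<circ> inv t) = f x"
  proof (intro allI impI)
    fix t x assume tx: "t permutes \<Omega>" "x permutes \<Omega>"
    have "f ((t \<circ> x) \<circ> inv t) = f (inv t \<circ> (t \<circ> x))"
      by (rule class_funD[OF c]) (intro permutes_compose permutes_inv tx)+
    also have "inv t \<circ> (t \<circ> x) = x" by (simp add: fun_eq_iff permutes_inverses[OF tx(1)])
    finally show "f (t \<circ> x \<circ> inv t) = f x" .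
  qed
next
  assume c: "\<forall>t x. t permutes \<Omega> \<longrightarrow> x permutes \<Omega> \<longrightarrow> f (t \<circ> x \<circ> inv t) = f x"
  show "class_fun \<Omega> f" unfolding class_fun_def
  proof (intro allI impI)
    fix x y assume xy: "x permutes \<Omega>" "y permutes \<Omega>"
    have "f (y \<circ> (x \<circ> y) \<circ> inv y) = f (x \<circ> y)" using c xy permutes_compose[OF xy(2,1)] by blast
    moreover have "y \<circ> (x \<circ> y) \<circ> inv y = y \<circ> x" by (simp add: fun_eq_iff permutes_inverses[OF xy(2)])
    ultimately show "f (x \<circ> y) = f (y \<circ> x)" by simp
  qed
qed

lemma cyc_sum_class:
  assumes c: "class_fun \<Omega> f" and t: "t permutes \<Omega>" and x: "x permutes \<Omega>"
  shows "cyc_sum \<Omega> q f (t \<circ> x \<circ> inv t) = cyc_sum \<Omega> q f x"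
proof -
  have "cyc_sum \<Omega> q f (t \<circ> x \<circ> inv t) = cyc_sum \<Omega> q (\<lambda>z. f (t \<circ> z)) (x \<circ> inv t)"
    using cyc_sum_shift[OF t, of q f "x \<circ> inv t"] by (simp only: o_assoc)
  also have "\<dots> = cyc_sum \<Omega> q f x"
    unfolding cyc_sum_def
  proof (intro sum.cong refl)
    fix g assume "g \<in> {g. g permutes \<Omega>}"
    then have "g \<circ> x permutes \<Omega>" using permutes_compose[OF x] by blast
    then have "f (t \<circ> (g \<circ> x) \<circ> inv t) = f (g \<circ> x)" using c t unfolding class_fun_conj by blast
    then show "q ^ ncyc \<Omega> g * f (t \<circ> (g \<circ> (x \<circ> inv t))) = q ^ ncyc \<Omega> g * f (g \<circ> x)"
      by (simp only: o_assoc)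
  qed
  finally show ?thesis .
qed

lemma card_perms: "finite \<Omega> \<Longrightarrow> card {t. t permutes \<Omega>} = fact (card \<Omega>)"
  by (rule card_permutations) simp_all

lemma eigen_imp_eigenfun:
  assumes fin: "finite \<Omega>" and e: "eigen \<Omega> (of_real q) \<theta> f" and nz: "\<exists>x. x permutes \<Omega> \<and> f x \<noteq> 0"
  shows "eigenfun {x. x permutes \<Omega>} (comm_kernel \<Omega> q) \<theta> f"
  unfolding eigenfun_def
proof (intro conjI ballI)
  fix x assume "x \<in> {x. x permutes \<Omega>}"
  then have x: "x permutes \<Omega>" by simp
  have c: "class_fun \<Omega> f" using e by (simp add: eigen_def)
  have "(\<Sum>t | t permutes \<Omega>. cyc_sum \<Omega> (of_real q) f (t \<circ> x \<circ> inv t)) = (\<Sum>t | t permutes \<Omega>. \<theta> * f x)"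
    by (intro sum.cong refl) (use e x cyc_sum_class[OF c _ x] in \<open>simp add: eigen_def\<close>)
  also have "\<dots> = fact (card \<Omega>) * (\<theta> * f x)" by (simp add: card_perms[OF fin])
  finally show "(\<Sum>y | y permutes \<Omega>. comm_kernel \<Omega> q x y * f y) = \<theta> * f x"
    unfolding comm_kernel_apply[OF x] by simp
qed (use nz in auto)

lemma eigenfun_imp_eigen:
  assumes fin: "finite \<Omega>" and e: "eigenfun {x. x permutes \<Omega>} (comm_kernel \<Omega> q) \<theta> f" and t0: "\<theta> \<noteq> 0"
  shows "eigen \<Omega> (of_real q) \<theta> f"
proof -
  define h where "h x = (\<Sum>t | t permutes \<Omega>. cyc_sum \<Omega> (of_real q) f (t \<circ> x \<circ> inv t)) / fact (card \<Omega>)" for x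
  have h: "h x = \<theta> * f x" if "x permutes \<Omega>" for x
  proof -
    have "(\<Sum>y | y permutes \<Omega>. comm_kernel \<Omega> q x y * f y) = \<theta> * f x"
      using e that unfolding eigenfun_def by blast
    then show ?thesis unfolding h_def comm_kernel_apply[OF that] .
  qed
  have c: "class_fun \<Omega> f"
    unfolding class_fun_conj
  proof (intro allI impI)
    fix s x assume s: "s permutes \<Omega>" and x: "x permutes \<Omega>"
    have "h x = (\<Sum>t | t permutes \<Omega>. cyc_sum \<Omega> (of_real q) f ((t \<circ> s) \<circ> x \<circ> inv (t \<circ> s))) / fact (card \<Omega>)"
      unfolding h_def by (subst sum_permutations_compose_right[OF s]) (rule refl)
    also have "\<dots> = h (s \<circ> x \<circ> inv s)"
      unfolding h_def
    proof (intro arg_cong2[where f = "(/)"] sum.cong refl)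
      fix t assume "t \<in> {t. t permutes \<Omega>}"
      then have t: "t permutes \<Omega>" by simp
      have "(t \<circ> s) \<circ> x \<circ> inv (t \<circ> s) = t \<circ> (s \<circ> x \<circ> inv s) \<circ> inv t"
        using permutes_bij[OF t] permutes_bij[OF s] by (simp add: o_inv_distrib o_assoc)
      then show "cyc_sum \<Omega> (of_real q) f ((t \<circ> s) \<circ> x \<circ> inv (t \<circ> s))
        = cyc_sum \<Omega> (of_real q) f (t \<circ> (s \<circ> x \<circ> inv s) \<circ> inv t)" by (simp only:)
    qed
    finally have "\<theta> * f x = \<theta> * f (s \<circ> x \<circ> inv s)"
      using h[OF x] h[of "s \<circ> x \<circ> inv s"] permutes_compose[OF permutes_inv[OF s] permutes_compose[OF x s]]
      by (simp add: o_assoc)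
    then show "f (s \<circ> x \<circ> inv s) = f x" using t0 by simp
  qed
  have "cyc_sum \<Omega> (of_real q) f x = \<theta> * f x" if x: "x permutes \<Omega>" for x
  proof -
    have "(\<Sum>t | t permutes \<Omega>. cyc_sum \<Omega> (of_real q) f (t \<circ> x \<circ> inv t))
      = (\<Sum>t | t permutes \<Omega>. cyc_sum \<Omega> (of_real q) f x)"
      by (intro sum.cong refl cyc_sum_class[OF c _ x]) simp
    also have "\<dots> = fact (card \<Omega>) * cyc_sum \<Omega> (of_real q) f x" by (simp add: card_perms[OF fin])
    finally have "h x = cyc_sum \<Omega> (of_real q) f x" by (simp add: h_def)
    then show ?thesis using h[OF x] by simp
  qed
  then show ?thesis using c by (simp add: eigen_def)
qed

text \<open>Each transposition acts on the sign as -1, so the factor for the next point is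
  \<open>q - card X\<close>, where constants have \<open>q + card X\<close>.\<close>

lemma cyc_sum_sign:
  assumes "finite X" "permutation x"
  shows "cyc_sum X q (\<lambda>y. of_int (sign y)) x = (\<Prod>j<card X. q - of_nat j) * (of_int (sign x) :: 'b::field_char_0)"
  using assms(1)
proof (induction X)
  case (insert k X)
  have "cyc_sum X q (\<lambda>y. of_int (sign (tswap k b \<circ> y))) x = - cyc_sum X q (\<lambda>y. of_int (sign y)) x"
    if b: "b \<in> X" for b
  proof -
    have "cyc_sum X q (\<lambda>y. of_int (sign (tswap k b \<circ> y))) x = (\<Sum>g | g permutes X. - (q ^ ncyc X g * of_int (sign (g \<circ> x))))"
      unfolding cyc_sum_def
    proof (intro sum.cong refl)
      fix g assume "g \<in> {g. g permutes X}"
      then have "permutation (g \<circ> x)"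
        using assms(2) insert.hyps(1) permutation_permutes permutation_compose by blast
      moreover have "k \<noteq> b" using insert.hyps(2) b by blast
      ultimately have "sign (tswap k b \<circ> (g \<circ> x)) = - sign (g \<circ> x)"
        by (simp add: sign_compose permutation_swap_id sign_swap_id)
      then show "q ^ ncyc X g * of_int (sign (tswap k b \<circ> (g \<circ> x))) = - (q ^ ncyc X g * of_int (sign (g \<circ> x)))"
        by simp
    qed
    then show ?thesis by (simp add: cyc_sum_def sum_negf)
  qed
  then show ?case using insert by (simp add: cyc_sum_insert algebra_simps)
qed (simp add: cyc_sum_def ncyc_def)

lemma content_prod_column: "content_prod (replicate n 1) q = (\<Prod>j<n. q - of_nat j)"
proof (induction n arbitrary: q)
  case (Suc n)
  have "(\<Prod>j<Suc n. q - of_nat j) = q * (\<Prod>j<n. (q - 1) - of_nat j)"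
    unfolding prod.lessThan_Suc_shift by (simp add: algebra_simps)
  then show ?case using Suc by simp
qed simp

definition partitions :: "nat \<Rightarrow> nat list set" where
  "partitions n = {l. is_partition l \<and> sum_list l = n}"

lemma finite_partitions: "finite (partitions n)"
proof (rule finite_subset)
  show "partitions n \<subseteq> {l. set l \<subseteq> {..n} \<and> length l \<le> n}"
  proof
    fix l assume l: "l \<in> partitions n"
    then have "\<forall>a\<in>set l. a \<le> n" using member_le_sum_list by (auto simp: partitions_def)
    moreover have "length l \<le> sum_list l" if "0 \<notin> set l" for l :: "nat list"
      using that by (induction l) auto
    then have "length l \<le> n" using l by (force simp: partitions_def is_partition_def)
    ultimately show "l \<in> {l. set l \<subseteq> {..n} \<and> length l \<le> n}" by auto
  qed
qed (rule finite_lists_length_le, simp)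

text \<open>A commutator is a conjugate of \<open>\<tau>\<close> times \<open>inv \<tau>\<close>, so
  the double sum is the trace of the kernel up to a factorial. \<open>L\<close> collects the
  partitions whose content product is a nonzero eigenvalue; constants and the sign supply the row
  and the column.\<close>

lemma commutator_trace:
  assumes fin: "finite \<Omega>" and ne: "\<Omega> \<noteq> {}" and gen: "generic (complex_of_real q)"
  obtains L where "L \<subseteq> partitions (card \<Omega>)" "[card \<Omega>] \<in> L" "replicate (card \<Omega>) 1 \<in> L"
    "(\<Sum>\<sigma> | \<sigma> permutes \<Omega>. \<Sum>\<tau> | \<tau> permutes \<Omega>. of_real q ^ ncyc \<Omega> (commutator \<sigma> \<tau>)) =
      fact (card \<Omega>) * (\<Sum>l\<in>L. content_prod l (complex_of_real q))"
proof -
  let ?S = "{x. x permutes \<Omega>}" and ?K = "comm_kernel \<Omega> q" and ?q = "complex_of_real q"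
  define E where "E = {\<theta>. \<theta> \<noteq> 0 \<and> (\<exists>f. eigenfun ?S ?K \<theta> f)}"
  have tr: "finite E \<and> (\<Sum>x\<in>?S. ?K x x) = \<Sum>E"
    unfolding E_def
  proof (rule trace_simple_spectrum)
    show "finite ?S" by (rule finite_permutations[OF fin])
    show "?K y x = cnj (?K x y)" if "x \<in> ?S" "y \<in> ?S" for x y
      using that by (intro comm_kernel_hermitian) auto
    fix \<theta> f f' assume t: "\<theta> \<noteq> 0" and f: "eigenfun ?S ?K \<theta> f" and f': "eigenfun ?S ?K \<theta> f'"
    obtain x0 x1 where x: "x0 permutes \<Omega>" "f x0 \<noteq> 0" "x1 permutes \<Omega>" "f' x1 \<noteq> 0"
      using f f' unfolding eigenfun_def by blast
    show "\<exists>\<alpha> \<beta>. (\<alpha> \<noteq> 0 \<or> \<beta> \<noteq> 0) \<and> (\<forall>x\<in>?S. \<alpha> * f x + \<beta> * f' x = 0)"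
      using eigen_unique[OF fin gen eigenfun_imp_eigen[OF fin f t] eigenfun_imp_eigen[OF fin f' t] x] by auto
  qed
  define L where "L = {l \<in> partitions (card \<Omega>). content_prod l ?q \<in> E}"
  have inj: "inj_on (\<lambda>l. content_prod l ?q) L"
    by (rule inj_onI) (use generic_inj[OF gen] in \<open>auto simp: L_def partitions_def\<close>)
  have img: "(\<lambda>l. content_prod l ?q) ` L = E"
  proof
    show "E \<subseteq> (\<lambda>l. content_prod l ?q) ` L"
    proof
      fix \<theta> assume t: "\<theta> \<in> E"
      then obtain f where f: "\<theta> \<noteq> 0" "eigenfun ?S ?K \<theta> f" by (auto simp: E_def)
      obtain x0 where x0: "x0 permutes \<Omega>" "f x0 \<noteq> 0" using f(2) by (auto simp: eigenfun_def)
      \<comment> \<open>No block is larger than \<open>\<Omega>\<close>, so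
        \<open>m0 = card \<Omega>\<close> is a valid start.\<close>
      have "\<forall>M x. M \<subseteq> \<Omega> \<longrightarrow> card \<Omega> < card M \<longrightarrow> x permutes \<Omega> \<longrightarrow> sym_sum M f x = 0"
        using card_mono[OF fin] by (meson not_less)
      then obtain l where "is_partition l" "sum_list l = card \<Omega>" "\<theta> = content_prod l ?q"
        using eigen_spectrum[OF fin eigenfun_imp_eigen[OF fin f(2,1)] x0 gen] by blast
      then show "\<theta> \<in> (\<lambda>l. content_prod l ?q) ` L" using t by (auto simp: L_def partitions_def)
    qed
  qed (auto simp: L_def)
  have cgen: "content_prod l ?q \<noteq> 0" if "is_partition l" for l
  proof -
    have "content_prod l (?q - of_nat 0) \<noteq> 0" using gen that unfolding generic_def by blast
    then show ?thesis by simp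
  qed
  have row: "[card \<Omega>] \<in> L"
  proof -
    have "eigen \<Omega> ?q (pochhammer ?q (card \<Omega>)) (\<lambda>_. 1)"
      using sum_pow_ncyc[OF fin, of ?q] by (simp add: eigen_def class_fun_def cyc_sum_def)
    then have "eigenfun ?S ?K (pochhammer ?q (card \<Omega>)) (\<lambda>_. 1)"
      by (rule eigen_imp_eigenfun[OF fin]) (use permutes_id[of \<Omega>] in \<open>auto intro!: exI[of _ id]\<close>)
    moreover have p: "is_partition [card \<Omega>]" using ne fin by (auto simp: is_partition_def)
    ultimately show ?thesis using cgen[OF p] unfolding L_def E_def partitions_def by auto
  qed
  have col: "replicate (card \<Omega>) 1 \<in> L"
  proof -
    have perm: "permutation x" if "x permutes \<Omega>" for x using that fin permutation_permutes by blast
    have "eigen \<Omega> ?q (\<Prod>j<card \<Omega>. ?q - of_nat j) (\<lambda>y. of_int (sign y))"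
      using cyc_sum_sign[OF fin perm, of _ ?q]
      by (auto simp: eigen_def class_fun_def sign_compose perm)
    then have "eigenfun ?S ?K (\<Prod>j<card \<Omega>. ?q - of_nat j) (\<lambda>y. of_int (sign y))"
      by (rule eigen_imp_eigenfun[OF fin]) (use permutes_id[of \<Omega>] in \<open>auto intro!: exI[of _ id]\<close>)
    then have ef: "eigenfun ?S ?K (content_prod (replicate (card \<Omega>) 1) ?q) (\<lambda>y. of_int (sign y))"
      by (simp only: content_prod_column)
    have p: "is_partition (replicate (card \<Omega>) 1)" by (simp add: is_partition_def sorted_wrt_iff_nth_less)
    have "sum_list (replicate (card \<Omega>) 1) = card \<Omega>" by (simp add: sum_list_replicate)
    then show ?thesis using cgen[OF p] ef p unfolding L_def E_def partitions_def by blast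
  qed
  have "(\<Sum>\<sigma> | \<sigma> permutes \<Omega>. \<Sum>\<tau> | \<tau> permutes \<Omega>. ?q ^ ncyc \<Omega> (commutator \<sigma> \<tau>))
    = (\<Sum>\<tau> | \<tau> permutes \<Omega>. \<Sum>\<sigma> | \<sigma> permutes \<Omega>. ?q ^ ncyc \<Omega> (commutator \<sigma> \<tau>))" by (rule sum.swap)
  also have "\<dots> = fact (card \<Omega>) * (\<Sum>x\<in>?S. ?K x x)"
    by (simp add: comm_kernel_def commutator_def sum_divide_distrib[symmetric])
  also have "(\<Sum>x\<in>?S. ?K x x) = (\<Sum>l\<in>L. content_prod l ?q)"
    using tr sum.reindex[OF inj, of "\<lambda>x. x"] img by simp
  finally show thesis using that[of L] row col by (auto simp: L_def)
qed

section \<open>Content polynomials and the supply of generic parameters\<close>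

fun contents :: "int \<Rightarrow> nat list \<Rightarrow> int list" where
  "contents s [] = []"
| "contents s (m # l) = map (\<lambda>j. s + int j) [0..<m] @ contents (s - 1) l"

lemma prod_list_upt: "(\<Prod>j\<leftarrow>[0..<m]. f j) = (\<Prod>j<m. f j :: 'a::comm_monoid_mult)"
  by (induction m) (simp_all add: mult.commute)

lemma content_prod_contents:
  "content_prod l (q + of_int s) = (\<Prod>c\<leftarrow>contents s l. q + of_int c :: 'a::comm_ring_1)"
proof (induction l arbitrary: s)
  case (Cons m l)
  have "content_prod l (q + of_int s - 1) = (\<Prod>c\<leftarrow>contents (s - 1) l. q + of_int c)"
    using Cons.IH[of "s - 1"] by (simp add: algebra_simps)
  moreover have "pochhammer (q + of_int s) m = (\<Prod>j\<leftarrow>[0..<m]. q + of_int (s + int j))"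
    unfolding prod_list_upt pochhammer_prod by (simp add: atLeast0LessThan add.assoc)
  ultimately show ?case by (simp add: o_def)
qed simp

lemma content_prod_of_real: "content_prod l (complex_of_real q) = of_real (content_prod l q)"
proof (induction l arbitrary: q)
  case (Cons m l)
  show ?case using Cons[of "q - 1"] by (simp add: pochhammer_prod)
qed simp

definition content_poly :: "nat list \<Rightarrow> real poly" where
  "content_poly l = (\<Prod>c\<leftarrow>contents 0 l. [:of_int c, 1:])"

lemma poly_content_poly: "poly (content_poly l) q = content_prod l q"
proof -
  have "poly (\<Prod>c\<leftarrow>cs. [:of_int c, 1:]) q = (\<Prod>c\<leftarrow>cs. q + of_int c)" for cs :: "int list" and q :: real
    by (induction cs) (simp_all add: algebra_simps)
  then show ?thesis using content_prod_contents[of l q 0] by (simp add: content_poly_def)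
qed

lemma content_poly_nonzero: "content_poly l \<noteq> 0"
  by (auto simp: content_poly_def prod_list_zero_iff)

text \<open>No content exceeds \<open>M - 1\<close>, so all factors are negative.\<close>

lemma content_prod_nonzero:
  fixes q :: real
  assumes "\<forall>a\<in>set l. a \<le> M" "q + real M < 1"
  shows "content_prod l q \<noteq> 0"
  using assms
proof (induction l arbitrary: q)
  case (Cons m l)
  have "pochhammer q m \<noteq> 0"
    unfolding pochhammer_prod using Cons.prems by (auto simp: prod_zero_iff)
  moreover have "content_prod l (q - 1) \<noteq> 0" using Cons.IH[of "q - 1"] Cons.prems by simp
  ultimately show ?case by simp
qed simp

text \<open>With first row \<open>m\<close> the largest content is \<open>m - 1\<close>, so the
  least root is \<open>1 - m\<close> and reveals \<open>m\<close>. Cancelling the first row leaves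
  the polynomial of the remaining rows, shifted by one.\<close>

lemma content_poly_inj:
  assumes "is_partition l" "is_partition l'" "content_poly l = content_poly l'"
  shows "l = l'"
  using assms
proof (induction l arbitrary: l')
  case Nil
  have "content_prod [] (real_of_int q) = content_prod l' (of_int q)" for q
    using Nil.prems(3) by (metis poly_content_poly)
  then have *: "content_prod l' (real_of_int q) = 1" for q by simp
  show ?case
  proof (cases l')
    case (Cons m r)
    then have "m > 0" using Nil.prems(2) by (auto simp: is_partition_def)
    then have "content_prod l' (0::real) = 0" using Cons by (simp add: pochhammer_0_left)
    then show ?thesis using *[of 0] by simp
  qed simp
next
  case (Cons m r)
  have eq: "content_prod (m # r) q = content_prod l' q" for q :: real
    using Cons.prems(3) by (metis poly_content_poly)
  have m: "m > 0" using Cons.prems(1) by (auto simp: is_partition_def)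
  have zero: "content_prod (k # s) (1 - real k) = 0" if "k > 0" for k s
  proof -
    have "1 - real k + real (k - 1) = 0" using that by (simp add: of_nat_diff)
    then have "pochhammer (1 - real k) k = 0"
      unfolding pochhammer_prod using that by (auto simp: prod_zero_iff intro!: bexI[of _ "k - 1"])
    then show ?thesis by simp
  qed
  have nonz: "content_prod (k # s) (1 - real k') \<noteq> 0" if "is_partition (k # s)" "k < k'" for k k' s
    by (rule content_prod_nonzero[where M = k]) (use that in \<open>auto simp: is_partition_def\<close>)
  show ?case
  proof (cases l')
    case Nil
    then show ?thesis using zero[OF m, of r] eq[of "1 - real m"]
      by (metis content_prod.simps(1) zero_neq_one)
  next
    case l': (Cons m' r')
    have m': "m' > 0" using Cons.prems(2) l' by (auto simp: is_partition_def)
    have "m = m'"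
    proof (rule ccontr)
      assume "m \<noteq> m'"
      then consider "m < m'" | "m' < m" by linarith
      then show False
      proof cases
        case 1
        then show False using nonz[OF Cons.prems(1) 1] zero[OF m', of r'] eq[of "1 - real m'"] l' by metis
      next
        case 2
        then show False using nonz[of m' r' m] zero[OF m, of r] eq[of "1 - real m"] l' Cons.prems(2) by metis
      qed
    qed
    \<comment> \<open>At \<open>q + 1 > 0\<close> the factor of the first row is positive and
      cancels; agreement on a half-line is enough for polynomials.\<close>
    have "content_prod r q = content_prod r' q" if "q > 0" for q :: real
    proof -
      have "pochhammer (q + 1) m \<noteq> 0" using that pochhammer_pos[of "q + 1" m] by simp
      then show ?thesis using eq[of "q + 1"] l' \<open>m = m'\<close> by simp
    qed
    then have "{0<..} \<subseteq> {q. poly (content_poly r - content_poly r') q = 0}"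
      by (auto simp: poly_content_poly)
    then have "infinite {q. poly (content_poly r - content_poly r') q = 0}"
      using infinite_Ioi[of "0::real"] finite_subset by blast
    then have "content_poly r - content_poly r' = 0" using poly_roots_finite by blast
    moreover have "is_partition r" "is_partition r'"
      using Cons.prems l' by (auto simp: is_partition_def)
    ultimately show ?thesis using Cons.IH[of r'] l' \<open>m = m'\<close> by simp
  qed
qed

text \<open>\<open>X\<close> collects the zeros and \<open>Y\<close> the coincidences of content
  products at all shifts. Both are countable unions of finite root sets, so finitely many generic
  values would make the reals countable.\<close>

lemma infinite_generic: "infinite {q. generic (complex_of_real q)}"
proof
  assume fin: "finite {q. generic (complex_of_real q)}"
  define X where "X = (\<Union>j::nat. \<Union>l. {q. poly (content_poly l) (q - real j) = 0})"
  define Y where "Y = (\<Union>j::nat. \<Union>(l, l')\<in>{(l, l'). is_partition l \<and> is_partition l' \<and> l \<noteq> l'}.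
    {q. poly (content_poly l - content_poly l') (q - real j) = 0})"
  have shift: "countable {q. poly p (q - real j) = 0}" if "p \<noteq> 0" for p j
  proof -
    have "{q. poly p (q - real j) = 0} = (\<lambda>q. q + real j) ` {q. poly p q = 0}"
      by (auto simp: image_iff intro!: exI[of _ "_ - real j"])
    then show ?thesis using poly_roots_finite[OF that] by (simp add: countable_finite)
  qed
  have X: "countable X" unfolding X_def by (intro countable_UN shift content_poly_nonzero) auto
  have "countable (case ll of (l, l') \<Rightarrow> {q. poly (content_poly l - content_poly l') (q - real j) = 0})"
    if ll: "ll \<in> {(l, l'). is_partition l \<and> is_partition l' \<and> l \<noteq> l'}" for ll j
  proof -
    obtain l l' where "ll = (l, l')" "is_partition l" "is_partition l'" "l \<noteq> l'" using ll by blast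
    then have "ll = (l, l')" "content_poly l - content_poly l' \<noteq> 0" using content_poly_inj by auto
    then show ?thesis using shift by (simp only: prod.case)
  qed
  then have Y: "countable Y" unfolding Y_def by (intro countable_UN) simp_all
  have "generic (complex_of_real q)" if "q \<notin> X" "q \<notin> Y" for q
  proof -
    have cp: "content_prod l (complex_of_real q - of_nat j) = of_real (poly (content_poly l) (q - real j))" for l j
      unfolding poly_content_poly content_prod_of_real[symmetric] by simp
    have "poly (content_poly l) (q - real j) \<noteq> 0" for l j using that(1) unfolding X_def by blast
    moreover have "poly (content_poly l) (q - real j) \<noteq> poly (content_poly l') (q - real j)"
      if "is_partition l" "is_partition l'" "l \<noteq> l'" for l l' j
      using \<open>q \<notin> Y\<close> that unfolding Y_def by auto
    ultimately show ?thesis unfolding generic_def cp of_real_eq_0_iff of_real_eq_iff by blast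
  qed
  then have "UNIV = X \<union> Y \<union> {q. generic (complex_of_real q)}" by blast
  then have "countable (UNIV :: real set)" using X Y fin by (metis countable_Un countable_finite)
  then show False using uncountable_UNIV_real by blast
qed

text \<open>Only finitely many sets \<open>L\<close> are possible in \<open>commutator_trace\<close>, so one of them serves
  infinitely many \<open>q\<close>, and the identity becomes one of polynomials.\<close>

lemma commutator_cycle_count:
  assumes fin: "finite \<Omega>" and ne: "\<Omega> \<noteq> {}"
  obtains L where "L \<subseteq> partitions (card \<Omega>)" "[card \<Omega>] \<in> L" "replicate (card \<Omega>) 1 \<in> L"
    "\<And>v. real (card {(\<sigma>, \<tau>). \<sigma> permutes \<Omega> \<and> \<tau> permutes \<Omega> \<and> ncyc \<Omega> (commutator \<sigma> \<tau>) = v}) =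
      fact (card \<Omega>) * (\<Sum>l\<in>L. coeff (content_poly l) v)"
proof -
  let ?P = "{x. x permutes \<Omega>}"
  define F where "F = (\<Sum>\<omega>\<in>?P \<times> ?P. monom (1::real) (ncyc \<Omega> (case \<omega> of (\<sigma>, \<tau>) \<Rightarrow> commutator \<sigma> \<tau>)))"
  define ok where "ok q L \<longleftrightarrow> L \<subseteq> partitions (card \<Omega>) \<and> [card \<Omega>] \<in> L \<and> replicate (card \<Omega>) 1 \<in> L \<and>
    poly F q = poly (Polynomial.smult (fact (card \<Omega>)) (\<Sum>l\<in>L. content_poly l)) q" for q L
  have "\<exists>L. ok q L" if gen: "generic (complex_of_real q)" for q
  proof -
    obtain L where L: "L \<subseteq> partitions (card \<Omega>)" "[card \<Omega>] \<in> L" "replicate (card \<Omega>) 1 \<in> L"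
      "(\<Sum>\<sigma> | \<sigma> permutes \<Omega>. \<Sum>\<tau> | \<tau> permutes \<Omega>. complex_of_real q ^ ncyc \<Omega> (commutator \<sigma> \<tau>)) =
        fact (card \<Omega>) * (\<Sum>l\<in>L. content_prod l (complex_of_real q))"
      by (rule commutator_trace[OF fin ne gen])
    have "complex_of_real (poly F q) =
      (\<Sum>\<sigma> | \<sigma> permutes \<Omega>. \<Sum>\<tau> | \<tau> permutes \<Omega>. complex_of_real q ^ ncyc \<Omega> (commutator \<sigma> \<tau>))"
      by (simp add: F_def poly_sum poly_monom sum.cartesian_product case_prod_unfold)
    also have "\<dots> = of_real (fact (card \<Omega>) * (\<Sum>l\<in>L. content_prod l q))"
      unfolding L(4) by (simp add: content_prod_of_real)
    finally have "poly F q = fact (card \<Omega>) * (\<Sum>l\<in>L. content_prod l q)" by (simp only: of_real_eq_iff)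
    then show ?thesis using L(1-3) by (auto simp: ok_def poly_sum poly_content_poly)
  qed
  then obtain L where L: "\<And>q. generic (complex_of_real q) \<Longrightarrow> ok q (L q)" by metis
  have "L ` {q. generic (complex_of_real q)} \<subseteq> Pow (partitions (card \<Omega>))"
    using L unfolding ok_def by blast
  then have "finite (L ` {q. generic (complex_of_real q)})"
    by (rule finite_subset) (simp add: finite_partitions)
  then obtain q0 where q0: "generic (complex_of_real q0)"
    and inf: "infinite {q \<in> {q. generic (complex_of_real q)}. L q = L q0}"
    using pigeonhole_infinite[OF infinite_generic] by blast
  define L0 where "L0 = L q0"
  have "{q \<in> {q. generic (complex_of_real q)}. L q = L q0}
    \<subseteq> {q. poly (F - Polynomial.smult (fact (card \<Omega>)) (\<Sum>l\<in>L0. content_poly l)) q = 0}"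
    using L by (auto simp: ok_def L0_def)
  then have "infinite {q. poly (F - Polynomial.smult (fact (card \<Omega>)) (\<Sum>l\<in>L0. content_poly l)) q = 0}"
    using inf finite_subset by blast
  then have "F - Polynomial.smult (fact (card \<Omega>)) (\<Sum>l\<in>L0. content_poly l) = 0" using poly_roots_finite by blast
  then have F: "F = Polynomial.smult (fact (card \<Omega>)) (\<Sum>l\<in>L0. content_poly l)" by simp
  have finP: "finite (?P \<times> ?P)" using finite_permutations[OF fin] by simp
  have "real (card {(\<sigma>, \<tau>). \<sigma> permutes \<Omega> \<and> \<tau> permutes \<Omega> \<and> ncyc \<Omega> (commutator \<sigma> \<tau>) = v}) =
      fact (card \<Omega>) * (\<Sum>l\<in>L0. coeff (content_poly l) v)" for v
  proof -
    have "coeff F v = (\<Sum>\<omega>\<in>?P \<times> ?P. if ncyc \<Omega> (case \<omega> of (\<sigma>, \<tau>) \<Rightarrow> commutator \<sigma> \<tau>) = v then 1 else 0)"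
      by (simp add: F_def coeff_sum)
    also have "\<dots> = real (card {\<omega> \<in> ?P \<times> ?P. ncyc \<Omega> (case \<omega> of (\<sigma>, \<tau>) \<Rightarrow> commutator \<sigma> \<tau>) = v})"
      using finP by (simp add: sum.If_cases Int_def)
    also have "{\<omega> \<in> ?P \<times> ?P. ncyc \<Omega> (case \<omega> of (\<sigma>, \<tau>) \<Rightarrow> commutator \<sigma> \<tau>) = v}
      = {(\<sigma>, \<tau>). \<sigma> permutes \<Omega> \<and> \<tau> permutes \<Omega> \<and> ncyc \<Omega> (commutator \<sigma> \<tau>) = v}" by auto
    finally show ?thesis unfolding F by (simp add: coeff_sum)
  qed
  moreover have "L0 \<subseteq> partitions (card \<Omega>)" "[card \<Omega>] \<in> L0" "replicate (card \<Omega>) 1 \<in> L0"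
    using L[OF q0] by (auto simp: ok_def L0_def)
  ultimately show thesis using that by blast
qed

section \<open>Sums of content products\<close>

text \<open>A coefficientwise majorant of \<open>content_poly\<close>; the estimates come from splitting off the
  first hook (first row and first column) of the diagram.\<close>

definition content_weight :: "real \<Rightarrow> nat list \<Rightarrow> real" where
  "content_weight x l = (\<Prod>c\<leftarrow>contents 0 l. x + \<bar>of_int c\<bar>)"

lemma prod_list_nonneg: "(\<And>a. a \<in> set as \<Longrightarrow> f a \<ge> 0) \<Longrightarrow> (\<Prod>a\<leftarrow>as. f a) \<ge> (0::real)"
  by (induction as) auto

lemma abs_coeff_content_poly_le:
  assumes "y \<ge> 0"
  shows "(\<Sum>v\<le>N. \<bar>coeff (content_poly l) v\<bar> * y ^ v) \<le> content_weight y l"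
proof -
  define q where "q cs = (\<Prod>c\<leftarrow>cs. [:\<bar>of_int c\<bar>, 1:] :: real poly)" for cs :: "int list"
  have le: "\<bar>coeff (\<Prod>c\<leftarrow>cs. [:real_of_int c, 1:]) v\<bar> \<le> coeff (q cs) v" for cs :: "int list" and v
  proof (induction cs arbitrary: v)
    case Nil then show ?case by (simp add: q_def)
  next
    case (Cons c cs)
    have "\<bar>real_of_int c * coeff (\<Prod>c\<leftarrow>cs. [:real_of_int c, 1:]) v\<bar> \<le> \<bar>real_of_int c\<bar> * coeff (q cs) v"
      unfolding abs_mult using Cons[of v] by (intro mult_left_mono) auto
    then show ?case using Cons[of "v - 1"]
      by (cases v) (auto simp: q_def coeff_pCons intro: order.trans[OF abs_triangle_ineq] add_mono)
  qed
  have nn: "coeff (q cs) v \<ge> 0" for cs v using le[of cs v] by linarith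
  have qp: "poly (q cs) y = (\<Prod>c\<leftarrow>cs. y + \<bar>of_int c\<bar>)" for cs
    by (induction cs) (simp_all add: q_def algebra_simps)
  define cs where "cs = contents 0 l"
  have "(\<Sum>v\<le>N. \<bar>coeff (content_poly l) v\<bar> * y ^ v) \<le> (\<Sum>v\<le>N. coeff (q cs) v * y ^ v)"
    unfolding content_poly_def cs_def by (intro sum_mono mult_right_mono le) (use assms in auto)
  also have "\<dots> \<le> (\<Sum>v\<le>max N (degree (q cs)). coeff (q cs) v * y ^ v)"
    by (rule sum_mono2) (use nn assms in auto)
  also have "\<dots> = (\<Sum>v\<le>degree (q cs). coeff (q cs) v * y ^ v)"
    by (rule sum.mono_neutral_right) (auto simp: coeff_eq_0)
  also have "\<dots> = content_weight y l"
    by (simp add: poly_altdef[symmetric] qp content_weight_def cs_def)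
  finally show ?thesis .
qed

lemma content_weight_nonneg: "x \<ge> 0 \<Longrightarrow> content_weight x l \<ge> 0"
  unfolding content_weight_def by (rule prod_list_nonneg) auto

section \<open>Splitting off the first hook of a partition\<close>

lemma contents_zeros: "(\<forall>a\<in>set l. a = 0) \<Longrightarrow> contents s l = []"
  by (induction l arbitrary: s) auto

lemma contents_filter:
  assumes "sorted_wrt (\<ge>) l"
  shows "contents s (filter (\<lambda>a. a \<noteq> 0) l) = contents s l"
  using assms
proof (induction l arbitrary: s)
  case (Cons a l)
  show ?case
  proof (cases "a = 0")
    case True
    then have "\<forall>b\<in>set (a # l). b = 0" using Cons.prems by auto
    then show ?thesis using contents_zeros[of "a # l" s] by (simp add: filter_False)
  qed (use Cons in auto)
qed simp

lemma filter_append_zeros: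
  assumes "sorted_wrt (\<ge>) (l :: nat list)"
  shows "filter (\<lambda>a. a \<noteq> 0) l @ replicate (length l - length (filter (\<lambda>a. a \<noteq> 0) l)) 0 = l"
  using assms
proof (induction l)
  case (Cons a l)
  show ?case
  proof (cases "a = 0")
    case True
    then have z: "\<forall>b\<in>set (a # l). b = 0" using Cons.prems by auto
    then have "filter (\<lambda>a. a \<noteq> 0) (a # l) = []" by (simp add: filter_False)
    moreover have "a # l = replicate (length (a # l)) 0" using z by (simp add: replicate_eqI)
    ultimately show ?thesis by (metis append_Nil diff_zero list.size(3))
  qed (use Cons in auto)
qed simp

lemma sum_list_filter_nonzero: "sum_list (filter (\<lambda>a. a \<noteq> 0) l) = sum_list (l :: nat list)"
  by (induction l) auto

text \<open>For \<open>r\<close> the rows below the first, this is the diagram without its first row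
  and column. Moving a box along the diagonal keeps its content, so these contents need no
  shift.\<close>

definition inner_part :: "nat list \<Rightarrow> nat list" where
  "inner_part r = filter (\<lambda>a. a \<noteq> 0) (map (\<lambda>a. a - 1) r)"

lemma sorted_map_pred: "sorted_wrt (\<ge>) r \<Longrightarrow> sorted_wrt (\<ge>) (map (\<lambda>a. a - 1 :: nat) r)"
  by (induction r) (auto intro: diff_le_mono)

lemma is_partition_inner_part: "is_partition r \<Longrightarrow> is_partition (inner_part r)"
  unfolding is_partition_def inner_part_def
  using sorted_map_pred sorted_wrt_filter by auto

lemma sum_list_inner_part:
  assumes "0 \<notin> set r"
  shows "sum_list r = length r + sum_list (inner_part r)"
  unfolding inner_part_def sum_list_filter_nonzero using assms by (induction r) auto

text \<open>The row starting at content \<open>- 1 - s\<close> gives up its first box, with factor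
  \<open>x + 1 + s\<close>, and then starts at \<open>- s\<close>; \<open>s\<close> counts the rows
  already passed in the induction.\<close>

lemma first_column:
  assumes "0 \<notin> set r"
  shows "(\<Prod>c\<leftarrow>contents (- 1 - int s) r. x + \<bar>real_of_int c\<bar>) =
    (\<Prod>i<length r. x + 1 + real s + real i) * (\<Prod>c\<leftarrow>contents (- int s) (map (\<lambda>a. a - 1) r). x + \<bar>real_of_int c\<bar>)"
  using assms
proof (induction r arbitrary: s)
  case (Cons a r)
  obtain k where a: "a = Suc k" using Cons.prems by (cases a) auto
  define f where "f c = x + \<bar>real_of_int c\<bar>" for c
  have up: "[0..<Suc k] = 0 # map Suc [0..<k]" by (simp add: map_Suc_upt upt_conv_Cons)
  have row: "(\<Prod>j\<leftarrow>[0..<a]. f (- 1 - int s + int j)) = (x + 1 + real s) * (\<Prod>j\<leftarrow>[0..<k]. f (- int s + int j))"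
  proof -
    have "(\<Prod>j\<leftarrow>[0..<a]. f (- 1 - int s + int j)) = f (- 1 - int s) * (\<Prod>j\<leftarrow>[0..<k]. f (- int s + int j))"
      unfolding a up by (simp add: o_def)
    moreover have "f (- 1 - int s) = x + 1 + real s" by (simp add: f_def)
    ultimately show ?thesis by simp
  qed
  have IH: "(\<Prod>c\<leftarrow>contents (- 1 - int s - 1) r. f c) =
    (\<Prod>i<length r. x + 1 + real (Suc s) + real i) * (\<Prod>c\<leftarrow>contents (- int s - 1) (map (\<lambda>a. a - 1) r). f c)"
  proof -
    have e: "- 1 - int (Suc s) = - 1 - int s - 1" "- int (Suc s) = - int s - 1" by simp_all
    show ?thesis unfolding f_def by (rule Cons.IH[of "Suc s", unfolded e]) (use Cons.prems in simp)
  qed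
  have lengthprod: "(\<Prod>i<length (a # r). x + 1 + real s + real i) =
    (x + 1 + real s) * (\<Prod>i<length r. x + 1 + real (Suc s) + real i)"
    unfolding list.size by (simp add: prod.lessThan_Suc_shift algebra_simps del: prod.lessThan_Suc)
  have "(\<Prod>c\<leftarrow>contents (- 1 - int s) (a # r). f c) =
    (\<Prod>j\<leftarrow>[0..<a]. f (- 1 - int s + int j)) * (\<Prod>c\<leftarrow>contents (- 1 - int s - 1) r. f c)"
    by (simp add: o_def)
  also have "\<dots> = (\<Prod>i<length (a # r). x + 1 + real s + real i) *
    (\<Prod>c\<leftarrow>contents (- int s) (map (\<lambda>a. a - 1) (a # r)). f c)"
    unfolding row IH lengthprod by (simp add: a o_def)
  finally show ?case unfolding f_def .
qed simp

lemma content_weight_hook: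
  assumes "is_partition (m # r)"
  shows "content_weight x (m # r) =
    pochhammer x m * pochhammer (x + 1) (length r) * content_weight x (inner_part r)"
proof -
  have r: "0 \<notin> set r" "sorted_wrt (\<ge>) r" using assms by (auto simp: is_partition_def)
  have "(\<Prod>c\<leftarrow>contents 0 (map (\<lambda>a. a - 1) r). x + \<bar>real_of_int c\<bar>) = content_weight x (inner_part r)"
    using contents_filter[OF sorted_map_pred[OF r(2)]] by (simp add: content_weight_def inner_part_def)
  moreover have "(\<Prod>j\<leftarrow>[0..<m]. x + \<bar>real_of_int (int j)\<bar>) = pochhammer x m"
    unfolding prod_list_upt pochhammer_prod by (simp add: atLeast0LessThan)
  moreover have "(\<Prod>i<length r. x + 1 + real i) = pochhammer (x + 1) (length r)"
    unfolding pochhammer_prod by (simp add: atLeast0LessThan)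
  ultimately show ?thesis
    using first_column[OF r(1), where s = 0 and x = x] by (simp add: content_weight_def o_def)
qed

definition hook_triple :: "nat list \<Rightarrow> nat \<times> nat \<times> nat list" where
  "hook_triple l = (hd l, length (tl l), inner_part (tl l))"

text \<open>The number of rows tells how many zeros \<open>inner_part\<close> has dropped; padding
  them back and adding one to every entry restores the rows below the first.\<close>

lemma inj_on_hook_triple: "inj_on hook_triple {l. is_partition l \<and> l \<noteq> []}"
proof (rule inj_on_inverseI)
  fix l assume l: "l \<in> {l. is_partition l \<and> l \<noteq> []}"
  define r where "r = tl l"
  have r: "sorted_wrt (\<ge>) r" "0 \<notin> set r" "l = hd l # r"
    using l by (cases l; auto simp: is_partition_def r_def)+
  have "map Suc (map (\<lambda>a. a - 1) r) = r" using r(2) by (induction r) auto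
  then have "map Suc (inner_part r @ replicate (length r - length (inner_part r)) 0) = r"
    using filter_append_zeros[OF sorted_map_pred[OF r(1)]] by (simp add: inner_part_def)
  then show "(\<lambda>(m, b, i). m # map Suc (i @ replicate (b - length i) 0)) (hook_triple l) = l"
    using r(3) by (simp add: hook_triple_def r_def)
qed

definition part_sum :: "real \<Rightarrow> nat \<Rightarrow> real" where
  "part_sum x n = (\<Sum>l\<in>partitions n. content_weight x l)"

lemma part_sum_nonneg: "x \<ge> 0 \<Longrightarrow> part_sum x n \<ge> 0"
  unfolding part_sum_def by (intro sum_nonneg content_weight_nonneg)

text \<open>Summing over all inner partitions of the right size ignores whether they fit into the
  hook, which decouples row, column and inner part.\<close>

lemma sum_content_weight_le:
  assumes x: "x > 0" and n: "n > 0" and X: "X \<subseteq> partitions n"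
    and I: "finite I" "\<And>m r. m # r \<in> X \<Longrightarrow> (m, length r) \<in> I"
  shows "(\<Sum>l\<in>X. content_weight x l) \<le>
    (\<Sum>(m, b)\<in>I. pochhammer x m * pochhammer (x + 1) b * part_sum x (n - m - b))"
proof -
  define T where "T = (SIGMA mb:I. partitions (n - fst mb - snd mb))"
  define g where "g = (\<lambda>((m, b), i). pochhammer x m * pochhammer (x + 1) b * content_weight x i)"
  define \<phi> where "\<phi> l = ((hd l, length (tl l)), inner_part (tl l))" for l :: "nat list"
  have X': "is_partition l" "sum_list l = n" "l \<noteq> []" if "l \<in> X" for l
    using X that n by (auto simp: partitions_def)
  have "(\<Sum>l\<in>X. content_weight x l) = (\<Sum>l\<in>X. g (\<phi> l))"
  proof (intro sum.cong refl)
    fix l assume l: "l \<in> X"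
    then obtain m r where mr: "l = m # r" using X'(3) by (cases l) auto
    show "content_weight x l = g (\<phi> l)"
      using content_weight_hook[of m r x] X'(1)[OF l] mr by (simp add: g_def \<phi>_def)
  qed
  also have "inj_on \<phi> X"
  proof (rule inj_onI)
    fix l l' assume a: "l \<in> X" "l' \<in> X" "\<phi> l = \<phi> l'"
    then have "hook_triple l = hook_triple l'" by (simp add: \<phi>_def hook_triple_def)
    then show "l = l'" using inj_on_hook_triple a X' by (auto dest!: inj_onD)
  qed
  then have "(\<Sum>l\<in>X. g (\<phi> l)) = (\<Sum>t\<in>\<phi> ` X. g t)" by (simp add: sum.reindex)
  also have "\<dots> \<le> (\<Sum>t\<in>T. g t)"
  proof (rule sum_mono2)
    show "finite T" unfolding T_def using I(1) finite_partitions by auto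
    show "\<phi> ` X \<subseteq> T"
    proof
      fix t assume "t \<in> \<phi> ` X"
      then obtain l where l: "l \<in> X" "t = \<phi> l" by blast
      then obtain m r where mr: "l = m # r" using X'(3) by (cases l) auto
      have p: "is_partition r" "0 \<notin> set r" using X'(1)[OF l(1)] mr by (auto simp: is_partition_def)
      have "m + sum_list r = n" using X'(2)[OF l(1)] mr by simp
      then have "sum_list (inner_part r) = n - m - length r" using sum_list_inner_part[OF p(2)] by simp
      then have "inner_part r \<in> partitions (n - m - length r)"
        using is_partition_inner_part[OF p(1)] by (simp add: partitions_def)
      then show "t \<in> T" using I(2) l mr by (auto simp: T_def \<phi>_def)
    qed
    fix t
    show "0 \<le> g t" unfolding g_def using x
      by (auto simp: case_prod_unfold intro!: mult_nonneg_nonneg pochhammer_nonneg content_weight_nonneg)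
  qed
  also have "\<dots> = (\<Sum>mb\<in>I. \<Sum>i\<in>partitions (n - fst mb - snd mb). g (mb, i))"
    unfolding T_def by (subst sum.Sigma) (use I(1) finite_partitions in auto)
  also have "\<dots> = (\<Sum>(m, b)\<in>I. pochhammer x m * pochhammer (x + 1) b * part_sum x (n - m - b))"
    by (intro sum.cong refl) (auto simp: g_def part_sum_def sum_distrib_left)
  finally show ?thesis .
qed

section \<open>Estimates for sums over hooks\<close>

text \<open>The total weight of all hooks with \<open>h\<close> boxes.\<close>

definition hook_sum :: "real \<Rightarrow> nat \<Rightarrow> real" where
  "hook_sum x h = (\<Sum>m=1..h. pochhammer x m * pochhammer (x + 1) (h - m))"

text \<open>Log-convexity of the rising factorial: the product grows when the two lengths move apart
  at constant sum.\<close>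

lemma pochhammer_exchange:
  assumes "x > 0" "k \<le> i" "k \<le> j"
  shows "pochhammer x i * pochhammer x j \<le> pochhammer x k * pochhammer (x :: real) (i + j - k)"
proof -
  have i: "pochhammer x i = pochhammer x k * pochhammer (x + real k) (i - k)"
    using pochhammer_product[OF assms(2)] by blast
  have "pochhammer x (i + j - k) = pochhammer x j * pochhammer (x + real j) (i + j - k - j)"
    by (rule pochhammer_product) (use assms in simp)
  also have "i + j - k - j = i - k" by simp
  finally have j: "pochhammer x (i + j - k) = pochhammer x j * pochhammer (x + real j) (i - k)" .
  have "pochhammer (x + real k) (i - k) \<le> pochhammer (x + real j) (i - k)"
    unfolding pochhammer_prod by (rule prod_mono) (use assms in auto)
  then show ?thesis unfolding i j using assms
    by (simp add: mult_ac mult_left_mono pochhammer_nonneg)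
qed

lemma pochhammer_Suc_shift: "x > 0 \<Longrightarrow> pochhammer (x + 1) b = pochhammer x (Suc b) / (x::real)"
  by (simp add: pochhammer_rec)

lemma hook_term_le:
  assumes "x > 0" "k \<ge> 1" "k \<le> m" "m \<le> h + 1 - k"
  shows "pochhammer x m * pochhammer (x + 1) (h - m) \<le> pochhammer x k / x * pochhammer (x::real) (h + 1 - k)"
proof -
  have "pochhammer x m * pochhammer x (Suc (h - m)) \<le> pochhammer x k * pochhammer x (m + Suc (h - m) - k)"
    by (rule pochhammer_exchange) (use assms in auto)
  also have "m + Suc (h - m) - k = h + 1 - k" using assms by simp
  finally show ?thesis using assms(1) by (simp add: pochhammer_Suc_shift divide_right_mono)
qed

lemma hook_sum_middle:
  assumes "x > 0" "k \<ge> 1"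
  shows "(\<Sum>m=k..h+1-k. pochhammer x m * pochhammer (x + 1) (h - m))
    \<le> real h * (pochhammer x k / x * pochhammer (x::real) (h + 1 - k))"
proof -
  have "(\<Sum>m=k..h+1-k. pochhammer x m * pochhammer (x + 1) (h - m))
    \<le> of_nat (card {k..h+1-k}) * (pochhammer x k / x * pochhammer x (h + 1 - k))"
    by (rule sum_bounded_above) (use hook_term_le assms in auto)
  also have "\<dots> \<le> real h * (pochhammer x k / x * pochhammer x (h + 1 - k))"
    by (rule mult_right_mono) (use assms in \<open>auto intro!: mult_nonneg_nonneg divide_nonneg_nonneg pochhammer_nonneg\<close>)
  finally show ?thesis .
qed

text \<open>Counting terms as in \<open>hook_sum_middle\<close> costs a factor \<open>h\<close>,
  which the next \<open>k\<close> wins back because \<open>pochhammer x (h + 1 - k)\<close> drops by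
  about that factor. So the two extreme terms are taken off first.\<close>

lemma hook_sum_peel:
  assumes "x > 0" "k \<ge> 1"
  shows "(\<Sum>m=k..h+1-k. pochhammer x m * pochhammer (x + 1) (h - m))
    \<le> 2 * (pochhammer x k / x * pochhammer (x::real) (h + 1 - k)) +
      (\<Sum>m=Suc k..h+1-Suc k. pochhammer x m * pochhammer (x + 1) (h - m))"
proof (cases "k \<le> h + 1 - k")
  case True
  define t where "t m = pochhammer x m * pochhammer (x + 1) (h - m)" for m
  define c where "c = pochhammer x k / x * pochhammer x (h + 1 - k)"
  have t: "0 \<le> t m" for m
    using assms by (auto simp: t_def intro!: mult_nonneg_nonneg pochhammer_nonneg)
  have tc: "t k \<le> c" "t (h + 1 - k) \<le> c"
    unfolding t_def c_def by (rule hook_term_le; use assms True in simp)+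
  have "(\<Sum>m=k..h+1-k. t m) \<le> (\<Sum>m\<in>insert k (insert (h + 1 - k) {Suc k..h+1-Suc k}). t m)"
    by (rule sum_mono2) (use t in auto)
  also have "\<dots> \<le> t k + (\<Sum>m\<in>insert (h + 1 - k) {Suc k..h+1-Suc k}. t m)"
    using t[of k] by (auto simp: sum.insert_if)
  also have "\<dots> \<le> t k + (t (h + 1 - k) + (\<Sum>m=Suc k..h+1-Suc k. t m))"
    using t[of "h + 1 - k"] by (simp add: sum.insert_if)
  finally have "(\<Sum>m=k..h+1-k. t m) \<le> 2 * c + (\<Sum>m=Suc k..h+1-Suc k. t m)" using tc by linarith
  then show ?thesis unfolding t_def c_def .
next
  case False
  then show ?thesis using assms
    by (auto intro!: mult_nonneg_nonneg divide_nonneg_nonneg pochhammer_nonneg add_nonneg_nonneg sum_nonneg)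
qed

abbreviation R :: "nat \<Rightarrow> real" where "R \<equiv> pochhammer (3/2)"

lemma R_pos: "R m > 0" by (rule pochhammer_pos) simp

lemma R_Suc: "R (Suc m) = (3/2 + real m) * R m" by (simp add: pochhammer_Suc)

text \<open>Peeling once gives \<open>2 * R h\<close>, and counting the rest gives
  \<open>5/2 * R h\<close>.\<close>

lemma hook_sum_le: "h \<ge> 1 \<Longrightarrow> hook_sum (3/2) h \<le> 9/2 * R h"
proof -
  assume h: "h \<ge> 1"
  have "hook_sum (3/2) h \<le> 2 * (R 1 / (3/2) * R h) +
      (\<Sum>m=2..h+1-2. R m * pochhammer (3/2 + 1) (h - m))"
    using hook_sum_peel[of "3/2" 1 h] by (simp add: hook_sum_def numeral_2_eq_2)
  also have "(\<Sum>m=2..h+1-2. R m * pochhammer (3/2 + 1) (h - m)) \<le> real h * (R 2 / (3/2) * R (h + 1 - 2))"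
    by (rule hook_sum_middle) auto
  also have "R 2 = 15/4" by (simp add: numeral_2_eq_2 pochhammer_Suc)
  also have "real h * (15/4 / (3/2) * R (h + 1 - 2)) \<le> 5/2 * R h"
  proof -
    obtain k where k: "h = Suc k" using h by (cases h) auto
    have "real h * R k \<le> R h" unfolding k R_Suc using R_pos[of k] by (intro mult_right_mono) auto
    then show ?thesis using k by simp
  qed
  finally show ?thesis by simp
qed

text \<open>Without \<open>m = 1\<close> and \<open>m = h\<close>, the column and the row, the sum
  starts at \<open>k = 2\<close> and gains a factor of order \<open>h\<close>. Peeling contributes 5
  and counting \<open>35/2\<close>, rounded up to 23 in total.\<close>

lemma hook_sum_inner_le:
  assumes "h \<ge> 2"
  shows "(\<Sum>m=2..h-1. R m * pochhammer (3/2 + 1) (h - m)) \<le> 23 * R (h - 1)"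
proof -
  obtain k where k: "h = Suc (Suc k)" using assms by (metis Suc_le_D numeral_2_eq_2 Suc_le_mono)
  have R2: "R 2 = 15/4" by (simp add: numeral_2_eq_2 pochhammer_Suc)
  have R3: "R 3 = 105/8" by (simp add: numeral_3_eq_3 pochhammer_Suc)
  have "(\<Sum>m=2..h+1-2. R m * pochhammer (3/2 + 1) (h - m)) \<le> 2 * (R 2 / (3/2) * R (h + 1 - 2)) +
      (\<Sum>m=3..h+1-3. R m * pochhammer (3/2 + 1) (h - m))"
    using hook_sum_peel[of "3/2" 2 h] by (simp add: numeral_3_eq_3 numeral_2_eq_2)
  also have "(\<Sum>m=3..h+1-3. R m * pochhammer (3/2 + 1) (h - m)) \<le> real h * (R 3 / (3/2) * R (h + 1 - 3))"
    by (rule hook_sum_middle) auto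
  also have "2 * (R 2 / (3/2) * R (h + 1 - 2)) + real h * (R 3 / (3/2) * R (h + 1 - 3))
      = 5 * R (h - 1) + 35/4 * (real h * R k)" unfolding R2 R3 by (simp add: k)
  also have "real h * R k \<le> 2 * R (h - 1)"
  proof -
    have "real h * R k \<le> 2 * (3/2 + real k) * R k"
      using R_pos[of k] by (intro mult_right_mono) (simp_all add: k)
    moreover have "R (h - 1) = (3/2 + real k) * R k" by (simp add: k R_Suc)
    ultimately show ?thesis by (simp only: mult.assoc)
  qed
  finally show ?thesis using R_pos[of "h - 1"] by simp
qed

text \<open>\<open>R (n - h)\<close> is \<open>3/2\<close> times the rising factorial of
  \<open>3/2 + 1\<close> of length \<open>n - 1 - h\<close>, so the convolution is a hook sum and
  the constant is \<open>3/2 * 9/2\<close>.\<close>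

lemma R_convolution: "n \<ge> 2 \<Longrightarrow> (\<Sum>h=1..n-1. R h * R (n - h)) \<le> 27/4 * R (n - 1)"
proof -
  assume n: "n \<ge> 2"
  have "(\<Sum>h=1..n-1. R h * R (n - h)) = 3/2 * hook_sum (3/2) (n - 1)"
    unfolding hook_sum_def sum_distrib_left
  proof (intro sum.cong refl)
    fix h assume "h \<in> {1..n-1}"
    then have "n - h = Suc (n - 1 - h)" using n by auto
    then show "R h * R (n - h) = 3/2 * (R h * pochhammer (3/2 + 1) (n - 1 - h))"
      using pochhammer_Suc_shift[of "3/2" "n - 1 - h"] by simp
  qed
  also have "\<dots> \<le> 3/2 * (9/2 * R (n - 1))"
    by (intro mult_left_mono hook_sum_le) (use n in auto)
  finally show ?thesis by simp
qed

section \<open>Total weight of all partitions\<close>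

lemma part_sum_0: "part_sum x 0 = 1"
proof -
  have "l = []" if "is_partition l" "sum_list l = 0" for l
    using that by (cases l) (auto simp: is_partition_def)
  then have "partitions 0 = {[]}" by (auto simp: partitions_def is_partition_def)
  then show ?thesis by (simp add: part_sum_def content_weight_def)
qed

definition hooks :: "nat \<Rightarrow> (nat \<times> nat) set" where
  "hooks h = (\<lambda>m. (m, h - m)) ` {1..h}"

lemma sum_hooks: "(\<Sum>(m, b)\<in>hooks h. F m b) = (\<Sum>m=1..h. F m (h - m))"
  unfolding hooks_def by (subst sum.reindex) (auto simp: inj_on_def)

lemma sum_hook_part_sum:
  "(\<Sum>(m, b)\<in>(\<Union>h\<in>{1..<n}. hooks h). pochhammer x m * pochhammer (x + 1) b * part_sum x (n - m - b)) =
    (\<Sum>h=1..<n. hook_sum x h * part_sum x (n - h))"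
proof -
  have "(\<Sum>mb\<in>(\<Union>h\<in>{1..<n}. hooks h). case mb of (m, b) \<Rightarrow> pochhammer x m * pochhammer (x + 1) b * part_sum x (n - m - b))
    = (\<Sum>h=1..<n. \<Sum>mb\<in>hooks h. case mb of (m, b) \<Rightarrow> pochhammer x m * pochhammer (x + 1) b * part_sum x (n - m - b))"
    by (rule sum.UNION_disjoint) (auto simp: hooks_def)
  also have "\<dots> = (\<Sum>h=1..<n. hook_sum x h * part_sum x (n - h))"
    by (intro sum.cong refl) (simp add: sum_hooks hook_sum_def sum_distrib_right)
  finally show ?thesis .
qed

lemma hook_mem:
  assumes "m # r \<in> partitions n"
  shows "(m, length r) \<in> (\<Union>h\<in>{1..<n}. hooks h) \<union> hooks n"
proof -
  have p: "m > 0" "0 \<notin> set r" "m + sum_list r = n" using assms by (auto simp: partitions_def is_partition_def)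
  have "m + length r \<le> n" using sum_list_inner_part[OF p(2)] p(3) by simp
  moreover have "(m, length r) \<in> hooks (m + length r)" unfolding hooks_def using p by force
  moreover have "m + length r \<ge> 1" using p by simp
  ultimately show ?thesis by (cases "m + length r = n") (auto simp: Suc_le_eq intro!: bexI[of _ "m + length r"])
qed

lemma hooks_disjoint: "(\<Union>h\<in>{1..<n}. hooks h) \<inter> hooks n = {}"
  by (auto simp: hooks_def)

lemma finite_hooks: "finite (hooks h)" by (simp add: hooks_def)

lemma part_sum_rec:
  assumes x: "x > 0" and n: "n > 0"
  shows "part_sum x n \<le> hook_sum x n + (\<Sum>h=1..<n. hook_sum x h * part_sum x (n - h))"
proof -
  let ?t = "\<lambda>(m, b). pochhammer x m * pochhammer (x + 1) b * part_sum x (n - m - b)"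
  have "part_sum x n \<le> (\<Sum>mb\<in>(\<Union>h\<in>{1..<n}. hooks h) \<union> hooks n. ?t mb)"
    unfolding part_sum_def[of x n]
    by (rule sum_content_weight_le[OF x n]) (use hook_mem finite_hooks in auto)
  also have "\<dots> = (\<Sum>mb\<in>(\<Union>h\<in>{1..<n}. hooks h). ?t mb) + (\<Sum>mb\<in>hooks n. ?t mb)"
    by (rule sum.union_disjoint) (use finite_hooks hooks_disjoint in auto)
  also have "(\<Sum>mb\<in>hooks n. ?t mb) = hook_sum x n"
    unfolding sum_hooks hook_sum_def by (intro sum.cong refl) (simp add: part_sum_0)
  finally show ?thesis unfolding sum_hook_part_sum by linarith
qed

text \<open>Among the hooks with all \<open>n\<close> boxes, the column and the row are those with
  \<open>m = 1\<close> and \<open>m = n\<close>.\<close>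

lemma part_sum_rec_nontrivial:
  assumes x: "x > 0" and n: "n > 0"
  shows "(\<Sum>l\<in>partitions n - {[n], replicate n 1}. content_weight x l) \<le>
    (\<Sum>m=2..n-1. pochhammer x m * pochhammer (x + 1) (n - m)) + (\<Sum>h=1..<n. hook_sum x h * part_sum x (n - h))"
proof -
  let ?t = "\<lambda>(m, b). pochhammer x m * pochhammer (x + 1) b * part_sum x (n - m - b)"
  define I where "I = (\<lambda>m. (m, n - m)) ` {2..n-1}"
  have "(\<Sum>l\<in>partitions n - {[n], replicate n 1}. content_weight x l)
      \<le> (\<Sum>mb\<in>(\<Union>h\<in>{1..<n}. hooks h) \<union> I. ?t mb)"
  proof (rule sum_content_weight_le[OF x n])
    show "finite ((\<Union>h\<in>{1..<n}. hooks h) \<union> I)" by (simp add: finite_hooks I_def)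
    fix m r assume mr: "m # r \<in> partitions n - {[n], replicate n 1}"
    have p: "m > 0" "0 \<notin> set r" "m + sum_list r = n" using mr by (auto simp: partitions_def is_partition_def)
    show "(m, length r) \<in> (\<Union>h\<in>{1..<n}. hooks h) \<union> I"
    proof (cases "(m, length r) \<in> hooks n")
      case True
      then have len: "length r = n - m" "m \<le> n" by (auto simp: hooks_def)
      have "m \<noteq> n"
      proof
        assume "m = n"
        then have "r = []" using len by simp
        then show False using mr \<open>m = n\<close> by simp
      qed
      moreover have "m \<noteq> 1"
      proof
        assume m: "m = 1"
        have "\<forall>a\<in>set r. a \<le> 1" using mr m by (auto simp: partitions_def is_partition_def)
        then have "\<forall>a\<in>set r. a = 1" using p(2) by (metis le_antisym less_one not_less)
        then have "r = replicate (n - 1) 1" using len m by (intro replicate_eqI) auto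
        then have "m # r = replicate (Suc (n - 1)) 1" using m by simp
        then show False using mr n by simp
      qed
      ultimately have "m \<in> {2..n-1}" using p(1) len by auto
      then show ?thesis using len by (auto simp: I_def)
    next
      case False
      then show ?thesis using hook_mem[of m r n] mr by blast
    qed
  qed auto
  also have "\<dots> = (\<Sum>mb\<in>(\<Union>h\<in>{1..<n}. hooks h). ?t mb) + (\<Sum>mb\<in>I. ?t mb)"
    by (rule sum.union_disjoint) (auto simp: finite_hooks I_def hooks_def)
  also have "(\<Sum>mb\<in>I. ?t mb) = (\<Sum>m=2..n-1. pochhammer x m * pochhammer (x + 1) (n - m))"
    unfolding I_def by (subst sum.reindex) (auto simp: inj_on_def part_sum_0 intro!: sum.cong)
  finally show ?thesis unfolding sum_hook_part_sum by linarith
qed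

lemma sum_hook_part_sum_le:
  assumes n: "n \<ge> 2" and K: "K \<ge> 0" "\<And>k. 1 \<le> k \<Longrightarrow> k < n \<Longrightarrow> part_sum (3/2) k \<le> K * R k"
  shows "(\<Sum>h=1..<n. hook_sum (3/2) h * part_sum (3/2) (n - h)) \<le> 31 * K * R (n - 1)"
proof -
  have "(\<Sum>h=1..<n. hook_sum (3/2) h * part_sum (3/2) (n - h)) \<le> (\<Sum>h=1..<n. 9/2 * K * (R h * R (n - h)))"
  proof (rule sum_mono)
    fix h assume h: "h \<in> {1..<n}"
    have "hook_sum (3/2) h * part_sum (3/2) (n - h) \<le> (9/2 * R h) * (K * R (n - h))"
      using h n by (intro mult_mono hook_sum_le K part_sum_nonneg) (auto simp: R_pos[THEN less_imp_le])
    then show "hook_sum (3/2) h * part_sum (3/2) (n - h) \<le> 9/2 * K * (R h * R (n - h))" by (simp add: mult_ac)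
  qed
  also have "\<dots> = 9/2 * K * (\<Sum>h=1..n-1. R h * R (n - h))"
    unfolding sum_distrib_left by (rule sum.cong) (use n in auto)
  also have "\<dots> \<le> 9/2 * K * (27/4 * R (n - 1))"
    by (intro mult_left_mono R_convolution n) (use K in auto)
  \<comment> \<open>\<open>9/2 * 27/4 = 30.375\<close>.\<close>
  also have "\<dots> \<le> 31 * K * R (n - 1)"
    using mult_nonneg_nonneg[OF K(1) R_pos[THEN less_imp_le, of "n - 1"]] by simp
  finally show ?thesis .
qed

text \<open>In the recursion the proper hooks contribute at most \<open>31 * K * R (n - 1)\<close>,
  which is below \<open>K / 2 * R n\<close> once \<open>n > 62\<close>; the other half of
  \<open>K \<ge> 9\<close> covers the hooks with \<open>n\<close> boxes. The finitely many smaller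
  \<open>n\<close> enter the choice of \<open>K\<close>.\<close>

lemma part_sum_bound: "\<exists>K\<ge>0. \<forall>n. part_sum (3/2) n \<le> K * R n"
proof -
  define K where "K = 9 + (\<Sum>k\<le>62. part_sum (3/2) k / R k)"
  have nn: "0 \<le> part_sum (3/2) k / R k" for k
    by (intro divide_nonneg_pos part_sum_nonneg R_pos) simp_all
  have K9: "K \<ge> 9" unfolding K_def using nn by (simp add: sum_nonneg)
  have "part_sum (3/2) n \<le> K * R n" for n
  proof (induction n rule: less_induct)
    case (less n)
    show ?case
    proof (cases "n \<le> 62")
      case True
      have "part_sum (3/2) n / R n \<le> (\<Sum>k\<le>62. part_sum (3/2) k / R k)"
        by (rule member_le_sum) (use True nn in auto)
      then have "part_sum (3/2) n / R n \<le> K" by (simp add: K_def)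
      then show ?thesis using R_pos[of n] by (simp add: field_simps)
    next
      case False
      obtain k where k: "n = Suc k" using False by (cases n) auto
      have "part_sum (3/2) n \<le> hook_sum (3/2) n + (\<Sum>h=1..<n. hook_sum (3/2) h * part_sum (3/2) (n - h))"
        by (rule part_sum_rec) (use False in auto)
      also have "\<dots> \<le> 9/2 * R n + 31 * K * R (n - 1)"
        by (intro add_mono hook_sum_le sum_hook_part_sum_le) (use False K9 less.IH in auto)
      also have "31 * K * R (n - 1) \<le> K / 2 * R n"
      proof -
        have "62 * R k \<le> R n" unfolding k R_Suc using False k R_pos[of k] by (intro mult_right_mono) auto
        then have "K / 2 * (62 * R k) \<le> K / 2 * R n" using K9 by (intro mult_left_mono) auto
        then show ?thesis using k by simp
      qed
      also have "9/2 * R n + K / 2 * R n = (9/2 + K / 2) * R n" by (simp add: algebra_simps)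
      also have "\<dots> \<le> K * R n" using K9 R_pos[of n] by (intro mult_right_mono) auto
      finally show ?thesis by simp
    qed
  qed
  then show ?thesis using K9 by (intro exI[of _ K]) auto
qed

text \<open>The quotient \<open>R m / fact m\<close> grows like \<open>sqrt m\<close>; the induction
  runs on its square to avoid roots.\<close>

lemma R_le_fact: "R (Suc m) \<le> 2 * sqrt (real (Suc m)) * fact (Suc m)"
proof -
  have "(R (Suc m) / fact (Suc m))\<^sup>2 \<le> 4 * real (Suc m)"
  proof (induction m)
    case (Suc m)
    define a where "a = real (Suc m)"
    have a: "a \<ge> 1" by (simp add: a_def)
    have "R (Suc (Suc m)) / fact (Suc (Suc m)) = (R (Suc m) / fact (Suc m)) * ((a + 3/2) / (a + 1))"
      by (simp add: R_Suc[of "Suc m"] a_def field_simps)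
    then have "(R (Suc (Suc m)) / fact (Suc (Suc m)))\<^sup>2 = (R (Suc m) / fact (Suc m))\<^sup>2 * ((a + 3/2) / (a + 1))\<^sup>2"
      by (simp only: power_mult_distrib)
    also have "\<dots> \<le> (4 * a) * ((a + 3/2) / (a + 1))\<^sup>2"
      using Suc by (intro mult_right_mono) (auto simp: a_def)
    also have "\<dots> \<le> 4 * (a + 1)"
    proof -
      have "a * (a + 3/2)\<^sup>2 \<le> (a + 1) * (a + 1)\<^sup>2"
        using a by (simp add: power2_eq_square algebra_simps)
      then have "4 * (a * (a + 3/2)\<^sup>2) \<le> 4 * ((a + 1) * (a + 1)\<^sup>2)" by (rule mult_left_mono) simp
      then have "4 * a * (a + 3/2)\<^sup>2 \<le> 4 * (a + 1) * (a + 1)\<^sup>2" by (simp only: mult.assoc)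
      moreover have "(a + 1)\<^sup>2 > 0" using a by simp
      ultimately have "4 * a * (a + 3/2)\<^sup>2 / (a + 1)\<^sup>2 \<le> 4 * (a + 1)" by (simp add: divide_le_eq)
      then show ?thesis by (simp add: power_divide)
    qed
    also have "4 * (a + 1) = 4 * real (Suc (Suc m))" by (simp add: a_def)
    finally show ?case .
  qed (simp add: power2_eq_square)
  then have "R (Suc m) / fact (Suc m) \<le> sqrt (4 * real (Suc m))" by (rule real_le_rsqrt)
  also have "\<dots> = 2 * sqrt (real (Suc m))"
    using real_sqrt_mult[of 4 "real (Suc m)"] by (simp del: of_nat_Suc)
  finally show ?thesis by (simp add: divide_le_eq)
qed

text \<open>Both sums in \<open>part_sum_rec_nontrivial\<close> are of order
  \<open>R (n - 1)\<close>, a factor \<open>n\<close> below \<open>R n\<close>; comparing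
  \<open>R\<close> with the factorial gives back a factor \<open>sqrt n\<close>.\<close>

lemma nontrivial_weight_bound:
  "\<exists>C\<ge>0. \<forall>n\<ge>2. (\<Sum>l\<in>partitions n - {[n], replicate n 1}. content_weight (3/2) l) \<le> C * fact n / sqrt n"
proof -
  obtain K where K: "K \<ge> 0" "\<And>n. part_sum (3/2) n \<le> K * R n" using part_sum_bound by blast
  define C where "C = 2 * (23 + 31 * K)"
  have "(\<Sum>l\<in>partitions n - {[n], replicate n 1}. content_weight (3/2) l) \<le> C * fact n / sqrt n" if n: "n \<ge> 2" for n
  proof -
    obtain m where m: "n = Suc (Suc m)" using n by (metis Suc_le_D numeral_2_eq_2 Suc_le_mono)
    have "(\<Sum>l\<in>partitions n - {[n], replicate n 1}. content_weight (3/2) l) \<le>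
      (\<Sum>m=2..n-1. R m * pochhammer (3/2 + 1) (n - m)) + (\<Sum>h=1..<n. hook_sum (3/2) h * part_sum (3/2) (n - h))"
      by (rule part_sum_rec_nontrivial) (use n in auto)
    also have "\<dots> \<le> 23 * R (n - 1) + 31 * K * R (n - 1)"
      by (intro add_mono hook_sum_inner_le sum_hook_part_sum_le n K)
    also have "\<dots> = (23 + 31 * K) * R (Suc m)" by (simp add: m algebra_simps)
    also have "\<dots> \<le> (23 + 31 * K) * (2 * sqrt (real (Suc m)) * fact (Suc m))"
      by (intro mult_left_mono R_le_fact) (use K in auto)
    also have "\<dots> = C * (sqrt (real (Suc m)) * fact (Suc m))" by (simp only: C_def mult_ac)
    also have "\<dots> \<le> C * (sqrt (real n) * fact (Suc m))"
      by (intro mult_left_mono mult_right_mono) (use K in \<open>auto simp: C_def m\<close>)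
    also have "sqrt (real n) * fact (Suc m) = fact n / sqrt n"
      using real_sqrt_mult_self[of n] by (simp add: m field_simps del: real_sqrt_mult_self of_nat_Suc)
    finally show ?thesis by simp
  qed
  then show ?thesis using K by (intro exI[of _ C]) (auto simp: C_def)
qed

section \<open>The cycle count of a uniform permutation\<close>

text \<open>The last of \<open>n + 1\<close> points is a cycle of its own with probability
  \<open>1 / (n + 1)\<close> and is spliced into an old cycle otherwise. Up to \<open>fact n\<close>
  these are the unsigned Stirling numbers of the first kind.\<close>

fun cyc_prob :: "nat \<Rightarrow> nat \<Rightarrow> real" where
  "cyc_prob 0 v = of_bool (v = 0)"
| "cyc_prob (Suc n) v = (real n * cyc_prob n v + (case v of 0 \<Rightarrow> 0 | Suc w \<Rightarrow> cyc_prob n w)) / real (Suc n)"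

lemma cyc_prob_eq_0: "v > n \<Longrightarrow> cyc_prob n v = 0"
  by (induction n arbitrary: v) (auto split: nat.split)

text \<open>Vector valued, to serve real moments as well as complex characteristic
  functions.\<close>

definition cyc_mean :: "nat \<Rightarrow> (nat \<Rightarrow> 'a::real_vector) \<Rightarrow> 'a" where
  "cyc_mean n F = (\<Sum>v\<le>n. cyc_prob n v *\<^sub>R F v)"

lemma cyc_mean_0 [simp]: "cyc_mean 0 F = F 0"
  by (simp add: cyc_mean_def)

lemma cyc_mean_Suc:
  "cyc_mean (Suc n) F = (real n *\<^sub>R cyc_mean n F + cyc_mean n (\<lambda>v. F (Suc v))) /\<^sub>R real (Suc n)"
proof -
  have a: "(\<Sum>v\<le>Suc n. cyc_prob n v *\<^sub>R F v) = cyc_mean n F"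
    by (simp add: cyc_mean_def cyc_prob_eq_0)
  have b: "(\<Sum>v\<le>Suc n. (case v of 0 \<Rightarrow> 0 | Suc w \<Rightarrow> cyc_prob n w) *\<^sub>R F v) = cyc_mean n (\<lambda>v. F (Suc v))"
    unfolding sum.atMost_Suc_shift cyc_mean_def by simp
  have "real (Suc n) *\<^sub>R cyc_mean (Suc n) F = (\<Sum>v\<le>Suc n. (real (Suc n) * cyc_prob (Suc n) v) *\<^sub>R F v)"
    unfolding cyc_mean_def scaleR_sum_right scaleR_scaleR ..
  also have "\<dots> = (\<Sum>v\<le>Suc n. real n *\<^sub>R (cyc_prob n v *\<^sub>R F v) + (case v of 0 \<Rightarrow> 0 | Suc w \<Rightarrow> cyc_prob n w) *\<^sub>R F v)"
    by (intro sum.cong refl) (simp add: scaleR_add_left del: of_nat_Suc)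
  also have "\<dots> = real n *\<^sub>R cyc_mean n F + cyc_mean n (\<lambda>v. F (Suc v))"
    unfolding sum.distrib scaleR_sum_right[symmetric] a b ..
  finally have "inverse (real (Suc n)) *\<^sub>R (real (Suc n) *\<^sub>R cyc_mean (Suc n) F) =
    inverse (real (Suc n)) *\<^sub>R (real n *\<^sub>R cyc_mean n F + cyc_mean n (\<lambda>v. F (Suc v)))" by (simp only:)
  then show ?thesis by (simp del: of_nat_Suc)
qed

lemma cyc_mean_add: "cyc_mean n (\<lambda>v. F v + H v) = cyc_mean n F + cyc_mean n H"
  by (simp add: cyc_mean_def scaleR_add_right sum.distrib)

lemma cyc_mean_scaleR: "cyc_mean n (\<lambda>v. c *\<^sub>R F v) = c *\<^sub>R cyc_mean n F"
  by (simp add: cyc_mean_def scaleR_sum_right mult.commute)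

lemma cyc_mean_mult: "cyc_mean n (\<lambda>v. c * F v) = c * cyc_mean n (F :: nat \<Rightarrow> 'a::real_algebra)"
  by (simp add: cyc_mean_def sum_distrib_left)

lemma cyc_mean_const: "cyc_mean n (\<lambda>_. c) = c"
proof (induction n)
  case (Suc n)
  have "(real n *\<^sub>R c + c) /\<^sub>R real (Suc n) = (inverse (real (Suc n)) * real (Suc n)) *\<^sub>R c"
    by (simp add: algebra_simps flip: scaleR_add_left)
  then show ?case using Suc by (simp add: cyc_mean_Suc del: of_nat_Suc)
qed simp

lemma cyc_mean_power:
  "cyc_mean n (\<lambda>v. z ^ v) = (\<Prod>j<n. (z + of_nat j) / (of_nat j + 1) :: complex)"
proof (induction n)
  case (Suc n)
  have "cyc_mean (Suc n) (\<lambda>v. z ^ v) = (real n *\<^sub>R cyc_mean n (\<lambda>v. z ^ v) + z * cyc_mean n (\<lambda>v. z ^ v)) /\<^sub>R real (Suc n)"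
    unfolding cyc_mean_Suc by (simp add: cyc_mean_mult del: of_nat_Suc)
  also have "\<dots> = cyc_mean n (\<lambda>v. z ^ v) * ((z + of_nat n) / (of_nat n + 1))"
    by (simp add: scaleR_conv_of_real field_simps)
  finally show ?case using Suc by simp
qed simp

lemma A_Suc: "A (Suc n) = A n + 1 / real (Suc n)" by (simp add: A_def)
lemma B_Suc: "B (Suc n) = B n + (1 / real (Suc n) - 1 / (real (Suc n))\<^sup>2)" by (simp add: B_def)
lemma A_0: "A 0 = 0" and B_0: "B 0 = 0" by (simp_all add: A_def B_def)

lemma cyc_mean_id: "cyc_mean n real = A n"
proof (induction n)
  case (Suc n)
  have "cyc_mean n (\<lambda>v. real (Suc v)) = A n + 1"
    using cyc_mean_add[of n real "\<lambda>_. 1"] Suc by (simp add: cyc_mean_const algebra_simps)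
  then show ?case using Suc by (simp add: cyc_mean_Suc A_Suc field_simps)
qed (simp add: A_0)

lemma cyc_mean_square: "cyc_mean n (\<lambda>v. (real v)\<^sup>2) = B n + (A n)\<^sup>2"
proof (induction n)
  case (Suc n)
  have "cyc_mean n (\<lambda>v. (real (Suc v))\<^sup>2) = cyc_mean n (\<lambda>v. (real v)\<^sup>2 + (2 * real v + 1))"
    by (simp add: power2_eq_square algebra_simps)
  also have "\<dots> = B n + (A n)\<^sup>2 + (2 * A n + 1)"
    unfolding cyc_mean_add cyc_mean_mult Suc by (simp add: cyc_mean_id cyc_mean_const)
  finally show ?case using Suc
    by (simp add: cyc_mean_Suc A_Suc B_Suc power2_eq_square divide_simps) (simp add: algebra_simps)
qed (simp add: A_0 B_0)

section \<open>Moments weighted by the sign\<close>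

text \<open>\<open>(- 1) ^ (n + v)\<close> is the sign of a permutation of \<open>n\<close> points
  with \<open>v\<close> cycles; this mean is the contribution of the column.\<close>

definition sgn_mean :: "nat \<Rightarrow> (nat \<Rightarrow> 'a::real_vector) \<Rightarrow> 'a" where
  "sgn_mean n F = cyc_mean n (\<lambda>v. (- 1) ^ (n + v) *\<^sub>R F v)"

lemma sgn_mean_Suc:
  "sgn_mean (Suc n) F = (sgn_mean n (\<lambda>v. F (Suc v)) - real n *\<^sub>R sgn_mean n F) /\<^sub>R real (Suc n)"
proof -
  have "cyc_mean n (\<lambda>v. (- 1) ^ (Suc n + v) *\<^sub>R F v) = - sgn_mean n F"
    using cyc_mean_scaleR[of n "- 1" "\<lambda>v. (- 1) ^ (n + v) *\<^sub>R F v"] by (simp add: sgn_mean_def)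
  then show ?thesis unfolding sgn_mean_def[of "Suc n"] cyc_mean_Suc by (simp add: sgn_mean_def)
qed

lemma sgn_mean_add: "sgn_mean n (\<lambda>v. F v + H v) = sgn_mean n F + sgn_mean n H"
  by (simp add: sgn_mean_def scaleR_add_right cyc_mean_add)

lemma sgn_mean_mult: "sgn_mean n (\<lambda>v. c * F v) = c * sgn_mean n (F :: nat \<Rightarrow> real)"
  by (simp add: sgn_mean_def mult.left_commute cyc_mean_mult)

text \<open>From two points on there are as many even as odd permutations.\<close>

lemma sgn_mean_one: "sgn_mean (Suc (Suc n)) (\<lambda>_. 1) = (0::real)"
  by (induction n) (simp_all add: sgn_mean_Suc sgn_mean_def[of 0])

text \<open>The signed generating function is a falling factorial divided by the factorial. It has a
  simple zero at 1, with derivative \<open>1 / (k * (k - 1))\<close> up to sign for \<open>k\<close>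
  points.\<close>

lemma sgn_mean_id: "\<bar>sgn_mean (Suc (Suc n)) real\<bar> \<le> 1 / real (Suc (Suc n))"
proof (induction n)
  case 0
  show ?case by (simp add: sgn_mean_Suc sgn_mean_def[of 0])
next
  case (Suc n)
  define k where "k = Suc (Suc n)"
  have "sgn_mean k (\<lambda>v. real (Suc v)) = sgn_mean k real"
    using sgn_mean_add[of k real "\<lambda>_. 1"] sgn_mean_one[of n] by (simp add: k_def add.commute)
  then have "sgn_mean (Suc k) real = - ((real k - 1) / real (Suc k) * sgn_mean k real)"
    unfolding sgn_mean_Suc by (simp add: field_simps)
  then have "\<bar>sgn_mean (Suc k) real\<bar> = (real k - 1) / real (Suc k) * \<bar>sgn_mean k real\<bar>"
    by (simp add: abs_mult k_def)
  also have "\<dots> \<le> (real k - 1) / real (Suc k) * (1 / real k)"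
    using Suc by (intro mult_left_mono) (auto simp: k_def)
  also have "\<dots> = (1 - 1 / real k) / real (Suc k)"
  proof -
    have e: "1 - 1 / real k = (real k - 1) * (1 / real k)" by (simp add: k_def field_simps)
    show ?thesis unfolding e by simp
  qed
  also have "\<dots> \<le> 1 / real (Suc k)" by (rule divide_right_mono) auto
  finally show ?case by (simp add: k_def)
qed

text \<open>The recursion brings in twice the first moment, at most \<open>2 / k\<close>; the
  constant 4 leaves room for it.\<close>

lemma sgn_mean_square: "\<bar>sgn_mean (Suc (Suc n)) (\<lambda>v. (real v)\<^sup>2)\<bar> \<le> 4 / real (Suc (Suc n))"
proof (induction n)
  case 0
  show ?case by (simp add: sgn_mean_Suc sgn_mean_def[of 0])
next
  case (Suc n)
  define k where "k = Suc (Suc n)"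
  define a b where "a = sgn_mean k real" and "b = sgn_mean k (\<lambda>v. (real v)\<^sup>2)"
  have "sgn_mean k (\<lambda>v. (real (Suc v))\<^sup>2) = sgn_mean k (\<lambda>v. (real v)\<^sup>2 + (2 * real v + 1))"
    by (simp add: power2_eq_square algebra_simps)
  also have "\<dots> = b + 2 * a"
    unfolding sgn_mean_add sgn_mean_mult a_def b_def using sgn_mean_one[of n] by (simp add: k_def)
  finally have "sgn_mean (Suc k) (\<lambda>v. (real v)\<^sup>2) = (2 * a - (real k - 1) * b) / real (Suc k)"
    unfolding sgn_mean_Suc by (simp add: b_def field_simps)
  moreover have "\<bar>2 * a - (real k - 1) * b\<bar> \<le> 2 * \<bar>a\<bar> + (real k - 1) * \<bar>b\<bar>"
    using abs_triangle_ineq4[of "2 * a" "(real k - 1) * b"] by (simp add: abs_mult k_def)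
  moreover have "\<dots> \<le> 2 * (1 / real k) + (real k - 1) * (4 / real k)"
    using Suc sgn_mean_id[of n] by (intro add_mono mult_left_mono) (auto simp: a_def b_def k_def)
  moreover have "\<dots> \<le> 4"
  proof -
    have "real k > 0" by (simp add: k_def)
    then have "2 * (1 / real k) + (real k - 1) * (4 / real k) = 4 - 2 / real k" by (simp add: field_simps)
    moreover have "0 \<le> 2 / real k" by simp
    ultimately show ?thesis by linarith
  qed
  ultimately have "\<bar>sgn_mean (Suc k) (\<lambda>v. (real v)\<^sup>2)\<bar> \<le> 4 / real (Suc k)"
    by (simp add: divide_right_mono del: of_nat_Suc)
  then show ?case by (simp add: k_def)
qed

text \<open>The characteristic function of the cycle count factors over \<open>p = 1, 1/2, \<dots>, 1/n\<close> as for a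
  sum of independent Bernoulli variables.\<close>

definition bern_char :: "real \<Rightarrow> real \<Rightarrow> complex" where
  "bern_char p t = 1 + p * (iexp t - 1)"

definition cyc_char :: "nat \<Rightarrow> real \<Rightarrow> complex" where
  "cyc_char n t = cyc_mean n (\<lambda>v. iexp (t * real v))"

lemma cyc_char_prod: "cyc_char n t = (\<Prod>j<n. bern_char (1 / real (Suc j)) t)"
proof -
  have "iexp (t * real v) = iexp t ^ v" for v
    by (simp add: exp_of_nat_mult[symmetric] mult_ac)
  then have "cyc_char n t = (\<Prod>j<n. (iexp t + of_nat j) / (of_nat j + 1))"
    unfolding cyc_char_def by (simp add: cyc_mean_power)
  also have "\<dots> = (\<Prod>j<n. bern_char (1 / real (Suc j)) t)"
  proof (intro prod.cong refl)
    fix j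
    have "of_nat j + (1::complex) \<noteq> 0" by (metis of_nat_Suc of_nat_neq_0 add.commute)
    then show "(iexp t + of_nat j) / (of_nat j + 1) = bern_char (1 / real (Suc j)) t"
      by (simp add: bern_char_def field_simps)
  qed
  finally show ?thesis .
qed

section \<open>Bounds for the characteristic function\<close>

lemma B_sum: "B n = (\<Sum>j<n. 1 / real (Suc j) * (1 - 1 / real (Suc j)))"
  by (induction n) (simp_all add: B_0 B_Suc power2_eq_square right_diff_distrib del: of_nat_Suc)

lemma A_sum: "A n = (\<Sum>j<n. 1 / real (Suc j))"
  by (induction n) (simp_all add: A_0 A_Suc)

text \<open>The squared modulus is exactly \<open>1 - 2 * p * (1 - p) * (1 - cos t)\<close>; then
  \<open>1 + u \<le> exp u\<close>.\<close>

lemma norm_bern_char_le: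
  assumes "0 \<le> p" "p \<le> 1"
  shows "cmod (bern_char p t) \<le> exp (- (p * (1 - p) * (1 - cos t)))"
proof (rule power2_le_imp_le)
  have "(cmod (bern_char p t))\<^sup>2 = (1 + p * (cos t - 1))\<^sup>2 + (p * sin t)\<^sup>2"
    by (simp add: bern_char_def cmod_power2 Re_exp Im_exp)
  also have "\<dots> = (1 + p * (cos t - 1))\<^sup>2 + p\<^sup>2 * (1 - (cos t)\<^sup>2)"
    by (simp add: power_mult_distrib sin_squared_eq)
  also have "\<dots> = 1 + (- 2 * (p * (1 - p) * (1 - cos t)))"
    by (simp add: power2_eq_square algebra_simps)
  also have "\<dots> \<le> exp (- 2 * (p * (1 - p) * (1 - cos t)))" by (rule exp_ge_add_one_self)
  also have "\<dots> = (exp (- (p * (1 - p) * (1 - cos t))))\<^sup>2" by (simp add: exp_double[symmetric])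
  finally show "(cmod (bern_char p t))\<^sup>2 \<le> (exp (- (p * (1 - p) * (1 - cos t))))\<^sup>2" .
qed simp

lemma norm_cyc_char_le: "cmod (cyc_char n t) \<le> exp (- (B n * (1 - cos t)))"
proof -
  have "cmod (cyc_char n t) \<le> (\<Prod>j<n. exp (- (1 / real (Suc j) * (1 - 1 / real (Suc j)) * (1 - cos t))))"
    unfolding cyc_char_prod prod_norm[symmetric] by (intro prod_mono conjI norm_bern_char_le) auto
  also have "\<dots> = exp (- (B n * (1 - cos t)))"
    by (simp add: exp_sum[symmetric] B_sum sum_negf sum_distrib_right del: of_nat_Suc)
  finally show ?thesis .
qed

lemma pi_sq_le: "pi\<^sup>2 \<le> 10"
proof -
  have "pi \<le> 3.15" using pi_approx by simp
  then have "pi\<^sup>2 \<le> 3.15\<^sup>2" by (intro power_mono) auto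
  then show ?thesis by (simp add: power2_eq_square)
qed

text \<open>Taylor gives the lower bound \<open>t^2 / 2 - t^4 / 24\<close>, and
  \<open>t^2 \<le> 10\<close> on this range leaves \<open>1/2 - 10/24 = 1/12\<close>.\<close>

lemma one_minus_cos_ge:
  assumes "\<bar>t\<bar> \<le> pi"
  shows "t\<^sup>2 / 12 \<le> 1 - cos t"
proof -
  have "cmod (iexp t - (\<Sum>k\<le>3. (\<i> * t) ^ k / fact k)) \<le> \<bar>t\<bar> ^ 4 / fact 4"
    using iexp_approx1[of t 3] by simp
  moreover have "(\<Sum>k\<le>3. (\<i> * t) ^ k / fact k) = Complex (1 - t\<^sup>2 / 2) (t - t ^ 3 / 6)"
    by (simp add: numeral_3_eq_3 numeral_2_eq_2 fact_numeral complex_eq_iff power_mult_distrib fact_reduce)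
  ultimately have "cmod (iexp t - Complex (1 - t\<^sup>2 / 2) (t - t ^ 3 / 6)) \<le> \<bar>t\<bar> ^ 4 / 24"
    by (simp only:) (simp add: fact_numeral)
  then have "\<bar>Re (iexp t - Complex (1 - t\<^sup>2 / 2) (t - t ^ 3 / 6))\<bar> \<le> \<bar>t\<bar> ^ 4 / 24"
    by (rule order.trans[OF abs_Re_le_cmod])
  then have c: "\<bar>cos t - (1 - t\<^sup>2 / 2)\<bar> \<le> (t\<^sup>2)\<^sup>2 / 24" by (simp add: Re_exp)
  have "t\<^sup>2 \<le> pi\<^sup>2" using assms by (metis abs_of_nonneg abs_le_square_iff pi_ge_zero)
  then have "t\<^sup>2 * t\<^sup>2 \<le> 10 * t\<^sup>2" using pi_sq_le by (intro mult_right_mono) auto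
  then have "(t\<^sup>2)\<^sup>2 \<le> 10 * t\<^sup>2" by (simp only: power2_eq_square[of "t\<^sup>2"])
  then show ?thesis using c by linarith
qed

text \<open>Third order Taylor estimate for a centred Bernoulli variable of variance
  \<open>p * (1 - p)\<close>. Keeping this factor in the error makes the errors sum to
  \<open>B n\<close>.\<close>

lemma bern_char_approx:
  assumes p: "0 \<le> p" "p \<le> 1" and t: "\<bar>t\<bar> \<le> pi"
  shows "cmod (iexp (- (t * p)) * bern_char p t - exp (- (p * (1 - p) * t\<^sup>2 / 2))) \<le> p * (1 - p) * \<bar>t\<bar> ^ 3"
proof -
  define T where "T x = 1 + \<i> * complex_of_real x - (complex_of_real x)\<^sup>2 / 2" for x
  have T: "cmod (iexp x - T x) \<le> \<bar>x\<bar> ^ 3 / 6" for x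
  proof -
    have "(\<Sum>k\<le>2. (\<i> * x) ^ k / fact k) = T x"
      by (simp add: T_def numeral_2_eq_2 power_mult_distrib)
    then show ?thesis using iexp_approx1[of x 2] by (simp add: fact_numeral)
  qed
  define s where "s = p * (1 - p)"
  have s: "0 \<le> s" "s \<le> 1/4"
  proof -
    show "0 \<le> s" using p by (simp add: s_def)
    have "0 \<le> (p - 1/2)\<^sup>2" by simp
    then show "s \<le> 1/4" by (simp add: s_def power2_eq_square algebra_simps)
  qed
  define r where "r = 1 - p"
  have r: "0 \<le> r" using p by (simp add: r_def)
  have e1: "iexp (- (t * p)) * bern_char p t = of_real r * iexp (- (t * p)) + of_real p * iexp (t * (1 - p))"
  proof -
    have "iexp (- (t * p)) * iexp t = iexp (t * (1 - p))"
      unfolding exp_add[symmetric] by (simp add: algebra_simps)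
    then show ?thesis by (simp add: bern_char_def r_def algebra_simps)
  qed
  \<comment> \<open>The mean is zero, so the linear terms cancel, and the quadratic ones add up to
    the variance \<open>s\<close>.\<close>
  have e2: "of_real r * T (- (t * p)) + of_real p * T (t * (1 - p)) = 1 - s * t\<^sup>2 / 2"
    by (simp add: T_def s_def r_def power2_eq_square algebra_simps) (simp add: field_simps)
  have "cmod ((of_real r * iexp (- (t * p)) + of_real p * iexp (t * (1 - p))) - (of_real r * T (- (t * p)) + of_real p * T (t * (1 - p))))
    = cmod (of_real r * (iexp (- (t * p)) - T (- (t * p))) + of_real p * (iexp (t * (1 - p)) - T (t * (1 - p))))"
    by (simp only: right_diff_distrib add_diff_add)
  also have "\<dots> \<le> cmod (of_real r * (iexp (- (t * p)) - T (- (t * p)))) + cmod (of_real p * (iexp (t * (1 - p)) - T (t * (1 - p))))"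
    by (rule norm_triangle_ineq)
  also have "\<dots> = (1 - p) * cmod (iexp (- (t * p)) - T (- (t * p))) + p * cmod (iexp (t * (1 - p)) - T (t * (1 - p)))"
    using p r by (simp only: norm_mult norm_of_real abs_of_nonneg r_def)
  also have "\<dots> \<le> (1 - p) * (\<bar>- (t * p)\<bar> ^ 3 / 6) + p * (\<bar>t * (1 - p)\<bar> ^ 3 / 6)"
    using p by (intro add_mono mult_left_mono T) auto
  also have "\<dots> = s * (\<bar>t\<bar> ^ 3 / 6) * (p\<^sup>2 + (1 - p)\<^sup>2)"
  proof -
    have "\<bar>- (t * p)\<bar> = \<bar>t\<bar> * p" "\<bar>t * (1 - p)\<bar> = \<bar>t\<bar> * (1 - p)" using p by (simp_all add: abs_mult)
    moreover have "(1 - p) * ((a * p) ^ 3 / 6) + p * ((a * (1 - p)) ^ 3 / 6) = s * (a ^ 3 / 6) * (p\<^sup>2 + (1 - p)\<^sup>2)" for a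
      by (simp add: s_def power2_eq_square power3_eq_cube field_simps)
    ultimately show ?thesis by (simp only:)
  qed
  also have "\<dots> \<le> s * (\<bar>t\<bar> ^ 3 / 6) * 1"
  proof (rule mult_left_mono)
    have "p\<^sup>2 + (1 - p)\<^sup>2 = 1 - 2 * s" by (simp add: s_def power2_eq_square algebra_simps)
    then show "p\<^sup>2 + (1 - p)\<^sup>2 \<le> 1" using s by simp
  qed (use s in simp)
  finally have d1: "cmod (iexp (- (t * p)) * bern_char p t - (1 - s * t\<^sup>2 / 2)) \<le> s * \<bar>t\<bar> ^ 3 / 6"
    unfolding e1 e2 by simp
  have d2: "\<bar>exp (- y) - (1 - y)\<bar> \<le> y\<^sup>2 / 2" if "y \<ge> 0" for y :: real
  proof -
    have "exp (- y) \<ge> 1 - y" using exp_ge_add_one_self[of "- y"] by simp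
    moreover have "exp (- y) \<le> 1 - y + y\<^sup>2 / 2"
    proof (cases "y = 0")
      case False
      then obtain u where "exp (- y) = (\<Sum>m<3. (- y) ^ m / fact m) + exp u / fact 3 * (- y) ^ 3"
        using Maclaurin_exp_le[of "- y" 3] by blast
      then have "exp (- y) = 1 - y + y\<^sup>2 / 2 - exp u / 6 * y ^ 3"
        by (simp add: numeral_3_eq_3 fact_numeral fact_reduce power2_eq_square)
      then show ?thesis using that by (simp add: zero_le_mult_iff)
    qed simp
    ultimately show ?thesis by simp
  qed
  have "\<bar>exp (- (s * t\<^sup>2 / 2)) - (1 - s * t\<^sup>2 / 2)\<bar> \<le> (s * t\<^sup>2 / 2)\<^sup>2 / 2"
    by (rule d2) (use s in simp)
  also have "(s * t\<^sup>2 / 2)\<^sup>2 / 2 = s * \<bar>t\<bar> ^ 3 * (s * \<bar>t\<bar> / 8)"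
  proof -
    have "(s * (\<bar>t\<bar>)\<^sup>2 / 2)\<^sup>2 / 2 = s * \<bar>t\<bar> ^ 3 * (s * \<bar>t\<bar> / 8)"
      by (simp add: power2_eq_square power3_eq_cube del: abs_mult_self_eq)
    then show ?thesis by (simp only: power2_abs)
  qed
  also have "\<dots> \<le> s * \<bar>t\<bar> ^ 3 * (1/2)"
  proof (rule mult_left_mono)
    have "s * \<bar>t\<bar> \<le> 1/4 * 4" using s t pi_less_4 by (intro mult_mono) auto
    then show "s * \<bar>t\<bar> / 8 \<le> 1/2" by simp
  qed (use s in simp)
  finally have "cmod (of_real (exp (- (s * t\<^sup>2 / 2)) - (1 - s * t\<^sup>2 / 2))) \<le> s * \<bar>t\<bar> ^ 3 / 2"
    unfolding norm_of_real by simp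
  then have "cmod ((1 - s * t\<^sup>2 / 2) - complex_of_real (exp (- (s * t\<^sup>2 / 2)))) \<le> s * \<bar>t\<bar> ^ 3 / 2"
    by (simp add: norm_minus_commute)
  then have "cmod (iexp (- (t * p)) * bern_char p t - complex_of_real (exp (- (s * t\<^sup>2 / 2)))) \<le>
    s * \<bar>t\<bar> ^ 3 / 6 + s * \<bar>t\<bar> ^ 3 / 2"
    using d1 norm_triangle_mono norm_diff_triangle_le by blast
  also have "\<dots> \<le> s * \<bar>t\<bar> ^ 3" using s by (simp add: mult_nonneg_nonneg)
  finally show ?thesis by (simp add: s_def exp_of_real)
qed

text \<open>Telescoping. Each term loses the decay of the one factor that is replaced; as
  \<open>u j \<le> 1\<close>, this costs at most \<open>exp 1\<close>.\<close>

lemma prod_diff_le: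
  fixes a b :: "nat \<Rightarrow> complex"
  assumes "\<And>j. j < n \<Longrightarrow> cmod (a j) \<le> exp (- u j)" "\<And>j. j < n \<Longrightarrow> cmod (b j) \<le> exp (- u j)"
    and "\<And>j. j < n \<Longrightarrow> cmod (a j - b j) \<le> d j" and "\<And>j. j < n \<Longrightarrow> u j \<le> 1"
  shows "cmod ((\<Prod>j<n. a j) - (\<Prod>j<n. b j)) \<le> exp 1 * (\<Sum>j<n. d j) * exp (- (\<Sum>j<n. u j))"
  using assms
proof (induction n)
  case (Suc n)
  define P Q U D where "P = (\<Prod>j<n. a j)" "Q = (\<Prod>j<n. b j)" "U = (\<Sum>j<n. u j)" "D = (\<Sum>j<n. d j)"
  note defs = P_Q_U_D_def
  have IH: "cmod (P - Q) \<le> exp 1 * D * exp (- U)" unfolding defs by (rule Suc.IH) (use Suc.prems in auto)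
  have P: "cmod P \<le> exp (- U)"
  proof -
    have "cmod P \<le> (\<Prod>j<n. exp (- u j))"
      unfolding defs prod_norm[symmetric] by (intro prod_mono) (use Suc.prems(1) in auto)
    then show ?thesis by (simp add: defs exp_sum sum_negf[symmetric])
  qed
  have dn: "0 \<le> d n" using Suc.prems(3)[of n] norm_ge_zero order.trans by blast
  have "cmod (P * a n - Q * b n) = cmod (P * (a n - b n) + (P - Q) * b n)" by (simp add: algebra_simps)
  also have "\<dots> \<le> cmod P * cmod (a n - b n) + cmod (P - Q) * cmod (b n)"
    using norm_triangle_ineq by (metis norm_mult)
  also have "\<dots> \<le> exp (- U) * d n + (exp 1 * D * exp (- U)) * exp (- u n)"
    by (intro add_mono mult_mono P IH) (use Suc.prems dn order.trans[OF norm_ge_zero IH] in auto)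
  also have "exp (- U) * d n \<le> exp (- U) * d n * exp (1 - u n)"
  proof -
    have "1 \<le> exp (1 - u n)" using Suc.prems(4)[of n] by simp
    then have "exp (- U) * d n * 1 \<le> exp (- U) * d n * exp (1 - u n)"
      using dn by (intro mult_left_mono) auto
    then show ?thesis by simp
  qed
  also have "exp (- U) * d n * exp (1 - u n) + (exp 1 * D * exp (- U)) * exp (- u n)
    = exp 1 * (D + d n) * exp (- (U + u n))"
    by (simp add: exp_diff exp_minus exp_add field_simps)
  finally show ?case by (simp add: defs)
qed simp

text \<open>The decay comes from \<open>one_minus_cos_ge\<close>, hence the 12, and the 3 bounds
  \<open>exp 1\<close>. Retaining the decay in the error keeps it integrable after
  rescaling.\<close>

lemma cyc_char_approx:
  assumes t: "\<bar>t\<bar> \<le> pi"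
  shows "cmod (iexp (- (t * A n)) * cyc_char n t - exp (- (B n * t\<^sup>2 / 2))) \<le>
    3 * (B n * \<bar>t\<bar> ^ 3) * exp (- (B n * t\<^sup>2 / 12))"
proof -
  define p where "p j = 1 / real (Suc j)" for j
  define s where "s j = p j * (1 - p j)" for j
  have p: "0 \<le> p j" "p j \<le> 1" for j by (simp_all add: p_def)
  have s: "0 \<le> s j" "s j \<le> 1/4" for j
  proof -
    show "0 \<le> s j" using p[of j] by (simp add: s_def)
    have "0 \<le> (p j - 1/2)\<^sup>2" by simp
    then show "s j \<le> 1/4" by (simp add: s_def power2_eq_square algebra_simps)
  qed
  have Bs: "B n = (\<Sum>j<n. s j)" by (simp add: B_sum s_def p_def)
  have As: "A n = (\<Sum>j<n. p j)" by (simp add: A_sum p_def)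
  have t2: "t\<^sup>2 \<le> 10"
    using power_mono[of "\<bar>t\<bar>" pi 2] t pi_sq_le by simp
  have a: "iexp (- (t * A n)) * cyc_char n t = (\<Prod>j<n. iexp (- (t * p j)) * bern_char (p j) t)"
  proof -
    have "iexp (- (t * A n)) = (\<Prod>j<n. iexp (- (t * p j)))"
      unfolding As by (simp add: exp_sum[symmetric] sum_negf sum_distrib_left)
    then show ?thesis by (simp add: cyc_char_prod p_def prod.distrib)
  qed
  have b: "exp (- (B n * t\<^sup>2 / 2)) = (\<Prod>j<n. complex_of_real (exp (- (s j * t\<^sup>2 / 2))))"
    unfolding Bs of_real_prod[symmetric] by (simp add: exp_sum[symmetric] sum_negf sum_distrib_right sum_divide_distrib exp_of_real)
  have "cmod ((\<Prod>j<n. iexp (- (t * p j)) * bern_char (p j) t) - (\<Prod>j<n. complex_of_real (exp (- (s j * t\<^sup>2 / 2)))))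
    \<le> exp 1 * (\<Sum>j<n. s j * \<bar>t\<bar> ^ 3) * exp (- (\<Sum>j<n. s j * t\<^sup>2 / 12))"
  proof (rule prod_diff_le)
    fix j
    have "cmod (iexp (- (t * p j)) * bern_char (p j) t) = cmod (bern_char (p j) t)"
      by (simp add: norm_mult)
    also have "\<dots> \<le> exp (- (s j * (1 - cos t)))" unfolding s_def by (rule norm_bern_char_le) (rule p)+
    also have "\<dots> \<le> exp (- (s j * t\<^sup>2 / 12))"
      using mult_left_mono[OF one_minus_cos_ge[OF t] s(1)[of j]] by simp
    finally show "cmod (iexp (- (t * p j)) * bern_char (p j) t) \<le> exp (- (s j * t\<^sup>2 / 12))" .
    show "cmod (complex_of_real (exp (- (s j * t\<^sup>2 / 2)))) \<le> exp (- (s j * t\<^sup>2 / 12))"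
      using s(1)[of j] by (simp add: mult_nonneg_nonneg)
    show "cmod (iexp (- (t * p j)) * bern_char (p j) t - complex_of_real (exp (- (s j * t\<^sup>2 / 2)))) \<le> s j * \<bar>t\<bar> ^ 3"
      using bern_char_approx[OF p t, of j] by (simp add: s_def exp_of_real)
    have "s j * t\<^sup>2 \<le> 1/4 * 10" using s t2 by (intro mult_mono) auto
    then show "s j * t\<^sup>2 / 12 \<le> 1" by simp
  qed
  also have "\<dots> = exp 1 * (B n * \<bar>t\<bar> ^ 3 * exp (- (B n * t\<^sup>2 / 12)))"
    by (simp add: Bs sum_distrib_right sum_divide_distrib)
  also have "\<dots> \<le> 3 * (B n * \<bar>t\<bar> ^ 3 * exp (- (B n * t\<^sup>2 / 12)))"
    by (rule mult_right_mono) (use exp_le s in \<open>auto simp: Bs intro!: mult_nonneg_nonneg sum_nonneg\<close>)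
  finally show ?thesis unfolding a b by simp
qed

section \<open>Local limit theorem for the cycle count\<close>

lemma has_integral_iexp_period:
  fixes k :: int
  shows "has_bochner_integral lborel (\<lambda>t. indicator {-pi..pi} t *\<^sub>R iexp (t * of_int k)) (if k = 0 then complex_of_real (2 * pi) else 0)"
proof (cases "k = 0")
  case True
  have "has_bochner_integral lborel (\<lambda>t. indicator {-pi..pi} t *\<^sub>R (1::complex)) (of_real pi - of_real (- pi))"
    by (rule has_bochner_integral_FTC_Icc) (auto intro!: derivative_eq_intros continuous_intros)
  then show ?thesis using True by simp
next
  case False
  define F where "F t = iexp (t * of_int k) / (\<i> * of_int k)" for t :: real
  have "has_bochner_integral lborel (\<lambda>t. indicator {-pi..pi} t *\<^sub>R iexp (t * of_int k)) (F pi - F (- pi))"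
  proof (rule has_bochner_integral_FTC_Icc)
    fix t assume "- pi \<le> t" "t \<le> pi"
    have "((\<lambda>t. iexp (t * of_int k)) has_vector_derivative (\<i> * of_int k) * iexp (t * of_int k)) (at t within {-pi..pi})"
    proof -
      have "((\<lambda>z. exp (\<i> * of_int k * z)) has_field_derivative (\<i> * of_int k) * exp (\<i> * of_int k * of_real t)) (at (of_real t))"
        by (auto intro!: derivative_eq_intros)
      then have "((\<lambda>t. exp (\<i> * of_int k * of_real t)) has_vector_derivative (\<i> * of_int k) * exp (\<i> * of_int k * of_real t)) (at t within {-pi..pi})"
        by (rule has_vector_derivative_real_field)
      then show ?thesis by (simp add: mult_ac)
    qed
    then have "((\<lambda>t. iexp (t * of_int k) / (\<i> * of_int k)) has_vector_derivative
      ((\<i> * of_int k) * iexp (t * of_int k)) / (\<i> * of_int k)) (at t within {-pi..pi})"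
      by (rule has_vector_derivative_divide)
    then show "(F has_vector_derivative iexp (t * of_int k)) (at t within {-pi..pi})"
      using False unfolding F_def by simp
  qed (auto intro!: continuous_intros)
  moreover have "F pi - F (- pi) = 0"
  proof -
    have "sin (pi * of_int k) = 0" unfolding sin_zero_iff_int2 by (intro exI[of _ k]) (simp add: mult.commute)
    then have "iexp (pi * of_int k) = iexp (- (pi * of_int k))"
      by (simp add: complex_eq_iff Re_exp Im_exp)
    then show ?thesis by (simp add: F_def)
  qed
  ultimately show ?thesis using False by simp
qed

lemma cyc_prob_fourier:
  "has_bochner_integral lborel (\<lambda>t. indicator {-pi..pi} t *\<^sub>R (cyc_char n t * iexp (- (t * real v))))
    (complex_of_real (2 * pi * cyc_prob n v))"
proof -
  have e: "indicator {-pi..pi} t *\<^sub>R (cyc_char n t * iexp (- (t * real v))) =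
    (\<Sum>w\<le>n. cyc_prob n w *\<^sub>R (indicator {-pi..pi} t *\<^sub>R iexp (t * of_int (int w - int v))))" for t :: real
  proof -
    have x: "iexp (t * real w) * iexp (- (t * real v)) = iexp (t * of_int (int w - int v))" for w
      unfolding exp_add[symmetric] by (simp add: algebra_simps)
    have "cyc_char n t * iexp (- (t * real v)) = (\<Sum>w\<le>n. cyc_prob n w *\<^sub>R iexp (t * of_int (int w - int v)))"
      unfolding cyc_char_def cyc_mean_def sum_distrib_right mult_scaleR_left x ..
    then show ?thesis by (simp only: scaleR_sum_right scaleR_left_commute)
  qed
  have "has_bochner_integral lborel
    (\<lambda>t. \<Sum>w\<le>n. cyc_prob n w *\<^sub>R (indicator {-pi..pi} t *\<^sub>R iexp (t * of_int (int w - int v))))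
    (\<Sum>w\<le>n. cyc_prob n w *\<^sub>R (if int w - int v = 0 then complex_of_real (2 * pi) else 0))"
    by (intro has_bochner_integral_sum has_bochner_integral_scaleR_right has_integral_iexp_period)
  moreover have "(\<Sum>w\<le>n. cyc_prob n w *\<^sub>R (if int w - int v = 0 then complex_of_real (2 * pi) else 0)) =
    complex_of_real (2 * pi * cyc_prob n v)"
  proof (cases "v \<le> n")
    case True
    have "(\<Sum>w\<le>n. cyc_prob n w *\<^sub>R (if int w - int v = 0 then complex_of_real (2 * pi) else 0)) =
      (\<Sum>w\<le>n. if w = v then complex_of_real (2 * pi * cyc_prob n v) else 0)"
      by (intro sum.cong refl) (auto simp: scaleR_conv_of_real)
    then show ?thesis using True by simp
  next
    case False
    then show ?thesis by (auto simp: cyc_prob_eq_0 intro!: sum.neutral)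
  qed
  ultimately show ?thesis unfolding e by simp
qed

lemma gauss_fourier:
  "has_bochner_integral lborel (\<lambda>s. exp (- (s\<^sup>2 / 2)) *\<^sub>R iexp (- (s * x)))
    (complex_of_real (sqrt (2 * pi) * exp (- (x\<^sup>2 / 2))))"
proof -
  interpret real_distribution std_normal_distribution by (rule real_dist_normal_dist)
  have int: "integrable std_normal_distribution (\<lambda>s. iexp (- x * s))"
    by (rule integrable_iexp) auto
  have i1: "integrable lborel (\<lambda>s. std_normal_density s *\<^sub>R iexp (- x * s))"
    using int by (subst (asm) integrable_density) (auto simp: normal_density_nonneg)
  have "char std_normal_distribution (- x) = (\<integral>s. std_normal_density s *\<^sub>R iexp (- x * s) \<partial>lborel)"
    unfolding char_def by (subst integral_density) (auto simp: normal_density_nonneg)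
  then have i2: "(\<integral>s. std_normal_density s *\<^sub>R iexp (- x * s) \<partial>lborel) = complex_of_real (exp (- (x\<^sup>2 / 2)))"
    by (simp add: char_std_normal_distribution)
  have "has_bochner_integral lborel (\<lambda>s. std_normal_density s *\<^sub>R iexp (- x * s)) (complex_of_real (exp (- (x\<^sup>2 / 2))))"
    using i1 i2 by (simp add: has_bochner_integral_iff)
  then have "has_bochner_integral lborel (\<lambda>s. sqrt (2 * pi) *\<^sub>R (std_normal_density s *\<^sub>R iexp (- x * s)))
    (sqrt (2 * pi) *\<^sub>R complex_of_real (exp (- (x\<^sup>2 / 2))))"
    by (intro has_bochner_integral_scaleR_right) auto
  moreover have "sqrt (2 * pi) *\<^sub>R (std_normal_density s *\<^sub>R iexp (- x * s)) = exp (- (s\<^sup>2 / 2)) *\<^sub>R iexp (- (s * x))" for s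
    by (simp add: std_normal_density_def mult.commute)
  ultimately show ?thesis by (simp add: scaleR_conv_of_real)
qed

text \<open>The term \<open>\<bar>s\<bar>\<close> absorbs the Gaussian tail outside the range of the Fourier integral.\<close>

definition llt_bound :: "real \<Rightarrow> real" where
  "llt_bound s = (3 * \<bar>s\<bar> ^ 3 + \<bar>s\<bar>) * exp (- (s\<^sup>2 / 12))"

lemma integrable_llt_bound: "integrable lborel llt_bound"
proof -
  have k: "integrable lborel (\<lambda>s::real. \<bar>s\<bar> ^ k * exp (- (s\<^sup>2 / 12)))" for k
  proof -
    \<comment> \<open>Scaling by \<open>1 / sqrt 6\<close> turns the exponent \<open>s^2 / 2\<close>
      into \<open>s^2 / 12\<close>, so this is an absolute moment of the normal law.\<close>
    have "integrable lborel (\<lambda>s. std_normal_density (0 + (1 / sqrt 6) * s) * \<bar>0 + (1 / sqrt 6) * s\<bar> ^ k)"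
      by (rule lborel_integrable_real_affine[OF integrable_std_normal_moment_abs]) simp
    then have "integrable lborel (\<lambda>s. (sqrt (2 * pi) * sqrt 6 ^ k) *
      (std_normal_density (0 + (1 / sqrt 6) * s) * \<bar>0 + (1 / sqrt 6) * s\<bar> ^ k))"
      by (rule integrable_mult_right)
    moreover have "(sqrt (2 * pi) * sqrt 6 ^ k) *
      (std_normal_density (0 + (1 / sqrt 6) * s) * \<bar>0 + (1 / sqrt 6) * s\<bar> ^ k) = \<bar>s\<bar> ^ k * exp (- (s\<^sup>2 / 12))" for s
      by (simp add: std_normal_density_def abs_mult power_divide power_mult_distrib field_simps)
    ultimately show ?thesis by (simp only:)
  qed
  have "integrable lborel (\<lambda>s::real. 3 * (\<bar>s\<bar> ^ 3 * exp (- (s\<^sup>2 / 12))) + \<bar>s\<bar> ^ 1 * exp (- (s\<^sup>2 / 12)))"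
    by (intro Bochner_Integration.integrable_add integrable_mult_right k)
  then show ?thesis unfolding llt_bound_def[abs_def] by (simp add: algebra_simps)
qed

text \<open>Fourier inversion with \<open>t = s / b\<close>: then \<open>B n * t^2 = s^2\<close>,
  and the error \<open>B n * \<bar>t\<bar>^3\<close> becomes \<open>\<bar>s\<bar>^3 / b\<close>. So
  the integrands differ by a fixed integrable function over \<open>b\<close>, uniformly in
  \<open>v\<close>.\<close>

lemma cyc_prob_llt:
  assumes B: "B n > 0"
  defines "b \<equiv> sqrt (B n)"
  shows "\<bar>2 * pi * b * cyc_prob n v - sqrt (2 * pi) * exp (- (((real v - A n) / b)\<^sup>2 / 2))\<bar>
    \<le> (\<integral>s. llt_bound s \<partial>lborel) / b"
proof -
  have b: "b > 0" "b\<^sup>2 = B n" using B by (simp_all add: b_def)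
  define x where "x = (real v - A n) / b"
  have v: "real v = A n + b * x" using b by (simp add: x_def)
  define f where "f t = indicator {-pi..pi} t *\<^sub>R (cyc_char n t * iexp (- (t * real v)))" for t :: real
  define h where "h s = f (0 + (1 / b) * s)" for s
  define g where "g s = exp (- (s\<^sup>2 / 2)) *\<^sub>R iexp (- (s * x))" for s :: real
  have "has_bochner_integral lborel h ((complex_of_real (2 * pi * cyc_prob n v)) /\<^sub>R \<bar>1 / b\<bar>)"
    unfolding h_def
  proof (rule lborel_has_bochner_integral_real_affine_iff[THEN iffD1])
    show "has_bochner_integral lborel f (complex_of_real (2 * pi * cyc_prob n v))"
      unfolding f_def[abs_def] by (rule cyc_prob_fourier)
  qed (use b in simp)
  then have h: "has_bochner_integral lborel h (complex_of_real (2 * pi * b * cyc_prob n v))"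
    using b by (simp add: scaleR_conv_of_real mult_ac)
  have g: "has_bochner_integral lborel g (complex_of_real (sqrt (2 * pi) * exp (- (x\<^sup>2 / 2))))"
    unfolding g_def by (rule gauss_fourier)
  have d: "has_bochner_integral lborel (\<lambda>s. h s - g s)
    (complex_of_real (2 * pi * b * cyc_prob n v) - complex_of_real (sqrt (2 * pi) * exp (- (x\<^sup>2 / 2))))"
    by (rule has_bochner_integral_diff[OF h g])
  have bound: "norm (h s - g s) \<le> llt_bound s / b" for s
  proof (cases "\<bar>s / b\<bar> \<le> pi")
    case True
    then have "s / b \<le> pi" "- pi \<le> s / b" by linarith+
    then have ind: "indicator {-pi..pi} (0 + (1 / b) * s) = (1::real)" by simp
    define t where "t = s / b"
    have "iexp (- (t * real v)) = iexp (- (t * A n)) * iexp (- (s * x))"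
      unfolding exp_add[symmetric] v using b by (simp add: t_def algebra_simps)
    then have hs: "h s = iexp (- (t * A n)) * cyc_char n t * iexp (- (s * x))"
      unfolding h_def f_def ind by (simp add: t_def mult_ac)
    have Bt: "B n * t\<^sup>2 = s\<^sup>2" using b by (simp add: t_def power_divide flip: b(2))
    have gs: "g s = complex_of_real (exp (- (B n * t\<^sup>2 / 2))) * iexp (- (s * x))"
      unfolding Bt by (simp add: g_def scaleR_conv_of_real)
    have "norm (h s - g s) = cmod ((iexp (- (t * A n)) * cyc_char n t - complex_of_real (exp (- (B n * t\<^sup>2 / 2)))) * iexp (- (s * x)))"
      unfolding hs gs by (simp add: left_diff_distrib)
    also have "\<dots> = cmod (iexp (- (t * A n)) * cyc_char n t - complex_of_real (exp (- (B n * t\<^sup>2 / 2))))"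
      by (simp add: norm_mult)
    also have "\<dots> \<le> 3 * (B n * \<bar>t\<bar> ^ 3) * exp (- (B n * t\<^sup>2 / 12))"
      using cyc_char_approx[of t n] True by (simp add: t_def exp_of_real)
    also have "3 * (B n * \<bar>t\<bar> ^ 3) * exp (- (B n * t\<^sup>2 / 12)) = 3 * \<bar>s\<bar> ^ 3 * exp (- (s\<^sup>2 / 12)) / b"
    proof -
      have "B n * \<bar>t\<bar> ^ 3 = \<bar>s\<bar> ^ 3 / b"
        using b by (simp add: t_def power_divide power2_eq_square power3_eq_cube flip: b(2))
      then show ?thesis unfolding Bt by simp
    qed
    also have "\<dots> \<le> llt_bound s / b"
      unfolding llt_bound_def using b by (intro divide_right_mono mult_right_mono) auto
    finally show ?thesis .
  next
    case False
    then have "s / b \<notin> {-pi..pi}" by auto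
    then have "h s = 0" by (simp add: h_def f_def)
    then have "norm (h s - g s) = exp (- (s\<^sup>2 / 2))" by (simp add: g_def)
    also have "\<dots> \<le> exp (- (s\<^sup>2 / 12))" by simp
    also have "\<dots> \<le> (\<bar>s\<bar> / b) * exp (- (s\<^sup>2 / 12))"
    proof -
      have "\<bar>s\<bar> / b = \<bar>s / b\<bar>" using b by (simp add: abs_divide)
      then have "1 \<le> \<bar>s\<bar> / b" using False pi_ge_two by linarith
      then have "1 * exp (- (s\<^sup>2 / 12)) \<le> (\<bar>s\<bar> / b) * exp (- (s\<^sup>2 / 12))" by (rule mult_right_mono) simp
      then show ?thesis by (simp only: mult_1)
    qed
    also have "\<dots> = \<bar>s\<bar> * exp (- (s\<^sup>2 / 12)) / b" by simp
    also have "\<dots> \<le> llt_bound s / b"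
      unfolding llt_bound_def using b by (intro divide_right_mono mult_right_mono) auto
    finally show ?thesis .
  qed
  have "cmod (complex_of_real (2 * pi * b * cyc_prob n v) - complex_of_real (sqrt (2 * pi) * exp (- (x\<^sup>2 / 2))))
    = norm (\<integral>s. h s - g s \<partial>lborel)"
    using d by (simp add: has_bochner_integral_iff)
  also have "\<dots> \<le> (\<integral>s. llt_bound s / b \<partial>lborel)"
    by (rule Bochner_Integration.integral_norm_bound_integral)
      (use d bound integrable_llt_bound in \<open>auto simp: has_bochner_integral_iff\<close>)
  also have "\<dots> = (\<integral>s. llt_bound s \<partial>lborel) / b" by simp
  finally show ?thesis unfolding x_def of_real_diff[symmetric] norm_of_real .
qed

section \<open>The genus\<close>

lemma contents_column: "contents s (replicate n 1) = map (\<lambda>j. s - int j) [0..<n]"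
proof (induction n arbitrary: s)
  case (Suc n)
  have "[0..<Suc n] = 0 # map Suc [0..<n]" by (simp add: map_Suc_upt upt_conv_Cons)
  then show ?case using Suc[of "s - 1"] by (simp add: o_def algebra_simps)
qed simp

lemma coeff_linear_mult:
  "coeff (p * [:c, 1:]) v = (c::real) * coeff p v + (case v of 0 \<Rightarrow> 0 | Suc w \<Rightarrow> coeff p w)"
  by (cases v) (simp_all add: mult.commute[of p] coeff_pCons)

lemma coeff_row: "coeff (content_poly [n]) v = fact n * cyc_prob n v"
proof -
  have "coeff (\<Prod>j\<leftarrow>[0..<n]. [:real j, 1:]) v = fact n * cyc_prob n v"
  proof (induction n arbitrary: v)
    case (Suc n)
    have "coeff (\<Prod>j\<leftarrow>[0..<Suc n]. [:real j, 1:]) v = coeff ((\<Prod>j\<leftarrow>[0..<n]. [:real j, 1:]) * [:real n, 1:]) v"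
      by simp
    also have "\<dots> = fact n * (real n * cyc_prob n v + (case v of 0 \<Rightarrow> 0 | Suc w \<Rightarrow> cyc_prob n w))"
      unfolding coeff_linear_mult Suc by (simp add: algebra_simps split: nat.split)
    also have "\<dots> = fact (Suc n) * cyc_prob (Suc n) v" by simp
    finally show ?case .
  qed (simp add: coeff_pCons split: nat.split)
  then show ?thesis by (simp add: content_poly_def o_def)
qed

text \<open>The falling factorial has the coefficients of the rising one with alternating signs. Row
  and column together give the factor \<open>1 + (- 1) ^ (n + v)\<close>: 2 at the parity that a
  commutator, being even, allows, and 0 at the other.\<close>

lemma coeff_column: "coeff (content_poly (replicate n 1)) v = (- 1) ^ (n + v) * (fact n * cyc_prob n v)"
proof -
  have "coeff (\<Prod>j\<leftarrow>[0..<n]. [:- real j, 1:]) v = (- 1) ^ (n + v) * (fact n * cyc_prob n v)"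
  proof (induction n arbitrary: v)
    case 0
    show ?case by (cases v) simp_all
  next
    case (Suc n)
    have "coeff (\<Prod>j\<leftarrow>[0..<Suc n]. [:- real j, 1:]) v = coeff ((\<Prod>j\<leftarrow>[0..<n]. [:- real j, 1:]) * [:- real n, 1:]) v"
      by simp
    also have "\<dots> = (- 1) ^ (Suc n + v) * (fact n * (real n * cyc_prob n v + (case v of 0 \<Rightarrow> 0 | Suc w \<Rightarrow> cyc_prob n w)))"
      unfolding coeff_linear_mult Suc by (simp add: algebra_simps split: nat.split)
    also have "\<dots> = (- 1) ^ (Suc n + v) * (fact (Suc n) * cyc_prob (Suc n) v)" by simp
    finally show ?case .
  qed
  then show ?thesis unfolding content_poly_def contents_column by (simp add: o_def)
qed

section \<open>The law of the cycle count of the commutator\<close>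

lemma set_unif_pairs: "finite (sym_group n \<times> sym_group n)" "sym_group n \<times> sym_group n \<noteq> {}"
  using finite_permutations[of "{1..n}"] permutes_id[of "{1..n}"] by (auto simp: sym_group_def intro!: exI[of _ id])

lemma card_unif_pairs: "real (card (sym_group n \<times> sym_group n)) = (fact n)\<^sup>2"
  using card_permutations[of "{1..n}" n] by (simp add: sym_group_def card_cartesian_product power2_eq_square)

definition comm_cycles :: "nat \<Rightarrow> (nat \<Rightarrow> nat) \<times> (nat \<Rightarrow> nat) \<Rightarrow> nat" where
  "comm_cycles n \<omega> = ncyc {1..n} (commutator (fst \<omega>) (snd \<omega>))"

definition comm_prob :: "nat \<Rightarrow> nat \<Rightarrow> real" where
  "comm_prob n v = measure_pmf.prob (unif_pairs n) {\<omega>. comm_cycles n \<omega> = v}"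

definition comm_rem :: "nat \<Rightarrow> nat \<Rightarrow> real" where
  "comm_rem n v = comm_prob n v - (1 + (- 1) ^ (n + v)) * cyc_prob n v"

lemma comm_prob_card:
  "comm_prob n v = real (card {\<omega> \<in> sym_group n \<times> sym_group n. comm_cycles n \<omega> = v}) / (fact n)\<^sup>2"
  unfolding comm_prob_def unif_pairs_def
  using set_unif_pairs by (simp add: measure_pmf_of_set card_unif_pairs Int_def)

text \<open>The remainder is the coefficient sum over \<open>L\<close> without row and column,
  divided by \<open>fact n\<close>. Only \<open>L \<subseteq> partitions n\<close> is known, so
  absolute values are taken and all partitions are summed.\<close>

lemma comm_rem_bound:
  "\<exists>C\<ge>0. \<forall>n\<ge>2. \<forall>N. (\<Sum>v\<le>N. \<bar>comm_rem n v\<bar> * (3/2) ^ v) \<le> C / sqrt n"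
proof -
  obtain C where C: "C \<ge> 0" "\<And>n. n \<ge> 2 \<Longrightarrow>
    (\<Sum>l\<in>partitions n - {[n], replicate n 1}. content_weight (3/2) l) \<le> C * fact n / sqrt n"
    using nontrivial_weight_bound by blast
  have "(\<Sum>v\<le>N. \<bar>comm_rem n v\<bar> * (3/2) ^ v) \<le> C / sqrt n" if n: "n \<ge> 2" for n N
  proof -
    have ne: "finite {1..n}" "{1..n} \<noteq> {}" using n by auto
    obtain L where L: "L \<subseteq> partitions (card {1..n})" "[card {1..n}] \<in> L" "replicate (card {1..n}) 1 \<in> L"
      "\<And>v. real (card {(\<sigma>, \<tau>). \<sigma> permutes {1..n} \<and> \<tau> permutes {1..n} \<and> ncyc {1..n} (commutator \<sigma> \<tau>) = v}) =
        fact (card {1..n}) * (\<Sum>l\<in>L. coeff (content_poly l) v)"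
      by (rule commutator_cycle_count[OF ne]) (rule that; assumption)
    have cn: "card {1..n} = n" by simp
    note L = L[unfolded cn]
    define L' where "L' = L - {[n], replicate n 1}"
    have finL: "finite L" using L(1) finite_partitions finite_subset by blast
    \<comment> \<open>For a single point row and column coincide; from \<open>n = 2\<close> on they
      are two terms of the sum.\<close>
    have neq: "[n] \<noteq> replicate n 1"
    proof
      assume "[n] = replicate n 1"
      then have "length [n] = length (replicate n (1::nat))" by (rule arg_cong)
      then show False using n by simp
    qed
    have rem: "comm_rem n v = (\<Sum>l\<in>L'. coeff (content_poly l) v) / fact n" for v
    proof -
      have eqL: "L = insert [n] (insert (replicate n 1) L')" using L(2,3) by (auto simp: L'_def)
      have nin: "[n] \<notin> insert (replicate n 1) L'" "replicate n 1 \<notin> L'" "finite L'"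
        using neq finL by (auto simp: L'_def)
      have "(\<Sum>l\<in>L. coeff (content_poly l) v) =
        coeff (content_poly [n]) v + (coeff (content_poly (replicate n 1)) v + (\<Sum>l\<in>L'. coeff (content_poly l) v))"
        unfolding eqL using nin by (simp only: sum.insert finite_insert simp_thms)
      also have "\<dots> = (1 + (- 1) ^ (n + v)) * (fact n * cyc_prob n v) + (\<Sum>l\<in>L'. coeff (content_poly l) v)"
        unfolding coeff_row coeff_column by (simp add: algebra_simps)
      finally have s: "(\<Sum>l\<in>L. coeff (content_poly l) v) =
        (1 + (- 1) ^ (n + v)) * (fact n * cyc_prob n v) + (\<Sum>l\<in>L'. coeff (content_poly l) v)" .
      have "{\<omega> \<in> sym_group n \<times> sym_group n. comm_cycles n \<omega> = v} =
        {(\<sigma>, \<tau>). \<sigma> permutes {1..n} \<and> \<tau> permutes {1..n} \<and> ncyc {1..n} (commutator \<sigma> \<tau>) = v}"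
        by (auto simp: sym_group_def comm_cycles_def)
      then have "comm_prob n v = fact n * (\<Sum>l\<in>L. coeff (content_poly l) v) / (fact n)\<^sup>2"
        unfolding comm_prob_card using L(4)[of v] by simp
      also have "\<dots> = (\<Sum>l\<in>L. coeff (content_poly l) v) / fact n" by (simp add: power2_eq_square)
      also have "\<dots> = (1 + (- 1) ^ (n + v)) * cyc_prob n v + (\<Sum>l\<in>L'. coeff (content_poly l) v) / fact n"
        unfolding s by (simp add: add_divide_distrib)
      finally show ?thesis by (simp add: comm_rem_def)
    qed
    have "(\<Sum>v\<le>N. \<bar>comm_rem n v\<bar> * (3/2) ^ v) \<le> (\<Sum>v\<le>N. (\<Sum>l\<in>L'. \<bar>coeff (content_poly l) v\<bar>) / fact n * (3/2) ^ v)"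
      unfolding rem abs_divide by (intro sum_mono mult_right_mono) (auto intro!: divide_right_mono sum_abs)
    also have "\<dots> = (\<Sum>v\<le>N. \<Sum>l\<in>L'. \<bar>coeff (content_poly l) v\<bar> * (3/2) ^ v) / fact n"
      by (simp add: sum_divide_distrib sum_distrib_right sum_distrib_left)
    also have "\<dots> = (\<Sum>l\<in>L'. \<Sum>v\<le>N. \<bar>coeff (content_poly l) v\<bar> * (3/2) ^ v) / fact n"
      by (subst sum.swap) (rule refl)
    also have "\<dots> \<le> (\<Sum>l\<in>L'. content_weight (3/2) l) / fact n"
      by (intro divide_right_mono sum_mono abs_coeff_content_poly_le) auto
    also have "\<dots> \<le> (\<Sum>l\<in>partitions n - {[n], replicate n 1}. content_weight (3/2) l) / fact n"
      using L(1) finite_partitions[of n]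
      by (intro divide_right_mono sum_mono2) (auto simp: L'_def intro!: content_weight_nonneg)
    also have "\<dots> \<le> (C * fact n / sqrt n) / fact n"
      by (intro divide_right_mono C(2) n) auto
    also have "\<dots> = C / sqrt n" by simp
    finally show ?thesis .
  qed
  then show ?thesis using C(1) by blast
qed

definition comm_mean :: "nat \<Rightarrow> (nat \<Rightarrow> 'a::real_vector) \<Rightarrow> 'a" where
  "comm_mean n F = (\<Sum>v\<le>n. comm_prob n v *\<^sub>R F v)"

lemma comm_mean_eq:
  "comm_mean n F = cyc_mean n F + sgn_mean n F + (\<Sum>v\<le>n. comm_rem n v *\<^sub>R F v)"
proof -
  have "comm_prob n v *\<^sub>R F v = cyc_prob n v *\<^sub>R F v + cyc_prob n v *\<^sub>R ((- 1) ^ (n + v) *\<^sub>R F v) + comm_rem n v *\<^sub>R F v" for v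
    by (simp add: comm_rem_def algebra_simps)
  then show ?thesis by (simp add: comm_mean_def cyc_mean_def sgn_mean_def sum.distrib)
qed

text \<open>One transfer rule for moments and characteristic functions: the Euler characteristic
  depends on the pair only through the cycle count.\<close>

lemma expectation_G:
  fixes H :: "real \<Rightarrow> 'a::{banach, second_countable_topology}"
  shows "(\<integral>\<omega>. H (G n \<omega>) \<partial>measure_pmf (unif_pairs n)) = comm_mean n (\<lambda>v. H (1 + real n / 2 - real v / 2))"
proof -
  let ?S = "sym_group n \<times> sym_group n"
  define F where "F v = H (1 + real n / 2 - real v / 2)" for v
  have HG: "H (G n \<omega>) = F (comm_cycles n \<omega>)" if \<omega>: "\<omega> \<in> ?S" for \<omega>
  proof -
    obtain \<sigma> \<tau> where st: "\<omega> = (\<sigma>, \<tau>)" "\<sigma> permutes {1..n}" "\<tau> permutes {1..n}"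
      using \<omega> by (auto simp: sym_group_def)
    have "G n \<omega> = 1 + real n / 2 - real (comm_cycles n \<omega>) / 2"
      using euler_char_eq[OF st(2,3)] by (simp add: G_def st(1) comm_cycles_def field_simps)
    then show ?thesis by (simp add: F_def)
  qed
  have le: "comm_cycles n \<omega> \<le> n" for \<omega>
    unfolding comm_cycles_def ncyc_def using card_image_le[of "{1..n}"] by fastforce
  have "(\<integral>\<omega>. H (G n \<omega>) \<partial>measure_pmf (unif_pairs n)) = (\<Sum>\<omega>\<in>?S. pmf (unif_pairs n) \<omega> *\<^sub>R H (G n \<omega>))"
    by (rule integral_measure_pmf) (use set_unif_pairs in \<open>auto simp: unif_pairs_def\<close>)
  also have "\<dots> = (\<Sum>\<omega>\<in>?S. (1 / (fact n)\<^sup>2) *\<^sub>R F (comm_cycles n \<omega>))"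
    by (intro sum.cong refl) (use set_unif_pairs card_unif_pairs HG in \<open>simp add: unif_pairs_def\<close>)
  also have "\<dots> = (\<Sum>v\<le>n. \<Sum>\<omega>\<in>{\<omega> \<in> ?S. comm_cycles n \<omega> = v}. (1 / (fact n)\<^sup>2) *\<^sub>R F (comm_cycles n \<omega>))"
    by (rule sum.group[symmetric]) (use set_unif_pairs le in auto)
  also have "\<dots> = (\<Sum>v\<le>n. comm_prob n v *\<^sub>R F v)"
  proof (intro sum.cong refl)
    fix v
    have "(\<Sum>\<omega>\<in>{\<omega> \<in> ?S. comm_cycles n \<omega> = v}. (1 / (fact n)\<^sup>2) *\<^sub>R F (comm_cycles n \<omega>)) =
      (\<Sum>\<omega>\<in>{\<omega> \<in> ?S. comm_cycles n \<omega> = v}. (1 / (fact n)\<^sup>2) *\<^sub>R F v)"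
      by (intro sum.cong refl) auto
    also have "\<dots> = comm_prob n v *\<^sub>R F v"
      unfolding comm_prob_card by (simp add: sum_constant_scaleR)
    finally show "(\<Sum>\<omega>\<in>{\<omega> \<in> ?S. comm_cycles n \<omega> = v}. (1 / (fact n)\<^sup>2) *\<^sub>R F (comm_cycles n \<omega>)) = comm_prob n v *\<^sub>R F v" .
  qed
  finally show ?thesis by (simp add: comm_mean_def F_def)
qed

lemma prob_G: "measure_pmf.prob (unif_pairs n) {\<omega>. G n \<omega> = real n / 2 - real v / 2 + 1} = comm_prob n v"
proof -
  have "measure_pmf.prob (unif_pairs n) {\<omega>. G n \<omega> = real n / 2 - real v / 2 + 1} =
    measure_pmf.prob (unif_pairs n) {\<omega>. comm_cycles n \<omega> = v}"
  proof (rule measure_prob_cong_0)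
    fix \<omega> assume "\<omega> \<in> {\<omega>. G n \<omega> = real n / 2 - real v / 2 + 1} - {\<omega>. comm_cycles n \<omega> = v}"
    then show "pmf (unif_pairs n) \<omega> = 0"
      using set_unif_pairs[of n] euler_char_eq[of "fst \<omega>" n "snd \<omega>"]
      by (cases "\<omega> \<in> sym_group n \<times> sym_group n")
        (auto simp: unif_pairs_def G_def comm_cycles_def sym_group_def field_simps)
  next
    fix \<omega> assume "\<omega> \<in> {\<omega>. comm_cycles n \<omega> = v} - {\<omega>. G n \<omega> = real n / 2 - real v / 2 + 1}"
    then show "pmf (unif_pairs n) \<omega> = 0"
      using set_unif_pairs[of n] euler_char_eq[of "fst \<omega>" n "snd \<omega>"]
      by (cases "\<omega> \<in> sym_group n \<times> sym_group n")
        (auto simp: unif_pairs_def G_def comm_cycles_def sym_group_def field_simps)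
  qed
  then show ?thesis by (simp add: comm_prob_def)
qed

lemma comm_mean_one: "comm_mean n (\<lambda>_. 1) = (1::real)"
  using expectation_G[where H = "\<lambda>_. 1::real" and n = n] by simp

lemma mean_G_eq: "mean_G n = 1 + real n / 2 - comm_mean n real / 2"
proof -
  have "mean_G n = comm_mean n (\<lambda>v. 1 + real n / 2 - real v / 2)"
    unfolding mean_G_def using expectation_G[where H = "\<lambda>x. x" and n = n] by simp
  also have "\<dots> = (1 + real n / 2) * comm_mean n (\<lambda>_. 1) - comm_mean n real / 2"
    unfolding comm_mean_def by (simp add: sum_distrib_left sum_subtractf sum_divide_distrib algebra_simps sum.distrib)
  finally show ?thesis by (simp add: comm_mean_one)
qed

lemma var_G_eq: "var_G n = (comm_mean n (\<lambda>v. (real v)\<^sup>2) - (comm_mean n real)\<^sup>2) / 4"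
proof -
  define m where "m = comm_mean n real"
  have "var_G n = comm_mean n (\<lambda>v. (1 + real n / 2 - real v / 2 - mean_G n)\<^sup>2)"
    unfolding var_G_def mean_G_def[symmetric] using expectation_G[where H = "\<lambda>x. (x - mean_G n)\<^sup>2" and n = n] by simp
  also have "\<dots> = comm_mean n (\<lambda>v. (m\<^sup>2 / 4) * 1 - (m / 2) * real v + (real v)\<^sup>2 / 4)"
  proof -
    have "(1 + real n / 2 - x / 2 - (1 + real n / 2 - m / 2))\<^sup>2 = (m\<^sup>2 / 4) * 1 - (m / 2) * x + x\<^sup>2 / 4" for x
      by (simp add: power2_eq_square field_simps)
    then show ?thesis unfolding mean_G_eq m_def[symmetric] by (simp only:)
  qed
  also have "\<dots> = (m\<^sup>2 / 4) * comm_mean n (\<lambda>_. 1) - (m / 2) * comm_mean n real + comm_mean n (\<lambda>v. (real v)\<^sup>2) / 4"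
    unfolding comm_mean_def by (simp add: sum_distrib_left sum_subtractf sum_divide_distrib sum_distrib_right sum.distrib algebra_simps)
  finally show ?thesis by (simp add: comm_mean_one m_def power2_eq_square field_simps)
qed

section \<open>Asymptotics of the mean and the variance\<close>

lemma A_minus_ln: "(\<lambda>n. A n - ln (real n)) \<longlonglongrightarrow> euler_mascheroni"
proof -
  have "A n = harm n" for n by (simp add: A_def harm_def inverse_eq_divide)
  then show ?thesis using euler_mascheroni_LIMSEQ by simp
qed

lemma B_minus_ln: "(\<lambda>n. B n - ln (real n)) \<longlonglongrightarrow> euler_mascheroni - pi\<^sup>2 / 6"
proof -
  have e: "B n = A n - (\<Sum>i<n. 1 / (real (Suc i))\<^sup>2)" for n
    by (induction n) (simp_all add: A_0 B_0 A_Suc B_Suc)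
  have "(\<lambda>n. \<Sum>i<n. 1 / (real (Suc i))\<^sup>2) \<longlonglongrightarrow> pi\<^sup>2 / 6"
    using inverse_squares_sums unfolding sums_def by (simp add: add.commute)
  then have "(\<lambda>n. (A n - ln (real n)) - (\<Sum>i<n. 1 / (real (Suc i))\<^sup>2)) \<longlonglongrightarrow> euler_mascheroni - pi\<^sup>2 / 6"
    by (intro tendsto_diff A_minus_ln)
  then show ?thesis by (simp add: e algebra_simps)
qed

lemma B_le_A: "B n \<le> A n"
  unfolding A_def B_def by (intro sum_mono) simp

lemma B_at_top: "filterlim B at_top sequentially"
proof -
  have "filterlim (\<lambda>n. (B n - ln (real n)) + ln (real n)) at_top sequentially"
    by (rule filterlim_tendsto_add_at_top[OF B_minus_ln]) real_asymp
  then show ?thesis by simp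
qed

lemma eventually_A_le: "eventually (\<lambda>n. A n \<le> ln (real n) + 1) sequentially"
proof -
  have "euler_mascheroni < (1::real)" using euler_mascheroni_less_13_over_22 by simp
  then have "eventually (\<lambda>n. A n - ln (real n) < 1) sequentially" by (rule order_tendstoD[OF A_minus_ln])
  then show ?thesis by (rule eventually_mono) simp
qed

lemma eventually_B_ge: "eventually (\<lambda>n. ln (real n) / 4 \<le> B n) sequentially"
proof -
  have "eventually (\<lambda>n. euler_mascheroni - pi\<^sup>2 / 6 - 1 < B n - ln (real n)) sequentially"
    by (rule order_tendstoD[OF B_minus_ln]) simp
  moreover have "eventually (\<lambda>n. 1 + pi\<^sup>2 / 6 - euler_mascheroni < 3 / 4 * ln (real n)) sequentially"
    by real_asymp
  ultimately show ?thesis by eventually_elim linarith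
qed

definition comm_err :: "nat \<Rightarrow> (nat \<Rightarrow> 'a::real_vector) \<Rightarrow> 'a" where
  "comm_err n F = comm_mean n F - cyc_mean n F - sgn_mean n F"

lemma norm_comm_err_le:
  fixes F :: "nat \<Rightarrow> 'a::real_normed_vector"
  assumes C: "\<And>N. (\<Sum>v\<le>N. \<bar>comm_rem n v\<bar> * (3/2) ^ v) \<le> C / sqrt n"
    and F: "\<And>v. norm (F v) \<le> M * (3/2) ^ v" and M: "M \<ge> 0"
  shows "norm (comm_err n F) \<le> M * (C / sqrt n)"
proof -
  have "norm (comm_err n F) = norm (\<Sum>v\<le>n. comm_rem n v *\<^sub>R F v)"
    by (simp add: comm_err_def comm_mean_eq)
  also have "\<dots> \<le> (\<Sum>v\<le>n. M * (\<bar>comm_rem n v\<bar> * (3/2) ^ v))"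
  proof (rule sum_norm_le)
    fix v
    have "\<bar>comm_rem n v\<bar> * norm (F v) \<le> \<bar>comm_rem n v\<bar> * (M * (3/2) ^ v)"
      by (intro mult_left_mono F) auto
    then show "norm (comm_rem n v *\<^sub>R F v) \<le> M * (\<bar>comm_rem n v\<bar> * (3/2) ^ v)" by (simp add: mult_ac)
  qed
  also have "\<dots> = M * (\<Sum>v\<le>n. \<bar>comm_rem n v\<bar> * (3/2) ^ v)" by (simp add: sum_distrib_left)
  also have "\<dots> \<le> M * (C / sqrt n)" by (intro mult_left_mono C M)
  finally show ?thesis .
qed

lemma power_growth: "real v \<le> 2 * (3/2) ^ v" "(real v)\<^sup>2 \<le> 25 * (3/2) ^ v"
proof -
  have "1 + real v * (1/2) \<le> (1 + 1/2 :: real) ^ v" by (rule Bernoulli_inequality) simp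
  then show "real v \<le> 2 * (3/2) ^ v" by simp
  \<comment> \<open>\<open>6/5\<close> serves because its square \<open>36/25\<close> is below
    \<open>3/2\<close>.\<close>
  have "1 + real v * (1/5) \<le> (1 + 1/5 :: real) ^ v" by (rule Bernoulli_inequality) simp
  then have "real v / 5 \<le> (6/5) ^ v" by simp
  then have "(real v / 5)\<^sup>2 \<le> ((6/5) ^ v)\<^sup>2" by (rule power_mono) simp
  also have "((6/5 :: real) ^ v)\<^sup>2 = (36/25) ^ v" by (simp add: power2_eq_square flip: power_mult_distrib)
  also have "\<dots> \<le> (3/2) ^ v" by (rule power_mono) auto
  finally have "(real v / 5)\<^sup>2 \<le> (3/2) ^ v" .
  moreover have "(real v)\<^sup>2 = 25 * (real v / 5)\<^sup>2" by (simp add: power_divide)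
  ultimately show "(real v)\<^sup>2 \<le> 25 * (3/2) ^ v" by linarith
qed

text \<open>A uniform permutation has exactly the moments \<open>A n\<close> and
  \<open>B n + (A n)^2\<close>; the sign terms are of order at most \<open>1 / n\<close> and the
  remainder is of order at most \<open>1 / sqrt n\<close>.\<close>

lemma
  shows comm_mean_id_bound: "\<exists>C\<ge>0. \<forall>n\<ge>2. \<bar>comm_mean n real - A n\<bar> \<le> C / sqrt n"
    and comm_mean_square_bound: "\<exists>C\<ge>0. \<forall>n\<ge>2. \<bar>comm_mean n (\<lambda>v. (real v)\<^sup>2) - (B n + (A n)\<^sup>2)\<bar> \<le> C / sqrt n"
proof -
  obtain C where C: "C \<ge> 0" "\<And>n N. n \<ge> 2 \<Longrightarrow> (\<Sum>v\<le>N. \<bar>comm_rem n v\<bar> * (3/2) ^ v) \<le> C / sqrt n"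
    using comm_rem_bound by blast
  have inv: "1 / real n \<le> 1 / sqrt n" if "n \<ge> 2" for n
    using that real_sqrt_le_mono[of 1 "real n"] sqrt_le_D[of "real n" "real n"]
    by (intro divide_left_mono) (auto simp: sqrt_le_D real_le_lsqrt power2_eq_square)
  have "\<bar>comm_mean n real - A n\<bar> \<le> (1 + 2 * C) / sqrt n" if n: "n \<ge> 2" for n
  proof -
    obtain m where m: "n = Suc (Suc m)" using n by (metis Suc_le_D numeral_2_eq_2 Suc_le_mono)
    have "\<bar>comm_err n real\<bar> \<le> 2 * (C / sqrt n)"
      using norm_comm_err_le[of n C real 2] C(2)[OF n] power_growth(1) by simp
    moreover have "\<bar>sgn_mean n real\<bar> \<le> 1 / sqrt n"
      using sgn_mean_id[of m] inv[OF n] m by simp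
    moreover have "comm_mean n real - A n = sgn_mean n real + comm_err n real"
      by (simp add: comm_err_def cyc_mean_id)
    moreover have "(1 + 2 * C) / sqrt n = 1 / sqrt n + 2 * (C / sqrt n)" by (simp add: add_divide_distrib)
    ultimately show ?thesis by linarith
  qed
  then show "\<exists>C\<ge>0. \<forall>n\<ge>2. \<bar>comm_mean n real - A n\<bar> \<le> C / sqrt n"
    using C(1) by (intro exI[of _ "1 + 2 * C"]) auto
  have "\<bar>comm_mean n (\<lambda>v. (real v)\<^sup>2) - (B n + (A n)\<^sup>2)\<bar> \<le> (4 + 25 * C) / sqrt n" if n: "n \<ge> 2" for n
  proof -
    obtain m where m: "n = Suc (Suc m)" using n by (metis Suc_le_D numeral_2_eq_2 Suc_le_mono)
    have "\<bar>comm_err n (\<lambda>v. (real v)\<^sup>2)\<bar> \<le> 25 * (C / sqrt n)"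
      using norm_comm_err_le[of n C "\<lambda>v. (real v)\<^sup>2" 25] C(2)[OF n] power_growth(2) by simp
    moreover have "\<bar>sgn_mean n (\<lambda>v. (real v)\<^sup>2)\<bar> \<le> 4 / sqrt n"
      using sgn_mean_square[of m] inv[OF n] m by simp
    moreover have "comm_mean n (\<lambda>v. (real v)\<^sup>2) - (B n + (A n)\<^sup>2) =
      sgn_mean n (\<lambda>v. (real v)\<^sup>2) + comm_err n (\<lambda>v. (real v)\<^sup>2)"
      by (simp add: comm_err_def cyc_mean_square)
    moreover have "(4 + 25 * C) / sqrt n = 4 / sqrt n + 25 * (C / sqrt n)" by (simp add: add_divide_distrib)
    ultimately show ?thesis by linarith
  qed
  then show "\<exists>C\<ge>0. \<forall>n\<ge>2. \<bar>comm_mean n (\<lambda>v. (real v)\<^sup>2) - (B n + (A n)\<^sup>2)\<bar> \<le> C / sqrt n"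
    using C(1) by (intro exI[of _ "4 + 25 * C"]) auto
qed

lemma tendsto_zero_by_bound:
  fixes f :: "nat \<Rightarrow> real"
  assumes "\<And>n. n \<ge> 2 \<Longrightarrow> \<bar>f n\<bar> \<le> C / sqrt n"
  shows "f \<longlonglongrightarrow> 0"
proof (rule Lim_null_comparison)
  show "eventually (\<lambda>n. norm (f n) \<le> C / sqrt n) sequentially"
    using eventually_ge_at_top[of 2] by eventually_elim (use assms in simp)
  show "(\<lambda>n. C / sqrt (real n)) \<longlonglongrightarrow> 0" by real_asymp
qed

lemma comm_mean_id_tendsto: "(\<lambda>n. comm_mean n real - A n) \<longlonglongrightarrow> 0"
proof -
  obtain C where "\<forall>n\<ge>2. \<bar>comm_mean n real - A n\<bar> \<le> C / sqrt n" using comm_mean_id_bound by blast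
  then show ?thesis by (intro tendsto_zero_by_bound[of _ C]) simp
qed

text \<open>The variance of the cycle count is \<open>4 * var_G n\<close>. The error of the mean
  enters it multiplied by \<open>A n\<close>, which grows like \<open>ln n\<close>; the rate
  \<open>1 / sqrt n\<close> absorbs this.\<close>

lemma var_tendsto: "(\<lambda>n. 4 * var_G n - B n) \<longlonglongrightarrow> 0"
proof -
  define e where "e n = comm_mean n real - A n" for n
  define e' where "e' n = comm_mean n (\<lambda>v. (real v)\<^sup>2) - (B n + (A n)\<^sup>2)" for n
  obtain C where C: "C \<ge> 0" "\<And>n. n \<ge> 2 \<Longrightarrow> \<bar>e n\<bar> \<le> C / sqrt n"
    using comm_mean_id_bound unfolding e_def by blast
  obtain C' where C': "\<forall>n\<ge>2. \<bar>e' n\<bar> \<le> C' / sqrt n"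
    using comm_mean_square_bound unfolding e'_def by (elim exE conjE)
  have e': "e' \<longlonglongrightarrow> 0" by (rule tendsto_zero_by_bound[of _ C']) (use C' in simp)
  have e: "e \<longlonglongrightarrow> 0" unfolding e_def by (rule comm_mean_id_tendsto)
  have Ae: "(\<lambda>n. A n * e n) \<longlonglongrightarrow> 0"
  proof (rule Lim_null_comparison)
    show "eventually (\<lambda>n. norm (A n * e n) \<le> (ln (real n) + 1) * (C / sqrt n)) sequentially"
      using eventually_A_le eventually_ge_at_top[of 2]
    proof eventually_elim
      case (elim n)
      have "0 \<le> A n" by (simp add: A_def sum_nonneg)
      then have "A n * \<bar>e n\<bar> \<le> (ln (real n) + 1) * (C / sqrt n)"
        using elim C(2)[of n] by (intro mult_mono) auto
      then show ?case using \<open>0 \<le> A n\<close> by (simp add: abs_mult)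
    qed
    show "(\<lambda>n. (ln (real n) + 1) * (C / sqrt (real n))) \<longlonglongrightarrow> 0" by real_asymp
  qed
  have "4 * var_G n - B n = e' n - 2 * (A n * e n) - (e n)\<^sup>2" for n
  proof -
    have v: "4 * var_G n = comm_mean n (\<lambda>v. (real v)\<^sup>2) - (comm_mean n real)\<^sup>2" unfolding var_G_eq by simp
    show ?thesis unfolding v e_def e'_def by (simp add: power2_eq_square algebra_simps)
  qed
  moreover have "(\<lambda>n. e' n - 2 * (A n * e n) - (e n)\<^sup>2) \<longlonglongrightarrow> 0 - 2 * 0 - 0\<^sup>2"
    by (intro tendsto_intros e e' Ae)
  ultimately show ?thesis by simp
qed

lemma mean_G_asymp:
  "(\<lambda>n. mean_G n - (real n / 2 - ln (real n) / 2 - euler_mascheroni / 2 + 1)) \<in> o(\<lambda>_. 1)"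
proof -
  have lim: "(\<lambda>n. - ((comm_mean n real - A n) + (A n - ln (real n)) - euler_mascheroni) / 2) \<longlonglongrightarrow>
    - (0 + euler_mascheroni - euler_mascheroni) / 2"
    by (intro tendsto_intros comm_mean_id_tendsto A_minus_ln) simp
  have eq: "- ((comm_mean n real - A n) + (A n - ln (real n)) - euler_mascheroni) / 2 =
    mean_G n - (real n / 2 - ln (real n) / 2 - euler_mascheroni / 2 + 1)" for n
    by (simp add: mean_G_eq field_simps)
  show ?thesis using lim unfolding eq by (intro smalloI_tendsto) simp_all
qed

lemma var_G_asymp:
  "(\<lambda>n. var_G n - (ln (real n) / 4 + euler_mascheroni / 4 - pi\<^sup>2 / 24)) \<in> o(\<lambda>_. 1)"
proof -
  have lim: "(\<lambda>n. ((4 * var_G n - B n) + (B n - ln (real n)) - (euler_mascheroni - pi\<^sup>2 / 6)) / 4) \<longlonglongrightarrow>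
    (0 + (euler_mascheroni - pi\<^sup>2 / 6) - (euler_mascheroni - pi\<^sup>2 / 6)) / 4"
    by (intro tendsto_intros var_tendsto B_minus_ln) simp
  have eq: "((4 * var_G n - B n) + (B n - ln (real n)) - (euler_mascheroni - pi\<^sup>2 / 6)) / 4 =
    var_G n - (ln (real n) / 4 + euler_mascheroni / 4 - pi\<^sup>2 / 24)" for n
    by (simp add: field_simps)
  show ?thesis using lim unfolding eq by (intro smalloI_tendsto) simp_all
qed

text \<open>The absolute errors are of order \<open>1 / B n\<close>, while the Gaussian term is at
  least a constant depending on \<open>a\<close> over \<open>sqrt (B n)\<close>; the relative error
  is thus of order \<open>1 / sqrt (B n)\<close>.\<close>

lemma genus_local_limit:
  fixes a :: real
  assumes a: "a > 0"
  shows "\<exists>C::real. \<forall>\<^sub>F n in sequentially. \<forall>l::int.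
              even (int n - l) \<and> (real_of_int l - A n) / sqrt (B n) \<in> {-a..a} \<longrightarrow>
              (\<exists>\<epsilon>::real. \<bar>\<epsilon>\<bar> \<le> C * ln (real n) powr (-1/2) \<and>
                 measure_pmf.prob (unif_pairs n)
                     {\<omega>. G n \<omega> = real n / 2 - real_of_int l / 2 + 1} =
                   (2 + \<epsilon>) * exp (- (real_of_int l - A n)\<^sup>2 / (2 * B n)) / sqrt (2 * pi * B n))"
proof -
  obtain C0 where C0: "C0 \<ge> 0" "\<And>n N. n \<ge> 2 \<Longrightarrow> (\<Sum>v\<le>N. \<bar>comm_rem n v\<bar> * (3/2) ^ v) \<le> C0 / sqrt n"
    using comm_rem_bound by blast
  define K where "K = (\<integral>s. llt_bound s \<partial>lborel)"
  have K0: "K \<ge> 0" unfolding K_def by (rule Bochner_Integration.integral_nonneg) (simp add: llt_bound_def)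
  \<comment> \<open>\<open>K / pi + C0\<close> bounds the absolute error times \<open>B n\<close>;
    the other factors come from dividing by the smallest Gaussian term, at
    \<open>\<bar>x\<bar> = a\<close>.\<close>
  define D where "D = sqrt (2 * pi) * exp (a\<^sup>2 / 2) * (K / pi + C0)"
  have D0: "D \<ge> 0" using K0 C0(1) by (simp add: D_def)
  \<comment> \<open>This gives \<open>B n \<le> A n \<le> sqrt n\<close>, so the remainder
    \<open>C0 / sqrt n\<close> is at most \<open>C0 / B n\<close>.\<close>
  have "eventually (\<lambda>n. ln (real n) + 1 \<le> sqrt (real n)) sequentially" by real_asymp
  \<comment> \<open>\<open>B n > a^2\<close> means \<open>a < b\<close>, so
    \<open>A n \<ge> b^2 > a * b\<close> and every admissible \<open>l\<close> is positive, hence a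
    possible number of cycles.\<close>
  moreover have "eventually (\<lambda>n. max 1 (a\<^sup>2 + 1) \<le> B n) sequentially"
    using B_at_top by (simp add: filterlim_at_top)
  ultimately have "\<forall>\<^sub>F n in sequentially. \<forall>l::int.
              even (int n - l) \<and> (real_of_int l - A n) / sqrt (B n) \<in> {-a..a} \<longrightarrow>
              (\<exists>\<epsilon>::real. \<bar>\<epsilon>\<bar> \<le> (2 * D) * ln (real n) powr (-1/2) \<and>
                 measure_pmf.prob (unif_pairs n)
                     {\<omega>. G n \<omega> = real n / 2 - real_of_int l / 2 + 1} =
                   (2 + \<epsilon>) * exp (- (real_of_int l - A n)\<^sup>2 / (2 * B n)) / sqrt (2 * pi * B n))"
    using eventually_A_le eventually_B_ge eventually_ge_at_top[of 2]
  proof eventually_elim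
    case (elim n)
    define b where "b = sqrt (B n)"
    have aB: "a\<^sup>2 + 1 \<le> B n" using elim(2) by simp
    have "B n > 0" using aB zero_le_power2[of a] by linarith
    then have b: "b > 0" "b\<^sup>2 = B n" "B n > 0" by (simp_all add: b_def)
    have ab: "a < b"
      unfolding b_def using aB by (intro real_less_rsqrt) linarith
    show ?case
    proof (intro allI impI)
      fix l :: int
      assume l: "even (int n - l) \<and> (real_of_int l - A n) / sqrt (B n) \<in> {-a..a}"
      define x where "x = (real_of_int l - A n) / b"
      have "x \<in> {-a..a}" using l unfolding x_def b_def by blast
      then have x: "\<bar>x\<bar> \<le> a" by auto
      have "real_of_int l = A n + b * x" using b by (simp add: x_def)
      moreover have "- (b * a) \<le> b * x"
        using mult_left_mono[of "- a" x b] x b by (simp add: abs_le_iff)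
      moreover have "b * a < b * b" using ab b by simp
      moreover have "b * b \<le> A n" using b B_le_A[of n] by (simp add: power2_eq_square)
      ultimately have "real_of_int l > 0" by linarith
      then have "l \<ge> 0" by simp
      then obtain v where v: "l = int v" by (rule nonneg_int_cases)
      have "even (int n - int v)" using l unfolding v by blast
      then have ev: "even (n + v)" by simp
      have P: "measure_pmf.prob (unif_pairs n) {\<omega>. G n \<omega> = real n / 2 - real_of_int l / 2 + 1} =
        2 * cyc_prob n v + comm_rem n v"
        using prob_G[of n v] ev by (simp add: v comm_rem_def)
      define N where "N = exp (- (x\<^sup>2 / 2)) / (sqrt (2 * pi) * b)"
      have N: "exp (- (real_of_int l - A n)\<^sup>2 / (2 * B n)) / sqrt (2 * pi * B n) = N"
        unfolding N_def x_def using b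
        by (simp add: power_divide real_sqrt_mult b_def)
      have Npos: "N > 0" using b by (simp add: N_def)
      have "\<bar>2 * pi * b * cyc_prob n v - sqrt (2 * pi) * exp (- (x\<^sup>2 / 2))\<bar> \<le> K / b"
        using cyc_prob_llt[OF b(3), of v] unfolding K_def x_def b_def v by simp
      moreover have "sqrt (2 * pi) * exp (- (x\<^sup>2 / 2)) = 2 * pi * b * N"
      proof -
        have "2 * pi = sqrt (2 * pi) * sqrt (2 * pi)" by simp
        then show ?thesis unfolding N_def using b by (simp add: field_simps)
      qed
      ultimately have "\<bar>2 * pi * b * (cyc_prob n v - N)\<bar> \<le> K / b" by (simp add: right_diff_distrib)
      then have c1: "\<bar>cyc_prob n v - N\<bar> \<le> K / (2 * pi * b\<^sup>2)"
      proof -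
        assume c: "\<bar>2 * pi * b * (cyc_prob n v - N)\<bar> \<le> K / b"
        have "\<bar>2 * pi * b * (cyc_prob n v - N)\<bar> = 2 * pi * b * \<bar>cyc_prob n v - N\<bar>"
          using b by (simp add: abs_mult)
        then have "2 * pi * b * \<bar>cyc_prob n v - N\<bar> * b \<le> K"
          using c pos_le_divide_eq[OF b(1)] by simp
        moreover have "2 * pi * b\<^sup>2 > 0" using b(1) by simp
        ultimately show ?thesis
          by (subst pos_le_divide_eq) (simp_all only: power2_eq_square mult_ac)
      qed
      have c2: "\<bar>comm_rem n v\<bar> \<le> C0 / b\<^sup>2"
      proof -
        have "\<bar>comm_rem n v\<bar> * 1 \<le> \<bar>comm_rem n v\<bar> * (3/2) ^ v"
          by (intro mult_left_mono one_le_power) auto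
        also have "\<dots> \<le> (\<Sum>v\<le>v. \<bar>comm_rem n v\<bar> * (3/2) ^ v)"
          by (rule member_le_sum) auto
        also have "\<dots> \<le> C0 / sqrt n" by (rule C0(2)[OF elim(5)])
        also have "\<dots> \<le> C0 / b\<^sup>2"
        proof (rule divide_left_mono)
          show "b\<^sup>2 \<le> sqrt n" using b(2) B_le_A[of n] elim(1,3) by linarith
        qed (use C0 b elim(5) in auto)
        finally show ?thesis by simp
      qed
      define \<epsilon> where "\<epsilon> = (2 * cyc_prob n v + comm_rem n v) / N - 2"
      have eN: "\<epsilon> * N = 2 * (cyc_prob n v - N) + comm_rem n v"
        using Npos by (simp add: \<epsilon>_def field_simps)
      have "\<bar>\<epsilon>\<bar> * N = \<bar>\<epsilon> * N\<bar>" using Npos by (simp add: abs_mult)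
      also have "\<dots> \<le> 2 * \<bar>cyc_prob n v - N\<bar> + \<bar>comm_rem n v\<bar>" unfolding eN
        using abs_triangle_ineq[of "2 * (cyc_prob n v - N)" "comm_rem n v"] by (simp only: abs_mult abs_numeral)
      also have "\<dots> \<le> 2 * (K / (2 * pi * b\<^sup>2)) + C0 / b\<^sup>2"
        by (intro add_mono mult_left_mono c1 c2) simp
      also have "\<dots> = (K / pi + C0) / b\<^sup>2" by (simp add: add_divide_distrib)
      finally have e1: "\<bar>\<epsilon>\<bar> * N \<le> (K / pi + C0) / b\<^sup>2" .
      have N2: "exp (- (a\<^sup>2 / 2)) / (sqrt (2 * pi) * b) \<le> N"
        unfolding N_def using b power_mono[OF x abs_ge_zero, of 2] by (intro divide_right_mono) auto
      have "\<bar>\<epsilon>\<bar> * (exp (- (a\<^sup>2 / 2)) / (sqrt (2 * pi) * b)) \<le> (K / pi + C0) / b\<^sup>2"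
        using e1 mult_left_mono[OF N2 abs_ge_zero[of \<epsilon>]] by linarith
      then have "\<bar>\<epsilon>\<bar> \<le> (K / pi + C0) / b\<^sup>2 * (sqrt (2 * pi) * b * exp (a\<^sup>2 / 2))"
        using b by (simp add: exp_minus field_simps)
      also have "\<dots> = D / b" using b(1) by (simp add: D_def power2_eq_square field_simps)
      also have "\<dots> \<le> (2 * D) * ln (real n) powr (-1/2)"
      proof -
        have ln0: "ln (real n) > 0" using elim(5) by simp
        \<comment> \<open>From \<open>ln n / 4 \<le> B n\<close>; this is the origin of the 2 in
          \<open>2 * D\<close>.\<close>
        have "sqrt (ln (real n)) = 2 * sqrt (ln (real n) / 4)" by (simp add: real_sqrt_divide)
        also have "\<dots> \<le> 2 * b" using elim(4) by (simp add: b_def)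
        finally have "1 / b \<le> 2 / sqrt (ln (real n))" using b ln0 by (simp add: field_simps)
        moreover have "ln (real n) powr (-1/2) = 1 / sqrt (ln (real n))"
          using ln0 by (simp add: powr_minus_divide powr_half_sqrt)
        ultimately show ?thesis using mult_left_mono[OF _ D0, of "1 / b" "2 / sqrt (ln (real n))"]
          by (simp add: mult.commute)
      qed
      finally have "\<bar>\<epsilon>\<bar> \<le> (2 * D) * ln (real n) powr (-1/2)" .
      moreover have "measure_pmf.prob (unif_pairs n) {\<omega>. G n \<omega> = real n / 2 - real_of_int l / 2 + 1} =
        (2 + \<epsilon>) * exp (- (real_of_int l - A n)\<^sup>2 / (2 * B n)) / sqrt (2 * pi * B n)"
        unfolding P times_divide_eq_right[symmetric] N using Npos by (simp add: \<epsilon>_def)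
      ultimately show "\<exists>\<epsilon>::real. \<bar>\<epsilon>\<bar> \<le> (2 * D) * ln (real n) powr (-1/2) \<and>
                 measure_pmf.prob (unif_pairs n)
                     {\<omega>. G n \<omega> = real n / 2 - real_of_int l / 2 + 1} =
                   (2 + \<epsilon>) * exp (- (real_of_int l - A n)\<^sup>2 / (2 * B n)) / sqrt (2 * pi * B n)" by blast
    qed
  qed
  then show ?thesis by blast
qed

section \<open>The central limit theorem\<close>

text \<open>\<open>(- 1) ^ v\<close> is \<open>iexp (pi * v)\<close>, so the sign shifts the
  frequency by \<open>pi\<close>; for small \<open>s\<close> the characteristic function there is
  exponentially small in \<open>B n\<close>.\<close>

lemma sgn_mean_iexp: "cmod (sgn_mean n (\<lambda>v. iexp (s * real v))) = cmod (cyc_char n (s + pi))"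
proof -
  have e: "iexp ((s + pi) * real v) = (- 1) ^ v *\<^sub>R iexp (s * real v)" for v
  proof -
    have "iexp ((s + pi) * real v) = iexp (s * real v) * exp (of_nat v * (\<i> * of_real pi))"
      unfolding exp_add[symmetric] by (simp add: algebra_simps)
    also have "exp (of_nat v * (\<i> * of_real pi)) = (- 1) ^ v"
      unfolding exp_of_nat_mult by simp
    finally show ?thesis by (simp add: scaleR_conv_of_real mult.commute)
  qed
  have "sgn_mean n (\<lambda>v. iexp (s * real v)) = (- 1) ^ n *\<^sub>R cyc_char n (s + pi)"
    unfolding sgn_mean_def cyc_char_def e cyc_mean_scaleR[symmetric] by (simp add: power_add)
  then show ?thesis by simp
qed

lemma comm_mean_mult: "comm_mean n (\<lambda>v. c * F v) = c * comm_mean n (F :: nat \<Rightarrow> complex)"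
  by (simp add: comm_mean_def sum_distrib_left)

lemma var_G_nonneg: "var_G n \<ge> 0"
  unfolding var_G_def by (rule measure_pmf.variance_positive)

text \<open>\<open>G n\<close> falls by 1/2 with each cycle, hence the minus sign and the 4 in the
  frequency \<open>s n\<close>.\<close>

lemma char_G:
  fixes t :: real
  defines "s n \<equiv> - t / sqrt (4 * var_G n)"
  shows "char (distr (measure_pmf (unif_pairs n)) borel (\<lambda>\<omega>. (G n \<omega> - mean_G n) / sqrt (var_G n))) t =
    iexp (- (s n * comm_mean n real)) * comm_mean n (\<lambda>v. iexp (s n * real v))"
proof -
  have "char (distr (measure_pmf (unif_pairs n)) borel (\<lambda>\<omega>. (G n \<omega> - mean_G n) / sqrt (var_G n))) t =
    (\<integral>\<omega>. iexp (t * ((G n \<omega> - mean_G n) / sqrt (var_G n))) \<partial>measure_pmf (unif_pairs n))"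
    unfolding char_def by (subst integral_distr) auto
  also have "\<dots> = comm_mean n (\<lambda>v. iexp (t * ((1 + real n / 2 - real v / 2 - mean_G n) / sqrt (var_G n))))"
    by (rule expectation_G[where H = "\<lambda>x. iexp (t * ((x - mean_G n) / sqrt (var_G n)))"])
  also have "\<dots> = comm_mean n (\<lambda>v. iexp (- (s n * comm_mean n real)) * iexp (s n * real v))"
  proof -
    have "t * ((1 + real n / 2 - real v / 2 - mean_G n) / sqrt (var_G n)) = - (s n * comm_mean n real) + s n * real v" for v
      unfolding mean_G_eq s_def real_sqrt_mult by (simp add: diff_divide_distrib add_divide_distrib algebra_simps)
    then show ?thesis by (simp only: of_real_add distrib_left exp_add)
  qed
  finally show ?thesis by (simp only: comm_mean_mult)
qed

text \<open>The characteristic function splits into the parts of the uniform cycle count, the sign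
  and the remainder; only the first survives in the limit.\<close>

lemma genus_central_limit:
  "weak_conv_m
     (\<lambda>n. distr (measure_pmf (unif_pairs n)) borel (\<lambda>\<omega>. (G n \<omega> - mean_G n) / sqrt (var_G n)))
     std_normal_distribution"
proof (rule levy_continuity)
  show "real_distribution (distr (measure_pmf (unif_pairs n)) borel (\<lambda>\<omega>. (G n \<omega> - mean_G n) / sqrt (var_G n)))" for n
    by (rule prob_space.real_distribution_distr[OF measure_pmf.prob_space_axioms]) simp
  show "real_distribution std_normal_distribution" by (rule real_dist_normal_dist)
  fix t :: real
  define D where "D n = 4 * var_G n" for n
  define s where "s n = - t / sqrt (D n)" for n
  obtain C where C: "C \<ge> 0" "\<And>n N. n \<ge> 2 \<Longrightarrow> (\<Sum>v\<le>N. \<bar>comm_rem n v\<bar> * (3/2) ^ v) \<le> C / sqrt n"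
    using comm_rem_bound by blast
  have Dt: "filterlim D at_top sequentially"
  proof -
    have "filterlim (\<lambda>n. (4 * var_G n - B n) + B n) at_top sequentially"
      by (rule filterlim_tendsto_add_at_top[OF var_tendsto B_at_top])
    then show ?thesis by (simp add: D_def[abs_def])
  qed
  have Dpos: "eventually (\<lambda>n. D n > 0) sequentially" using Dt by (simp add: filterlim_at_top_dense)
  have BD: "(\<lambda>n. B n / D n) \<longlonglongrightarrow> 1"
  proof -
    have "(\<lambda>n. (4 * var_G n - B n) / D n) \<longlonglongrightarrow> 0"
      by (rule tendsto_divide_0[OF var_tendsto filterlim_at_top_imp_at_infinity[OF Dt]])
    then have "(\<lambda>n. 1 - (4 * var_G n - B n) / D n) \<longlonglongrightarrow> 1 - 0" by (intro tendsto_intros)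
    moreover have "eventually (\<lambda>n. 1 - (4 * var_G n - B n) / D n = B n / D n) sequentially"
      using Dpos by eventually_elim (simp add: D_def field_simps)
    ultimately show ?thesis using tendsto_cong by fastforce
  qed
  have s0: "s \<longlonglongrightarrow> 0"
  proof -
    have "filterlim (\<lambda>n. sqrt (D n)) at_top sequentially"
      by (rule filterlim_compose[OF sqrt_at_top Dt])
    then show ?thesis unfolding s_def
      by (intro tendsto_divide_0[OF tendsto_const] filterlim_at_top_imp_at_infinity)
  qed
  have Bs: "(\<lambda>n. B n * (s n)\<^sup>2) \<longlonglongrightarrow> t\<^sup>2"
  proof -
    have "(\<lambda>n. t\<^sup>2 * (B n / D n)) \<longlonglongrightarrow> t\<^sup>2 * 1" by (intro tendsto_intros BD)
    moreover have "t\<^sup>2 * (B n / D n) = B n * (s n)\<^sup>2" for n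
      using var_G_nonneg[of n] by (simp add: s_def D_def power_divide)
    ultimately show ?thesis by simp
  qed
  have sle: "eventually (\<lambda>n. \<bar>s n\<bar> < 1) sequentially"
    using order_tendstoD(2)[OF tendsto_rabs_zero[OF s0], of 1] by simp
  define \<psi> where "\<psi> n = iexp (- (s n * A n)) * cyc_char n (s n)" for n
  have psi: "\<psi> \<longlonglongrightarrow> complex_of_real (exp (- (t\<^sup>2 / 2)))"
  proof -
    have "(\<lambda>n. \<psi> n - complex_of_real (exp (- (B n * (s n)\<^sup>2 / 2)))) \<longlonglongrightarrow> 0"
    proof (rule Lim_null_comparison)
      show "eventually (\<lambda>n. cmod (\<psi> n - complex_of_real (exp (- (B n * (s n)\<^sup>2 / 2)))) \<le> 3 * (B n * (s n)\<^sup>2 * \<bar>s n\<bar>)) sequentially"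
        using sle
      proof eventually_elim
        case (elim n)
        have Bn: "0 \<le> B n"
          unfolding B_def by (intro sum_nonneg) (simp add: power2_eq_square divide_simps)
        have "cmod (\<psi> n - complex_of_real (exp (- (B n * (s n)\<^sup>2 / 2)))) \<le> 3 * (B n * \<bar>s n\<bar> ^ 3) * exp (- (B n * (s n)\<^sup>2 / 12))"
          using cyc_char_approx[of "s n" n] elim pi_gt3 by (simp add: \<psi>_def)
        also have "\<dots> \<le> 3 * (B n * \<bar>s n\<bar> ^ 3) * 1"
          using Bn by (intro mult_left_mono) auto
        also have "\<dots> = 3 * (B n * (s n)\<^sup>2 * \<bar>s n\<bar>)"
          by (simp add: power3_eq_cube power2_eq_square)
        finally show ?case .
      qed
      have "(\<lambda>n. 3 * (B n * (s n)\<^sup>2 * \<bar>s n\<bar>)) \<longlonglongrightarrow> 3 * (t\<^sup>2 * 0)"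
        by (intro tendsto_intros Bs tendsto_rabs_zero[OF s0])
      then show "(\<lambda>n. 3 * (B n * (s n)\<^sup>2 * \<bar>s n\<bar>)) \<longlonglongrightarrow> 0" by simp
    qed
    moreover have "(\<lambda>n. complex_of_real (exp (- (B n * (s n)\<^sup>2 / 2)))) \<longlonglongrightarrow> complex_of_real (exp (- (t\<^sup>2 / 2)))"
      by (intro tendsto_intros Bs) simp
    ultimately show ?thesis using Lim_transform by fastforce
  qed
  \<comment> \<open>The genus is centred at its true mean, but \<open>\<psi>\<close> at
    \<open>A n\<close>; the phase between them tends to 1.\<close>
  have shift: "(\<lambda>n. iexp (- (s n * (comm_mean n real - A n)))) \<longlonglongrightarrow> 1"
  proof -
    have "(\<lambda>n. iexp (- (s n * (comm_mean n real - A n)))) \<longlonglongrightarrow> iexp (- (0 * 0))"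
      by (intro tendsto_intros s0 comm_mean_id_tendsto)
    then show ?thesis by simp
  qed
  have sgn: "(\<lambda>n. sgn_mean n (\<lambda>v. iexp (s n * real v))) \<longlonglongrightarrow> 0"
  proof (rule Lim_null_comparison)
    show "eventually (\<lambda>n. cmod (sgn_mean n (\<lambda>v. iexp (s n * real v))) \<le> exp (- B n)) sequentially"
      using sle
    proof eventually_elim
      case (elim n)
      have Bn: "0 \<le> B n"
        unfolding B_def by (intro sum_nonneg) (simp add: power2_eq_square divide_simps)
      \<comment> \<open>\<open>\<bar>s n\<bar> < 1\<close> keeps \<open>s n + pi\<close> where the
        cosine is at most 0.\<close>
      have "0 \<le> cos (s n)" by (rule cos_ge_zero) (use elim pi_gt3 in auto)
      then have "B n * 1 \<le> B n * (1 - cos (s n + pi))" using Bn by (intro mult_left_mono) auto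
      then have "exp (- (B n * (1 - cos (s n + pi)))) \<le> exp (- B n)" by simp
      then show ?case using norm_cyc_char_le[of n "s n + pi"] unfolding sgn_mean_iexp by linarith
    qed
    show "(\<lambda>n. exp (- B n)) \<longlonglongrightarrow> 0"
      by (rule filterlim_compose[OF exp_at_bot filterlim_compose[OF filterlim_uminus_at_bot_at_top B_at_top]])
  qed
  have err: "(\<lambda>n. comm_err n (\<lambda>v. iexp (s n * real v))) \<longlonglongrightarrow> 0"
  proof (rule Lim_null_comparison)
    show "eventually (\<lambda>n. cmod (comm_err n (\<lambda>v. iexp (s n * real v))) \<le> 1 * (C / sqrt n)) sequentially"
      using eventually_ge_at_top[of 2]
      by eventually_elim (rule norm_comm_err_le, use C(2) in \<open>auto intro: one_le_power\<close>)
    show "(\<lambda>n. 1 * (C / sqrt (real n))) \<longlonglongrightarrow> 0" by real_asymp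
  qed
  have small: "(\<lambda>n. iexp (- (s n * comm_mean n real)) *
      (sgn_mean n (\<lambda>v. iexp (s n * real v)) + comm_err n (\<lambda>v. iexp (s n * real v)))) \<longlonglongrightarrow> 0"
  proof (rule Lim_null_comparison)
    show "eventually (\<lambda>n. cmod (iexp (- (s n * comm_mean n real)) *
      (sgn_mean n (\<lambda>v. iexp (s n * real v)) + comm_err n (\<lambda>v. iexp (s n * real v)))) \<le>
      cmod (sgn_mean n (\<lambda>v. iexp (s n * real v)) + comm_err n (\<lambda>v. iexp (s n * real v)))) sequentially"
      by (simp add: norm_mult)
    show "(\<lambda>n. cmod (sgn_mean n (\<lambda>v. iexp (s n * real v)) + comm_err n (\<lambda>v. iexp (s n * real v)))) \<longlonglongrightarrow> 0"
      using tendsto_norm[OF tendsto_add[OF sgn err]] by simp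
  qed
  have eq: "char (distr (measure_pmf (unif_pairs n)) borel (\<lambda>\<omega>. (G n \<omega> - mean_G n) / sqrt (var_G n))) t =
    iexp (- (s n * (comm_mean n real - A n))) * \<psi> n + iexp (- (s n * comm_mean n real)) *
      (sgn_mean n (\<lambda>v. iexp (s n * real v)) + comm_err n (\<lambda>v. iexp (s n * real v)))" for n
  proof -
    have "iexp (- (s n * (comm_mean n real - A n))) * iexp (- (s n * A n)) = iexp (- (s n * comm_mean n real))"
      unfolding exp_add[symmetric] by (simp add: algebra_simps)
    moreover have "comm_mean n (\<lambda>v. iexp (s n * real v)) = cyc_char n (s n) +
      (sgn_mean n (\<lambda>v. iexp (s n * real v)) + comm_err n (\<lambda>v. iexp (s n * real v)))"
      by (simp add: comm_err_def cyc_char_def)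
    moreover have "- t / sqrt (4 * var_G n) = s n" by (simp add: s_def D_def)
    ultimately show ?thesis
      unfolding char_G \<psi>_def mult.assoc[symmetric] by (simp only: distrib_left)
  qed
  have "(\<lambda>n. iexp (- (s n * (comm_mean n real - A n))) * \<psi> n + iexp (- (s n * comm_mean n real)) *
      (sgn_mean n (\<lambda>v. iexp (s n * real v)) + comm_err n (\<lambda>v. iexp (s n * real v)))) \<longlonglongrightarrow>
    1 * complex_of_real (exp (- (t\<^sup>2 / 2))) + 0"
    by (intro tendsto_add tendsto_mult shift psi small)
  then show "(\<lambda>n. char (distr (measure_pmf (unif_pairs n)) borel (\<lambda>\<omega>. (G n \<omega> - mean_G n) / sqrt (var_G n))) t)
    \<longlonglongrightarrow> char std_normal_distribution t"
    unfolding eq char_std_normal_distribution by (simp add: exp_of_real[symmetric])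
qed

theorem mainTheorem1:
  shows "(\<forall>a::real. a > 0 \<longrightarrow>
           (\<exists>C::real. \<forall>\<^sub>F n in sequentially. \<forall>l::int.
              even (int n - l) \<and> (real_of_int l - A n) / sqrt (B n) \<in> {-a..a} \<longrightarrow>
              (\<exists>\<epsilon>::real. \<bar>\<epsilon>\<bar> \<le> C * ln (real n) powr (-1/2) \<and>
                 measure_pmf.prob (unif_pairs n)
                     {\<omega>. G n \<omega> = real n / 2 - real_of_int l / 2 + 1} =
                   (2 + \<epsilon>) * exp (- (real_of_int l - A n)\<^sup>2 / (2 * B n)) / sqrt (2 * pi * B n))))
       \<and> weak_conv_m
           (\<lambda>n. distr (measure_pmf (unif_pairs n)) borel (\<lambda>\<omega>. (G n \<omega> - mean_G n) / sqrt (var_G n)))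
           std_normal_distribution
       \<and> (\<lambda>n. mean_G n - (real n / 2 - ln (real n) / 2 - euler_mascheroni / 2 + 1)) \<in> o(\<lambda>_. 1)
       \<and> (\<lambda>n. var_G n - (ln (real n) / 4 + euler_mascheroni / 4 - pi\<^sup>2 / 24)) \<in> o(\<lambda>_. 1)"
  using genus_local_limit genus_central_limit mean_G_asymp var_G_asymp by blast

end
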